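(* Let $\eta>0$. If $u\in H^{3/2+\eta}(\Omega)\cap W^{1,\infty}(\Omega)$ satisfies $\mathcal{I}(u)=0$, then $u=0$ in $\Omega$.
   Context: $\Omega$ is a bounded $C^{1,1}$ domain of $\mathbb{R}^n$, $n\ge 2$. $A=(a^{k\ell})$ is a symmetric matrix with coefficients $a^{k\ell}\in C^{2,1}(\overline{\Omega})$, $1\le k,\ell\le n$, and $\varkappa>1$ is a constant such that \[ \varkappa^{-1}|\xi|^2\le A(x)\xi\cdot\xi\quad (x\in\overline{\Omega},\ \xi\in\mathbb{R}^n),\qquad \max_{1\le k,\ell\le n}\|a^{k\ell}\|_{C^{2,1}(\overline{\Omega})}\le\varkappa . \] $f:\Omega\times\mathbb{R}^{n+1}\to\mathbb{R}$ is a measurable function such that for each $\delta>0$ there is a nonnegative function $g_\delta\in L^\infty(\Omega)$ with $|f(\cdot,z)|\le g_\delta|z|$ for $|z|\le\delta$. The semilinear operator is $\mathscr{E}u=\mathrm{div}(A\nabla u)+f(\cdot,u(\cdot),\nabla u(\cdot))$, with $\mathrm{div}(A\nabla u)$ understood in the sense of distributions. $\omega\Subset\Omega$ is a fixed nonempty open set and \[ \mathcal{I}(u)=\|u\|_{L^2(\omega)}+\|\mathscr{E}u\|_{L^2(\Omega)}. \] The condition $\mathcal{I}(u)=0$ means $u=0$ in $\omega$ and $\mathscr{E}u=0$ in $\Omega$. *)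

theory Defs
  imports "HOL-Analysis.Analysis"
begin

section \<open>Partial derivatives and classical function spaces\<close>

definition partial :: "'n \<Rightarrow> (real ^ 'n \<Rightarrow> real) \<Rightarrow> real ^ 'n \<Rightarrow> real" where
  "partial i f x = frechet_derivative f (at x) (axis i 1)"

text \<open>Multi-indices are lists of coordinate directions, and the order of the derivative is the
  length of the list.\<close>

definition partials :: "'n list \<Rightarrow> (real ^ 'n \<Rightarrow> real) \<Rightarrow> real ^ 'n \<Rightarrow> real" where
  "partials \<alpha> f = foldr partial \<alpha> f"

text \<open>The space \<open>C\<^sup>k\<^sup>,\<^sup>1\<close> on the closure of an open set: all derivatives up to order \<open>k\<close> extend
  continuously to the closure (for \<open>f\<close> itself the extension is \<open>f\<close>), and those of order \<open>k\<close> are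
  Lipschitz.\<close>

definition Ck1_closure :: "nat \<Rightarrow> (real ^ 'n) set \<Rightarrow> (real ^ 'n \<Rightarrow> real) \<Rightarrow> bool" where
  "Ck1_closure k \<Omega> f \<longleftrightarrow>
     continuous_on (closure \<Omega>) f \<and>
     (\<forall>\<alpha>. length \<alpha> < k \<longrightarrow> (\<forall>x\<in>\<Omega>. partials \<alpha> f differentiable (at x))) \<and>
     (\<forall>\<alpha>. length \<alpha> \<le> k \<longrightarrow>
        (\<exists>g. continuous_on (closure \<Omega>) g \<and> (\<forall>x\<in>\<Omega>. g x = partials \<alpha> f x))) \<and>
     (\<forall>\<alpha>. length \<alpha> = k \<longrightarrow> (\<exists>L. L-lipschitz_on \<Omega> (partials \<alpha> f)))"

text \<open>The usual norm: the sum over \<open>j \<le> k\<close> of the largest supremum of a derivative of order \<open>j\<close>,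
  plus the largest Lipschitz seminorm of a derivative of order \<open>k\<close>.  The pairs \<open>x = y\<close>
  contribute \<open>0 / 0 = 0\<close>.\<close>

definition Ck1_norm :: "nat \<Rightarrow> (real ^ 'n) set \<Rightarrow> (real ^ 'n \<Rightarrow> real) \<Rightarrow> ennreal" where
  "Ck1_norm k \<Omega> f =
     (\<Sum>j\<le>k. SUP \<alpha>\<in>{\<alpha>. length \<alpha> = j}. SUP x\<in>\<Omega>. ennreal \<bar>partials \<alpha> f x\<bar>)
     + (SUP \<alpha>\<in>{\<alpha>. length \<alpha> = k}. SUP x\<in>\<Omega>. SUP y\<in>\<Omega>.
          ennreal (\<bar>partials \<alpha> f x - partials \<alpha> f y\<bar> / dist x y))"

definition C11 :: "(real ^ 'n \<Rightarrow> real) \<Rightarrow> bool" where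
  "C11 \<gamma> \<longleftrightarrow> (\<exists>G L. (\<forall>x. (\<gamma> has_derivative (\<lambda>h. G x \<bullet> h)) (at x)) \<and>
                  L-lipschitz_on UNIV (G :: real ^ 'n \<Rightarrow> real ^ 'n))"

text \<open>Near each boundary point the set is the region above a \<open>C\<^sup>1\<^sup>,\<^sup>1\<close> graph.  The graph lives over the
  hyperplane orthogonal to the unit vector \<open>\<nu>\<close>: the function \<open>\<gamma>\<close> is only evaluated at the
  orthogonal projection \<open>x - (x \<bullet> \<nu>) \<nu>\<close>, which avoids a rotation of the coordinates and
  a separate type for the space of dimension \<open>n - 1\<close>.\<close>

definition C11_domain :: "(real ^ 'n) set \<Rightarrow> bool" where
  "C11_domain \<Omega> \<longleftrightarrow>
     open \<Omega> \<and> connected \<Omega> \<and> \<Omega> \<noteq> {} \<and>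
     (\<forall>x0\<in>frontier \<Omega>. \<exists>r>0. \<exists>\<nu> \<gamma>. norm \<nu> = 1 \<and> C11 \<gamma> \<and>
        \<Omega> \<inter> ball x0 r = {x \<in> ball x0 r. x \<bullet> \<nu> > \<gamma> (x - (x \<bullet> \<nu>) *\<^sub>R \<nu>)})"

definition compactly_contained :: "(real ^ 'n) set \<Rightarrow> (real ^ 'n) set \<Rightarrow> bool" where
  "compactly_contained \<omega> \<Omega> \<longleftrightarrow> compact (closure \<omega>) \<and> closure \<omega> \<subseteq> \<Omega>"

section \<open>Lebesgue and Sobolev spaces\<close>

definition mem_L2 :: "(real ^ 'n) set \<Rightarrow> (real ^ 'n \<Rightarrow> real) \<Rightarrow> bool" where
  "mem_L2 S v \<longleftrightarrow>
     v \<in> borel_measurable (lebesgue_on S) \<and> integrable (lebesgue_on S) (\<lambda>x. (v x)\<^sup>2)"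

definition L2_norm :: "(real ^ 'n) set \<Rightarrow> (real ^ 'n \<Rightarrow> real) \<Rightarrow> ennreal" where
  "L2_norm S v = (if mem_L2 S v then ennreal (sqrt (\<integral>x. (v x)\<^sup>2 \<partial>lebesgue_on S)) else top)"

definition mem_Linf :: "(real ^ 'n) set \<Rightarrow> (real ^ 'n \<Rightarrow> real) \<Rightarrow> bool" where
  "mem_Linf S v \<longleftrightarrow>
     v \<in> borel_measurable (lebesgue_on S) \<and> (\<exists>C. AE x in lebesgue_on S. \<bar>v x\<bar> \<le> C)"

definition locally_integrable :: "(real ^ 'n) set \<Rightarrow> (real ^ 'n \<Rightarrow> real) \<Rightarrow> bool" where
  "locally_integrable \<Omega> v \<longleftrightarrow>
     (\<forall>K. compact K \<and> K \<subseteq> \<Omega> \<longrightarrow> integrable (lebesgue_on K) v)"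

definition test_function :: "(real ^ 'n) set \<Rightarrow> (real ^ 'n \<Rightarrow> real) \<Rightarrow> bool" where
  "test_function \<Omega> \<phi> \<longleftrightarrow>
     (\<forall>\<alpha> x. partials \<alpha> \<phi> differentiable (at x)) \<and>
     compact (closure {x. \<phi> x \<noteq> 0}) \<and> closure {x. \<phi> x \<noteq> 0} \<subseteq> \<Omega>"

definition has_weak_deriv ::
  "(real ^ 'n) set \<Rightarrow> 'n list \<Rightarrow> (real ^ 'n \<Rightarrow> real) \<Rightarrow> (real ^ 'n \<Rightarrow> real) \<Rightarrow> bool" where
  "has_weak_deriv \<Omega> \<alpha> u v \<longleftrightarrow>
     locally_integrable \<Omega> u \<and> locally_integrable \<Omega> v \<and>
     (\<forall>\<phi>. test_function \<Omega> \<phi> \<longrightarrow>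
        (\<integral>x. u x * partials \<alpha> \<phi> x \<partial>lebesgue_on \<Omega>)
          = (-1) ^ length \<alpha> * (\<integral>x. v x * \<phi> x \<partial>lebesgue_on \<Omega>))"

definition weak_gradient ::
  "(real ^ 'n) set \<Rightarrow> (real ^ 'n \<Rightarrow> real) \<Rightarrow> real ^ 'n \<Rightarrow> real ^ 'n" where
  "weak_gradient \<Omega> u = (SOME G. \<forall>i. has_weak_deriv \<Omega> [i] u (\<lambda>x. G x $ i))"

definition mem_W1inf :: "(real ^ 'n) set \<Rightarrow> (real ^ 'n \<Rightarrow> real) \<Rightarrow> bool" where
  "mem_W1inf \<Omega> u \<longleftrightarrow>
     mem_Linf \<Omega> u \<and> (\<forall>i. \<exists>v. has_weak_deriv \<Omega> [i] u v \<and> mem_Linf \<Omega> v)"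

text \<open>The squared Gagliardo seminorm of order \<open>\<sigma> \<in> (0,1)\<close>.\<close>

definition gagliardo :: "real \<Rightarrow> (real ^ 'n) set \<Rightarrow> (real ^ 'n \<Rightarrow> real) \<Rightarrow> ennreal" where
  "gagliardo \<sigma> \<Omega> v =
     (\<integral>\<^sup>+ x. (\<integral>\<^sup>+ y. ennreal ((v x - v y)\<^sup>2 / dist x y powr (real CARD('n) + 2 * \<sigma>))
        \<partial>lebesgue_on \<Omega>) \<partial>lebesgue_on \<Omega>)"

text \<open>The Sobolev (Sobolev--Slobodeckij) space \<open>H\<^sup>s\<close> for real \<open>s \<ge> 0\<close>: all weak derivatives up to
  order \<open>\<lfloor>s\<rfloor>\<close> are square integrable and, if \<open>s\<close> is not an integer, those of order \<open>\<lfloor>s\<rfloor>\<close> have finite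
  Gagliardo seminorm of order \<open>s - \<lfloor>s\<rfloor>\<close>.\<close>

definition mem_H :: "real \<Rightarrow> (real ^ 'n) set \<Rightarrow> (real ^ 'n \<Rightarrow> real) \<Rightarrow> bool" where
  "mem_H s \<Omega> u \<longleftrightarrow>
     mem_L2 \<Omega> u \<and>
     (\<forall>\<alpha>. length \<alpha> \<le> nat \<lfloor>s\<rfloor> \<longrightarrow>
        (\<exists>v. has_weak_deriv \<Omega> \<alpha> u v \<and> mem_L2 \<Omega> v \<and>
             (length \<alpha> = nat \<lfloor>s\<rfloor> \<and> frac s > 0 \<longrightarrow> gagliardo (frac s) \<Omega> v < top)))"

section \<open>The semilinear operator and the observation\<close>

text \<open>The nonlinearity is a function of \<open>(x, z)\<close> with \<open>z\<close> in \<open>real \<times> (real ^ 'n)\<close>, whose norm is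
  the Euclidean norm of the space of dimension \<open>n + 1\<close>.  The exceptional null set in the
  growth bound does not depend on \<open>z\<close>.\<close>

definition admissible_nonlinearity ::
  "(real ^ 'n) set \<Rightarrow> ((real ^ 'n) \<times> (real \<times> (real ^ 'n)) \<Rightarrow> real) \<Rightarrow> bool" where
  "admissible_nonlinearity \<Omega> f \<longleftrightarrow>
     f \<in> borel_measurable (lebesgue_on (\<Omega> \<times> UNIV)) \<and>
     (\<forall>\<delta>>0. \<exists>g. mem_Linf \<Omega> g \<and>
        (AE x in lebesgue_on \<Omega>. 0 \<le> g x \<and>
           (\<forall>z. norm z \<le> \<delta> \<longrightarrow> \<bar>f (x, z)\<bar> \<le> g x * norm z)))"

definition nonlinear_term ::
  "(real ^ 'n) set \<Rightarrow> ((real ^ 'n) \<times> (real \<times> (real ^ 'n)) \<Rightarrow> real)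
     \<Rightarrow> (real ^ 'n \<Rightarrow> real) \<Rightarrow> real ^ 'n \<Rightarrow> real" where
  "nonlinear_term \<Omega> f u x = f (x, u x, weak_gradient \<Omega> u x)"

text \<open>The distribution \<open>div (A \<nabla>u) + f(\<cdot>, u, \<nabla>u)\<close>, as a functional on test functions.\<close>

definition semilinear_op ::
  "(real ^ 'n) set \<Rightarrow> (real ^ 'n \<Rightarrow> real ^ 'n ^ 'n)
     \<Rightarrow> ((real ^ 'n) \<times> (real \<times> (real ^ 'n)) \<Rightarrow> real)
     \<Rightarrow> (real ^ 'n \<Rightarrow> real) \<Rightarrow> (real ^ 'n \<Rightarrow> real) \<Rightarrow> real" where
  "semilinear_op \<Omega> A f u \<phi> =
     - (\<integral>x. (A x *v weak_gradient \<Omega> u x) \<bullet> (\<chi> i. partial i \<phi> x) \<partial>lebesgue_on \<Omega>)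
     + (\<integral>x. nonlinear_term \<Omega> f u x * \<phi> x \<partial>lebesgue_on \<Omega>)"

text \<open>The distribution above is the function \<open>w\<close>.  For a Lebesgue measurable nonlinearity
  \<open>f(\<cdot>, u, \<nabla>u)\<close> need not be measurable, so that it defines a distribution (is locally integrable)
  is part of the condition; otherwise its Bochner integrals would be \<open>0\<close> by convention.\<close>

definition semilinear_op_eq ::
  "(real ^ 'n) set \<Rightarrow> (real ^ 'n \<Rightarrow> real ^ 'n ^ 'n)
     \<Rightarrow> ((real ^ 'n) \<times> (real \<times> (real ^ 'n)) \<Rightarrow> real)
     \<Rightarrow> (real ^ 'n \<Rightarrow> real) \<Rightarrow> (real ^ 'n \<Rightarrow> real) \<Rightarrow> bool" where
  "semilinear_op_eq \<Omega> A f u w \<longleftrightarrow>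
     locally_integrable \<Omega> (nonlinear_term \<Omega> f u) \<and> locally_integrable \<Omega> w \<and>
     (\<forall>\<phi>. test_function \<Omega> \<phi> \<longrightarrow>
        semilinear_op \<Omega> A f u \<phi> = (\<integral>x. w x * \<phi> x \<partial>lebesgue_on \<Omega>))"

text \<open>The norm is infinite when the distribution is not a square integrable function.\<close>

definition semilinear_op_L2_norm ::
  "(real ^ 'n) set \<Rightarrow> (real ^ 'n \<Rightarrow> real ^ 'n ^ 'n)
     \<Rightarrow> ((real ^ 'n) \<times> (real \<times> (real ^ 'n)) \<Rightarrow> real) \<Rightarrow> (real ^ 'n \<Rightarrow> real) \<Rightarrow> ennreal" where
  "semilinear_op_L2_norm \<Omega> A f u =
     (if \<exists>w. mem_L2 \<Omega> w \<and> semilinear_op_eq \<Omega> A f u w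
      then L2_norm \<Omega> (SOME w. mem_L2 \<Omega> w \<and> semilinear_op_eq \<Omega> A f u w) else top)"

definition observation ::
  "(real ^ 'n) set \<Rightarrow> (real ^ 'n) set \<Rightarrow> (real ^ 'n \<Rightarrow> real ^ 'n ^ 'n)
     \<Rightarrow> ((real ^ 'n) \<times> (real \<times> (real ^ 'n)) \<Rightarrow> real) \<Rightarrow> (real ^ 'n \<Rightarrow> real) \<Rightarrow> ennreal" where
  "observation \<omega> \<Omega> A f u = L2_norm \<omega> u + semilinear_op_L2_norm \<Omega> A f u"

lemma L2_norm_eq_0:
  assumes "L2_norm S v = 0"
  shows "AE x in lebesgue_on S. v x = 0"
proof -
  have m: "mem_L2 S v" using assms by (auto simp: L2_norm_def split: if_splits)
  then have "ennreal (sqrt (\<integral>x. (v x)\<^sup>2 \<partial>lebesgue_on S)) = 0"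
    using assms by (simp add: L2_norm_def)
  then have "(\<integral>x. (v x)\<^sup>2 \<partial>lebesgue_on S) \<le> 0"
    by (simp add: ennreal_eq_0_iff)
  moreover have "(\<integral>x. (v x)\<^sup>2 \<partial>lebesgue_on S) \<ge> 0" by simp
  ultimately have "(\<integral>x. (v x)\<^sup>2 \<partial>lebesgue_on S) = 0" by linarith
  then have "AE x in lebesgue_on S. (v x)\<^sup>2 = 0"
    using m integral_nonneg_eq_0_iff_AE[of "lebesgue_on S" "\<lambda>x. (v x)\<^sup>2"]
    by (simp add: mem_L2_def)
  then show ?thesis by simp
qed

text \<open>The vanishing of the observation means \<open>u = 0\<close> in \<open>\<omega>\<close> and that the distribution is zero.\<close>

lemma observation_eq_0D:
  assumes "observation \<omega> \<Omega> A f u = 0"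
  shows "AE x in lebesgue_on \<omega>. u x = 0"
    and "locally_integrable \<Omega> (nonlinear_term \<Omega> f u)"
    and "test_function \<Omega> \<phi> \<Longrightarrow> semilinear_op \<Omega> A f u \<phi> = 0"
proof -
  have a: "L2_norm \<omega> u = 0" and b: "semilinear_op_L2_norm \<Omega> A f u = 0"
    using assms by (auto simp: observation_def)
  show "AE x in lebesgue_on \<omega>. u x = 0" by (rule L2_norm_eq_0[OF a])
  define P where "P w \<longleftrightarrow> mem_L2 \<Omega> w \<and> semilinear_op_eq \<Omega> A f u w" for w
  define w where "w = (SOME w. P w)"
  have "\<exists>w. P w" and n: "L2_norm \<Omega> w = 0"
    using b by (auto simp: semilinear_op_L2_norm_def P_def w_def split: if_splits)
  then have "P w" unfolding w_def by (metis someI_ex)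
  then have e: "semilinear_op_eq \<Omega> A f u w" by (simp add: P_def)
  then show "locally_integrable \<Omega> (nonlinear_term \<Omega> f u)"
    by (simp add: semilinear_op_eq_def)
  have z: "AE x in lebesgue_on \<Omega>. w x = 0" by (rule L2_norm_eq_0[OF n])
  show "semilinear_op \<Omega> A f u \<phi> = 0" if "test_function \<Omega> \<phi>"
  proof -
    have "(\<integral>x. w x * \<phi> x \<partial>lebesgue_on \<Omega>) = 0"
      by (rule integral_eq_zero_AE) (use z in auto)
    then show ?thesis using e that by (simp add: semilinear_op_eq_def)
  qed
qed

end

theory Submission
  imports Defs
begin

text \<open>Only local information is used: \<open>G = \<nabla>u\<close> is bounded, \<open>div (A G) = - F\<close> with
  \<open>\<bar>F\<bar> \<le> L \<bar>(u, G)\<bar>\<close>, and \<open>A\<close> has bounded first derivatives.  Let \<open>u\<close> vanish near the centre \<open>y\<close> of a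
  ball \<open>B\<close> inside \<open>\<Omega>\<close>.  A Carleman estimate with weight \<open>exp (\<tau> exp (- \<mu> \<bar>x - y\<bar>\<^sup>2 / 2))\<close> holds for
  \<open>C\<^sup>2\<close> functions supported in \<open>B\<close> away from \<open>y\<close>.  It is applied to a cutoff times the mollification
  \<open>u\<^sub>\<epsilon>\<close>: by Friedrichs' commutator argument \<open>div (A \<nabla>u\<^sub>\<epsilon>)\<close> is bounded by an average of \<open>\<bar>(u, G)\<bar>\<close> over a
  ball of radius \<open>\<epsilon>\<close>, uniformly in \<open>\<epsilon>\<close>, and this error is absorbed for large \<open>\<tau>\<close> once \<open>\<epsilon> \<rightarrow> 0\<close>.
  The weight is radially decreasing, so the terms from the cutoff are dominated as \<open>\<tau> \<rightarrow> \<infinity>\<close>, and \<open>u\<close>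
  vanishes in all of \<open>B\<close>.  Since every point of \<open>\<Omega>\<close> in the closure of the zero region lies in such a
  ball, connectedness gives the claim.\<close>

section \<open>The divergence theorem for compactly supported fields\<close>

text \<open>The growth bound on \<open>f\<close> is used once, with the bound of
  \<open>(u, G)\<close> as radius; afterwards the nonlinear term is a fixed function
  \<open>F\<close> and the problem is a linear differential inequality. The obstacle is that the
  Carleman estimate needs two derivatives while only \<open>G\<close> is at hand. Mollifying the
  weak equation produces averages of \<bar>(u, G)\<bar> over small balls, which no pointwise value
  controls. Each average is therefore split into the value at the point and a mean oscillation. The
  value is absorbed because the left side of the estimate carries the factor \<tau>; the oscillation
  tends to 0 in the mean, without any rate, and since it is bounded its square does too. This
  dictates the order of the limits: \<epsilon> \<rightarrow> 0 for fixed \<tau>, then \<tau>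
  \<rightarrow> \<infinity>. The centre has to lie in the zero region because the gradient of the
  weight vanishes there; the distance \<open>r0\<close> kept from it fixes \<mu>, and \<mu> fixes
  the threshold for \<tau>.\<close>

lemma integrable_lborel_bounded_support:
  fixes f :: "'a::euclidean_space \<Rightarrow> 'b::{banach, second_countable_topology}"
  assumes "f \<in> borel_measurable borel" "\<And>x. norm (f x) \<le> C" "\<And>x. x \<notin> cball a r \<Longrightarrow> f x = 0"
  shows "integrable lborel f"
proof (rule Bochner_Integration.integrable_bound)
  show "integrable lborel (\<lambda>x. C * indicator (cball a r) x :: real)"
    by (intro integrable_mult_right integrable_real_indicator) (use emeasure_lborel_cball_finite in \<open>auto simp: less_top[symmetric]\<close>)
  show "AE x in lborel. norm (f x) \<le> norm (C * indicator (cball a r) x :: real)"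
  proof (rule AE_I2)
    fix x show "norm (f x) \<le> norm (C * indicator (cball a r) x :: real)"
      using assms(2)[of x] assms(3)[of x] by (cases "x \<in> cball a r") auto
  qed
qed (use assms in auto)

lemma integral_lborel_translate:
  fixes f :: "'a::euclidean_space \<Rightarrow> 'b::{banach, second_countable_topology}"
  assumes "f \<in> borel_measurable borel"
  shows "(\<integral>x. f (c + x) \<partial>lborel) = (\<integral>x. f x \<partial>lborel)"
proof -
  have "(\<integral>x. f x \<partial>lborel) = (\<integral>x. f x \<partial>distr lborel borel ((+) c))"
    by (simp add: lborel_distr_plus)
  also have "\<dots> = (\<integral>x. f (c + x) \<partial>lborel)"
    by (subst integral_distr) (use assms in auto)
  finally show ?thesis by simp
qed

lemma integrable_lborel_translate:
  fixes f :: "'a::euclidean_space \<Rightarrow> 'b::{banach, second_countable_topology}"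
  assumes "integrable lborel f"
  shows "integrable lborel (\<lambda>x. f (c + x))"
proof -
  have "integrable (distr lborel borel ((+) c)) f"
    using assms by (simp add: lborel_distr_plus)
  then show ?thesis by (subst (asm) integrable_distr_eq) (use assms in auto)
qed

text \<open>Translation invariance gives every difference quotient of \<open>h\<close> the integral
  0, the mean value theorem bounds the quotients by \<open>C\<close>, and dominated convergence
  passes to the derivative. No continuity of \<open>h'\<close> enters; even its measurability comes
  from the quotients. Bounded derivatives are all that \<open>bdiff_on\<close> provides.\<close>

lemma integral_directional_derivative_eq_0:
  fixes h :: "'a::euclidean_space \<Rightarrow> real"
  assumes der: "\<And>x. (h has_derivative h' x) (at x)"
    and bd: "\<And>x. \<bar>h' x e\<bar> \<le> C"
    and supp: "\<And>x. x \<notin> cball 0 r \<Longrightarrow> h x = 0"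
  shows "has_bochner_integral lborel (\<lambda>x. h' x e) 0"
proof -
  have C0: "0 \<le> C" using bd[of 0] by linarith
  have cont: "continuous_on UNIV h"
    using der by (meson has_derivative_continuous continuous_at_imp_continuous_on)
  have meas: "h \<in> borel_measurable borel" using cont by (rule borel_measurable_continuous_onI)
  define t :: "nat \<Rightarrow> real" where "t j = inverse (real (Suc j))" for j
  have t: "t j > 0" "t j \<le> 1" for j by (auto simp: t_def field_simps)
  define q where "q j x = (h (t j *\<^sub>R e + x) - h x) / t j" for j x
  have qmeas: "q j \<in> borel_measurable borel" for j
    unfolding q_def by (intro borel_measurable_divide borel_measurable_diff
      measurable_compose[OF _ meas]) auto
  have lim: "(\<lambda>j. q j x) \<longlonglongrightarrow> h' x e" for x
  proof -
    have "((\<lambda>s. h (x + s *\<^sub>R e)) has_derivative (\<lambda>s. h' x (s *\<^sub>R e))) (at 0)"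
      by (rule has_derivative_compose[where f="\<lambda>s. x + s *\<^sub>R e" and g=h])
         (auto intro!: derivative_eq_intros simp: der)
    moreover have "(\<lambda>s. h' x (s *\<^sub>R e)) = (\<lambda>s. h' x e * s)"
      using der[of x] by (auto simp: linear_scale has_derivative_linear)
    ultimately have "((\<lambda>s. h (x + s *\<^sub>R e)) has_field_derivative h' x e) (at 0)"
      by (simp add: has_field_derivative_def)
    then have "((\<lambda>s. (h (x + s *\<^sub>R e) - h x) / s) \<longlongrightarrow> h' x e) (at 0)"
      by (simp add: DERIV_def)
    moreover have "filterlim t (at 0) sequentially"
      unfolding filterlim_at t_def
      using LIMSEQ_inverse_real_of_nat by auto
    ultimately have "(\<lambda>j. (h (x + t j *\<^sub>R e) - h x) / t j) \<longlonglongrightarrow> h' x e"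
      by (rule filterlim_compose)
    then show ?thesis by (simp add: q_def add.commute)
  qed
  have qb: "\<bar>q j x\<bar> \<le> C" for j x
  proof -
    have "\<exists>s. s > 0 \<and> s < t j \<and> h (x + t j *\<^sub>R e) - h (x + 0 *\<^sub>R e) = (t j - 0) * h' (x + s *\<^sub>R e) e"
    proof (rule MVT2)
      show "0 < t j" by (rule t)
      fix s assume "0 \<le> s" "s \<le> t j"
      have "((\<lambda>s. h (x + s *\<^sub>R e)) has_derivative (\<lambda>d. h' (x + s *\<^sub>R e) (d *\<^sub>R e))) (at s)"
        by (rule has_derivative_compose[where f="\<lambda>s. x + s *\<^sub>R e" and g=h])
           (auto intro!: derivative_eq_intros simp: der)
      moreover have "(\<lambda>d. h' (x + s *\<^sub>R e) (d *\<^sub>R e)) = (\<lambda>d. h' (x + s *\<^sub>R e) e * d)"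
        using der[of "x + s *\<^sub>R e"] by (auto simp: linear_scale has_derivative_linear)
      ultimately show "((\<lambda>s. h (x + s *\<^sub>R e)) has_real_derivative h' (x + s *\<^sub>R e) e) (at s)"
        by (simp add: has_field_derivative_def)
    qed
    then obtain s where "h (x + t j *\<^sub>R e) - h x = t j * h' (x + s *\<^sub>R e) e" by auto
    then have "q j x = h' (x + s *\<^sub>R e) e" using t[of j] by (simp add: q_def add.commute)
    then show ?thesis using bd by simp
  qed
  \<comment> \<open>All steps \<open>t j\<close> are at most 1, so every quotient lives in the ball
    enlarged by \<open>norm e\<close>, and one dominating function serves for all
    \<open>j\<close>.\<close>
  have qs: "q j x = 0" if "x \<notin> cball 0 (r + norm e)" for j x
  proof -
    have "norm x > r + norm e" using that by simp
    moreover have "norm (t j *\<^sub>R e) \<le> norm e" using t[of j] by (simp add: mult_left_le_one_le)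
    ultimately have "norm (t j *\<^sub>R e + x) > r" "norm x > r"
      using norm_triangle_ineq2[of x "- (t j *\<^sub>R e)"] norm_ge_zero[of e]
      by (auto simp: add.commute, linarith+)
    then show ?thesis using supp by (simp add: q_def)
  qed
  have int_h: "integrable lborel h"
  proof -
    have "\<exists>B. \<forall>x\<in>cball 0 r. norm (h x) \<le> B"
    proof -
      have "compact (h ` cball 0 r)"
        using cont by (intro compact_continuous_image) (auto intro: continuous_on_subset)
      then have "bounded (h ` cball 0 r)" by (rule compact_imp_bounded)
      then show ?thesis by (simp add: bounded_iff)
    qed
    then obtain B where B: "\<And>x. x \<in> cball 0 r \<Longrightarrow> norm (h x) \<le> B" by blast
    show ?thesis
    proof (rule integrable_lborel_bounded_support[where C="\<bar>B\<bar>" and a=0 and r=r])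
      fix x show "norm (h x) \<le> \<bar>B\<bar>"
        using B[of x] supp[of x] by (cases "x \<in> cball 0 r") auto
    qed (use meas supp in auto)
  qed
  have iq: "(\<integral>x. q j x \<partial>lborel) = 0" for j
  proof -
    have "(\<integral>x. q j x \<partial>lborel) = ((\<integral>x. h (t j *\<^sub>R e + x) \<partial>lborel) - (\<integral>x. h x \<partial>lborel)) / t j"
      unfolding q_def using int_h integrable_lborel_translate[OF int_h] by simp
    then show ?thesis using integral_lborel_translate[OF meas] by simp
  qed
  define w :: "'a \<Rightarrow> real" where "w x = C * indicator (cball 0 (r + norm e)) x" for x
  have wint: "integrable lborel w" unfolding w_def
    by (intro integrable_mult_right integrable_real_indicator) (use emeasure_lborel_cball_finite in \<open>auto simp: less_top[symmetric]\<close>)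
  have wb: "norm (q j x) \<le> w x" for j x
    using qb[of j x] qs[of x j] by (cases "x \<in> cball 0 (r + norm e)") (auto simp: w_def)
  have hm: "(\<lambda>x. h' x e) \<in> borel_measurable lborel"
    by (rule borel_measurable_LIMSEQ_metric[where f=q]) (use qmeas lim in auto)
  have i: "integrable lborel (\<lambda>x. h' x e)"
    by (rule integrable_dominated_convergence[where s=q and w=w])
       (use hm qmeas wint lim wb in auto)
  have "(\<lambda>j. \<integral>x. q j x \<partial>lborel) \<longlonglongrightarrow> (\<integral>x. h' x e \<partial>lborel)"
    by (rule integral_dominated_convergence[where w=w])
       (use hm qmeas wint lim wb in auto)
  then have "(\<lambda>j. 0) \<longlonglongrightarrow> (\<integral>x. h' x e \<partial>lborel)" by (simp only: iq)
  then have "(\<integral>x. h' x e \<partial>lborel) = 0" by (simp add: LIMSEQ_const_iff)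
  with i show ?thesis by (simp add: has_bochner_integral_iff)
qed

section \<open>Differentiable maps with uniform bounds, and the divergence as a trace\<close>

definition lin_trace :: "('a::euclidean_space \<Rightarrow> 'a) \<Rightarrow> real" where
  "lin_trace L = (\<Sum>i\<in>Basis. L i \<bullet> i)"

text \<open>Carries the derivative together with bounds on both the map and the derivative, so that
  the closure rules compute the derivative of a long expression and prove it bounded in one
  pass.\<close>

definition bdiff_on ::
  "'a::real_normed_vector set \<Rightarrow> ('a \<Rightarrow> 'b::real_normed_vector) \<Rightarrow> ('a \<Rightarrow> 'a \<Rightarrow> 'b) \<Rightarrow> bool" where
  "bdiff_on S f f' \<longleftrightarrow> (\<exists>C\<ge>0. \<forall>x\<in>S. (f has_derivative f' x) (at x) \<and> norm (f x) \<le> C \<and>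
     (\<forall>h. norm (f' x h) \<le> C * norm h))"

lemma bdiff_onD: "bdiff_on S f f' \<Longrightarrow> x \<in> S \<Longrightarrow> (f has_derivative f' x) (at x)"
  by (auto simp: bdiff_on_def)

lemma bdiff_onI:
  fixes f :: "'a::real_normed_vector \<Rightarrow> 'b::real_normed_vector"
  assumes "\<And>x. x \<in> S \<Longrightarrow> (f has_derivative f' x) (at x)" "\<And>x. x \<in> S \<Longrightarrow> norm (f x) \<le> B"
    "\<And>x h. x \<in> S \<Longrightarrow> norm (f' x h) \<le> C * norm h"
  shows "bdiff_on S f f'"
  unfolding bdiff_on_def
proof (intro exI[of _ "max \<bar>B\<bar> \<bar>C\<bar>"] conjI ballI allI)
  fix x h :: 'a assume x: "x \<in> S"
  show "(f has_derivative f' x) (at x)" using assms(1) x by blast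
  show "norm (f x) \<le> max \<bar>B\<bar> \<bar>C\<bar>" using assms(2)[OF x] by linarith
  have "C * norm h \<le> max \<bar>B\<bar> \<bar>C\<bar> * norm h" by (intro mult_right_mono) auto
  then show "norm (f' x h) \<le> max \<bar>B\<bar> \<bar>C\<bar> * norm h" using assms(3)[OF x, of h] by linarith
qed auto

lemma bdiff_on_const: "bdiff_on S (\<lambda>x. c) (\<lambda>x h. 0)"
  by (rule bdiff_onI[where B="norm c" and C=0]) (auto intro: derivative_intros)

lemma bdiff_on_ident:
  assumes "bounded S" shows "bdiff_on S (\<lambda>x. x - a) (\<lambda>x h. h)"
proof -
  obtain B where "\<And>x. x \<in> S \<Longrightarrow> norm x \<le> B" using assms by (auto simp: bounded_iff)
  then have "norm (x - a) \<le> B + norm a" if "x \<in> S" for x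
    using that norm_triangle_ineq4[of x a] by fastforce
  then show ?thesis
    by (intro bdiff_onI[where B="B + norm a" and C=1]) (auto intro!: derivative_eq_intros)
qed

lemma bdiff_on_add:
  fixes f g :: "'a::real_normed_vector \<Rightarrow> 'b::real_normed_vector"
  assumes "bdiff_on S f f'" "bdiff_on S g g'"
  shows "bdiff_on S (\<lambda>x. f x + g x) (\<lambda>x h. f' x h + g' x h)"
proof -
  from assms obtain C D where
    C: "\<And>x. x \<in> S \<Longrightarrow> (f has_derivative f' x) (at x) \<and> norm (f x) \<le> C \<and> (\<forall>h. norm (f' x h) \<le> C * norm h)" and
    D: "\<And>x. x \<in> S \<Longrightarrow> (g has_derivative g' x) (at x) \<and> norm (g x) \<le> D \<and> (\<forall>h. norm (g' x h) \<le> D * norm h)"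
    unfolding bdiff_on_def by metis
  show ?thesis
  proof (rule bdiff_onI[where B="C + D" and C="C + D"])
    fix x h :: 'a assume x: "x \<in> S"
    show "((\<lambda>x. f x + g x) has_derivative (\<lambda>h. f' x h + g' x h)) (at x)"
      using C[OF x] D[OF x] by (auto intro: derivative_intros)
    show "norm (f x + g x) \<le> C + D" using C[OF x] D[OF x] norm_triangle_mono by blast
    show "norm (f' x h + g' x h) \<le> (C + D) * norm h"
      unfolding distrib_right using C[OF x] D[OF x] norm_triangle_mono by blast
  qed
qed

text \<open>One product rule for all pairings in use: multiplication, scaling, inner product and,
  later, matrix times vector.\<close>

lemma (in bounded_bilinear) bdiff_on_bilinear:
  fixes f :: "'d::real_normed_vector \<Rightarrow> 'a" and g :: "'d \<Rightarrow> 'b"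
  assumes "bdiff_on S f f'" "bdiff_on S g g'"
  shows "bdiff_on S (\<lambda>x. prod (f x) (g x)) (\<lambda>x h. prod (f x) (g' x h) + prod (f' x h) (g x))"
proof -
  from assms obtain C D where C0: "C \<ge> 0" "D \<ge> 0" and
    C: "\<And>x. x \<in> S \<Longrightarrow> (f has_derivative f' x) (at x) \<and> norm (f x) \<le> C \<and> (\<forall>h. norm (f' x h) \<le> C * norm h)" and
    D: "\<And>x. x \<in> S \<Longrightarrow> (g has_derivative g' x) (at x) \<and> norm (g x) \<le> D \<and> (\<forall>h. norm (g' x h) \<le> D * norm h)"
    unfolding bdiff_on_def by metis
  obtain K where K: "K \<ge> 0" "\<And>a b. norm (prod a b) \<le> norm a * norm b * K"
    using nonneg_bounded by blast
  have m: "norm (prod a b) \<le> C * D * K * t" if "norm a * norm b \<le> C * D * t" for a b t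
    using K(2)[of a b] mult_right_mono[OF that K(1)] by (simp add: mult.assoc mult.commute mult.left_commute)
  show ?thesis
  proof (rule bdiff_onI[where B="C * D * K" and C="2 * (C * D * K)"])
    fix x h :: 'd assume x: "x \<in> S"
    note c = C[OF x] and d = D[OF x]
    show "((\<lambda>x. prod (f x) (g x)) has_derivative (\<lambda>h. prod (f x) (g' x h) + prod (f' x h) (g x))) (at x)"
      using c d by (intro FDERIV) auto
    show "norm (prod (f x) (g x)) \<le> C * D * K"
      using m[of "f x" "g x" 1] c d C0 by (simp add: mult_mono)
    have 1: "norm (prod (f x) (g' x h)) \<le> C * D * K * norm h"
      by (rule m) (use c d C0 in \<open>simp add: mult_mono mult.assoc\<close>)
    have "norm (f' x h) * norm (g x) \<le> (C * norm h) * D"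
      using c d C0 by (intro mult_mono) auto
    then have 2: "norm (prod (f' x h) (g x)) \<le> C * D * K * norm h"
      by (intro m) (simp add: mult_ac)
    have "norm (prod (f x) (g' x h) + prod (f' x h) (g x))
        \<le> norm (prod (f x) (g' x h)) + norm (prod (f' x h) (g x))" by (rule norm_triangle_ineq)
    then show "norm (prod (f x) (g' x h) + prod (f' x h) (g x)) \<le> 2 * (C * D * K) * norm h"
      using 1 2 by simp
  qed
qed

lemmas bdiff_on_mult = bounded_bilinear.bdiff_on_bilinear[OF bounded_bilinear_mult]
lemmas bdiff_on_scaleR = bounded_bilinear.bdiff_on_bilinear[OF bounded_bilinear_scaleR]
lemmas bdiff_on_inner = bounded_bilinear.bdiff_on_bilinear[OF bounded_bilinear_inner]

lemma bdiff_on_subset: "bdiff_on S f f' \<Longrightarrow> T \<subseteq> S \<Longrightarrow> bdiff_on T f f'"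
  unfolding bdiff_on_def by blast

lemma bdiff_on_cong: "bdiff_on S f f' \<Longrightarrow> (\<And>x h. x \<in> S \<Longrightarrow> f' x h = g' x h) \<Longrightarrow> bdiff_on S f g'"
proof -
  assume a: "bdiff_on S f f'" and b: "\<And>x h. x \<in> S \<Longrightarrow> f' x h = g' x h"
  have "f' x = g' x" if "x \<in> S" for x using b[OF that] by blast
  then show "bdiff_on S f g'" using a by (simp add: bdiff_on_def)
qed

theorem integral_divergence_eq_0:
  fixes V :: "'a::euclidean_space \<Rightarrow> 'a"
  assumes V: "bdiff_on S V V'" and S: "open S" "compact K" "K \<subseteq> S" and supp: "\<And>x. x \<notin> K \<Longrightarrow> V x = 0"
  shows "has_bochner_integral lborel (\<lambda>x. if x \<in> S then lin_trace (V' x) else 0) 0"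
proof -
  obtain r where "\<And>x. x \<in> K \<Longrightarrow> norm x \<le> r"
    using compact_imp_bounded[OF S(2)] by (auto simp: bounded_iff)
  then have r: "K \<subseteq> cball 0 r" by auto
  from V obtain C where C0: "C \<ge> 0" and
    C: "\<And>x. x \<in> S \<Longrightarrow> (V has_derivative V' x) (at x) \<and> norm (V x) \<le> C \<and> (\<forall>h. norm (V' x h) \<le> C * norm h)"
    unfolding bdiff_on_def by metis
  \<comment> \<open>A point outside \<open>S\<close> has a neighbourhood missing the closed set
    \<open>K\<close>, so the zero map is the derivative of \<open>V\<close> there and
    \<open>V\<close> is differentiable on the whole space.\<close>
  define W where "W x = (if x \<in> S then V' x else (\<lambda>h. 0))" for x
  have der: "(V has_derivative W x) (at x)" for x
  proof (cases "x \<in> S")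
    case True then show ?thesis using C by (simp add: W_def)
  next
    case False
    have "((\<lambda>x. 0) has_derivative (\<lambda>h. 0)) (at x)" by simp
    moreover have "open (- K)" using S compact_imp_closed by blast
    moreover have "x \<in> - K" using False S by blast
    ultimately have "(V has_derivative (\<lambda>h. 0)) (at x)"
      by (rule has_derivative_transform_within_open) (use supp in auto)
    then show ?thesis using False by (simp add: W_def)
  qed
  have "has_bochner_integral lborel (\<lambda>x. W x i \<bullet> i) 0" if i: "i \<in> Basis" for i
  proof (rule integral_directional_derivative_eq_0[where h="\<lambda>x. V x \<bullet> i" and h'="\<lambda>x h. W x h \<bullet> i" and C=C and r=r])
    fix x
    show "((\<lambda>x. V x \<bullet> i) has_derivative (\<lambda>h. W x h \<bullet> i)) (at x)"
      using der by (intro derivative_intros)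
    have "\<bar>W x i \<bullet> i\<bar> \<le> norm (W x i)" using Cauchy_Schwarz_ineq2[of "W x i" i] i by simp
    also have "\<dots> \<le> C" using C[of x] C0 i by (auto simp: W_def dest!: spec[of _ i])
    finally show "\<bar>W x i \<bullet> i\<bar> \<le> C" .
    show "V x \<bullet> i = 0" if "x \<notin> cball 0 r"
    proof -
      have "x \<notin> K" using that r by blast
      then show ?thesis using supp by simp
    qed
  qed
  then have "has_bochner_integral lborel (\<lambda>x. \<Sum>i\<in>Basis. W x i \<bullet> i) (\<Sum>i\<in>(Basis::'a set). 0)"
    by (intro has_bochner_integral_sum) auto
  moreover have "(\<lambda>x. \<Sum>i\<in>Basis. W x i \<bullet> i) = (\<lambda>x. if x \<in> S then lin_trace (V' x) else 0)"
    by (auto simp: lin_trace_def W_def)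
  ultimately show ?thesis by simp
qed

section \<open>The Carleman estimate\<close>

lemma bounded_bilinear_matrix_vector_mult:
  "bounded_bilinear ((*v) :: real ^ 'n ^ 'm \<Rightarrow> real ^ 'n \<Rightarrow> real ^ 'm)"
  unfolding bilinear_conv_bounded_bilinear[symmetric] bilinear_def
  by (auto intro!: linearI simp: matrix_vector_right_distrib matrix_vector_mult_add_rdistrib
      scaleR_matrix_vector_assoc matrix_vector_mult_scaleR)

lemmas bdiff_on_mv = bounded_bilinear.bdiff_on_bilinear[OF bounded_bilinear_matrix_vector_mult]

lemma lin_trace_add: "lin_trace (\<lambda>h. f h + g h) = lin_trace f + lin_trace g"
  by (simp add: lin_trace_def inner_add_left sum.distrib)

lemma lin_trace_scaleR: "lin_trace (\<lambda>h. c *\<^sub>R f h) = c * lin_trace f"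
  by (simp add: lin_trace_def sum_distrib_left)

text \<open>The product rule for a scalar times a vector field leaves the term
  \<open>f h *\<^sub>R v\<close>. With this rule the divergence of a product can be read off its
  derivative.\<close>

lemma lin_trace_rank1:
  assumes "linear f" shows "lin_trace (\<lambda>h. f h *\<^sub>R v) = f v"
proof -
  have "f v = f (\<Sum>i\<in>Basis. (v \<bullet> i) *\<^sub>R i)" by (simp add: euclidean_representation)
  also have "\<dots> = (\<Sum>i\<in>Basis. (v \<bullet> i) * f i)"
    using assms by (simp add: linear_sum linear_scale)
  finally show ?thesis by (simp add: lin_trace_def mult.commute)
qed

lemma abs_lin_trace_le:
  fixes L :: "'a::euclidean_space \<Rightarrow> 'a" and C :: real
  assumes "\<And>h. norm (L h) \<le> C * norm h"
  shows "\<bar>lin_trace L\<bar> \<le> DIM('a) * C"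
proof -
  have "\<bar>L i \<bullet> i\<bar> \<le> C" if "i \<in> Basis" for i
    using Cauchy_Schwarz_ineq2[of "L i" i] assms[of i] that by simp
  then have "(\<Sum>i\<in>Basis. \<bar>L i \<bullet> i\<bar>) \<le> (\<Sum>i\<in>(Basis::'a set). C)" by (intro sum_mono)
  then show ?thesis
    unfolding lin_trace_def using sum_abs[of "\<lambda>i. L i \<bullet> i" "Basis::'a set"] by (simp del: sum_abs)
qed

lemma bdiff_on_cmult:
  assumes "bdiff_on S f f'"
  shows "bdiff_on S (\<lambda>x. c *\<^sub>R f x) (\<lambda>x h. c *\<^sub>R f' x h)"
  using bdiff_on_scaleR[OF bdiff_on_const assms, of c] by simp

lemma bdiff_on_linear: "bdiff_on S f f' \<Longrightarrow> x \<in> S \<Longrightarrow> linear (f' x)"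
  using bdiff_onD has_derivative_linear by blast

lemma bdiff_on_compose_real:
  fixes f :: "'a::real_normed_vector \<Rightarrow> real"
  assumes f: "bdiff_on S f f'" and e: "\<And>t. (e has_real_derivative e' t) (at t)"
    and b: "\<And>x. x \<in> S \<Longrightarrow> \<bar>e (f x)\<bar> \<le> B" "\<And>x. x \<in> S \<Longrightarrow> \<bar>e' (f x)\<bar> \<le> B"
  shows "bdiff_on S (\<lambda>x. e (f x)) (\<lambda>x h. e' (f x) * f' x h)"
proof -
  from f obtain C where C0: "C \<ge> 0" and
    C: "\<And>x. x \<in> S \<Longrightarrow> (f has_derivative f' x) (at x) \<and> norm (f x) \<le> C \<and> (\<forall>h. norm (f' x h) \<le> C * norm h)"
    unfolding bdiff_on_def by metis
  show ?thesis
  proof (rule bdiff_onI[where B=B and C="B * C"])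
    fix x h :: 'a assume x: "x \<in> S"
    show "((\<lambda>x. e (f x)) has_derivative (\<lambda>h. e' (f x) * f' x h)) (at x)"
      using has_derivative_compose[of f "f' x" x UNIV e "(*) (e' (f x))"] C[OF x] e[of "f x"]
      by (simp add: has_field_derivative_def)
    show "norm (e (f x)) \<le> B" using b(1)[OF x] by simp
    have "\<bar>e' (f x)\<bar> * \<bar>f' x h\<bar> \<le> B * (C * norm h)"
      using b(2)[OF x] C[OF x] C0 by (intro mult_mono) auto
    then show "norm (e' (f x) * f' x h) \<le> B * C * norm h" by (simp add: abs_mult)
  qed
qed

text \<open>Here \<open>a\<close> stands for \<open>A g\<close>, \<open>B\<close> for its derivative, and \<open>\<beta>\<close> for the term
  in which the coefficients are differentiated in the direction \<open>N\<close>.\<close>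

lemma lin_trace_multiplier:
  fixes g a N :: "'a::euclidean_space"
  assumes lin: "linear B" "linear H" "linear N'" "linear q'" "linear s'"
    and symH: "\<And>h k. H h \<bullet> k = h \<bullet> H k"
    and B: "B N \<bullet> g = a \<bullet> H N + \<beta>"
  shows "lin_trace (\<lambda>h.
      (-2 * \<tau>) *\<^sub>R ((N \<bullet> g) *\<^sub>R B h + (N \<bullet> H h + N' h \<bullet> g) *\<^sub>R a)
      + \<tau> *\<^sub>R ((a \<bullet> g) *\<^sub>R N' h + (a \<bullet> H h + B h \<bullet> g) *\<^sub>R N)
      + (-\<tau>) *\<^sub>R ((s * w) *\<^sub>R B h + (s * (g \<bullet> h) + s' h * w) *\<^sub>R a)
      + (-(\<tau>^3)) *\<^sub>R ((q * (w * w)) *\<^sub>R N' h + (q * (w * (g \<bullet> h) + (g \<bullet> h) * w) + q' h * (w * w)) *\<^sub>R N))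
    = (lin_trace B + \<tau>\<^sup>2 * q * w) * (-2 * \<tau> * (N \<bullet> g) - \<tau> * s * w)
      - \<tau> * (2 * (N' a \<bullet> g) - (a \<bullet> g) * lin_trace N' - \<beta> + s * (a \<bullet> g) + s' a * w
          + \<tau>\<^sup>2 * (q * lin_trace N' + q' N - s * q) * w\<^sup>2)" (is "lin_trace ?L = ?rhs")
proof -
  have l1: "linear (\<lambda>h. N \<bullet> H h + N' h \<bullet> g)" "linear (\<lambda>h. a \<bullet> H h + B h \<bullet> g)"
     "linear (\<lambda>h. s * (g \<bullet> h) + s' h * w)"
     "linear (\<lambda>h. q * (w * (g \<bullet> h) + (g \<bullet> h) * w) + q' h * (w * w))"
    using lin by (auto intro!: linearI simp: linear_add linear_scale inner_add_left inner_add_right algebra_simps)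
  have "lin_trace ?L = -2 * \<tau> * ((N \<bullet> g) * lin_trace B + (N \<bullet> H a + N' a \<bullet> g))
      + \<tau> * ((a \<bullet> g) * lin_trace N' + (a \<bullet> H N + B N \<bullet> g))
      - \<tau> * (s * w * lin_trace B + (s * (g \<bullet> a) + s' a * w))
      - \<tau>^3 * (q * (w * w) * lin_trace N' + (q * (w * (g \<bullet> N) + (g \<bullet> N) * w) + q' N * (w * w)))"
    unfolding lin_trace_add lin_trace_scaleR lin_trace_rank1[OF l1(1)] lin_trace_rank1[OF l1(2)]
        lin_trace_rank1[OF l1(3)] lin_trace_rank1[OF l1(4)] by simp
  \<comment> \<open>By the symmetry of \<open>H\<close> the second derivatives cancel: the factors
    \<open>-2 * \<tau>\<close> and \<open>\<tau>\<close> of the first two fields are matched so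
    that, besides the trace of \<open>B\<close>, only the term with \<beta> is left of them.\<close>
  also have "N \<bullet> H a = a \<bullet> H N" using symH[of a N] by (simp add: inner_commute)
  also note B
  also have "g \<bullet> a = a \<bullet> g" by (simp add: inner_commute)
  also have "g \<bullet> N = N \<bullet> g" by (simp add: inner_commute)
  finally show ?thesis by (simp add: algebra_simps power2_eq_square power3_eq_cube)
qed

text \<open>Positivity comes from the net term \<open>\<mu>\<^sup>2 * \<phi> * p * X4\<close> for
  the gradient and from \<open>\<tau>\<^sup>2 * \<mu>^4 * \<phi>^3 * p\<^sup>2\<close> for
  \<open>w\<close>; the square \<open>X2\<^sup>2\<close> has the good sign and is dropped. The
  number 6 in \<open>l1\<close> counts errors of size
  \<open>\<mu> * \<phi> * M\<^sup>2 * G\<^sup>2\<close>: two from \<open>X1\<close>, one each from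
  \<open>X3\<close> and \<open>T\<close>, two from the cross terms; the extra 1 is what survives. In
  the same way \<open>l2\<close> pays for \<open>p * T\<close> and \<open>X6\<close>.\<close>

lemma carleman_quadratic_form_ge:
  fixes M c0 p \<mu> \<phi> \<tau> w G :: real
  assumes M: "M \<ge> 1" and p: "0 < c0" "c0 \<le> p" "p \<le> M" and l: "\<mu> \<ge> 1"
    and l1: "\<mu> * c0 \<ge> M * (6 * M\<^sup>2 + 1)" and l2: "\<mu> * c0\<^sup>2 \<ge> 2 * M\<^sup>2 + 1"
    and ph: "0 < \<phi>0" "\<phi>0 \<le> \<phi>" "\<phi> \<le> 1" and t: "\<tau> * \<phi>0 \<ge> 2 * M * \<mu>" "\<tau> > 0"
    and G: "G \<ge> 0"
    and X: "\<bar>X1\<bar> \<le> M\<^sup>2 * G\<^sup>2" "\<bar>X2\<bar> \<le> M * G" "\<bar>X3\<bar> \<le> M\<^sup>2 * G\<^sup>2" "G\<^sup>2 \<le> M * X4" "X4 \<le> M * G\<^sup>2"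
      "\<bar>X5\<bar> \<le> M\<^sup>2 * G" "\<bar>X6\<bar> \<le> M\<^sup>2" "\<bar>T\<bar> \<le> M"
  shows "2 * (-\<mu> * \<phi> * X1 + \<mu>\<^sup>2 * \<phi> * X2\<^sup>2) - X4 * (\<mu>\<^sup>2 * \<phi> * p - \<mu> * \<phi> * T) + \<mu> * \<phi> * X3
      + 2 * \<mu>\<^sup>2 * \<phi> * p * X4 + (2 * \<mu>\<^sup>2 * \<phi> * X5 - 2 * \<mu>^3 * \<phi> * X2 * p) * w
      + \<tau>\<^sup>2 * (\<mu>^3 * \<phi>^3 * (\<mu> * p\<^sup>2 - p * T - X6)) * w\<^sup>2
     \<ge> \<phi>0^3 / 2 * (G\<^sup>2 + \<tau>\<^sup>2 * w\<^sup>2)" (is "?Q \<ge> _")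
proof -
  have phi: "\<phi> > 0" using ph by simp
  have X4: "X4 \<ge> 0" using X(4) M by (smt (verit) zero_le_power2 mult_nonneg_nonpos zero_le_mult_iff)
  define lp where "lp = \<mu> * \<phi>"
  have lp: "lp > 0" unfolding lp_def using l phi by simp
  have a1: "lp * X1 \<le> lp * (M\<^sup>2 * G\<^sup>2)" using X(1) lp by (intro mult_left_mono) auto
  have a3: "lp * X3 \<ge> - (lp * (M\<^sup>2 * G\<^sup>2))"
  proof -
    have "lp * (- X3) \<le> lp * (M\<^sup>2 * G\<^sup>2)" using X(3) lp by (intro mult_left_mono) auto
    then show ?thesis by simp
  qed
  have a4: "lp * (X4 * T) \<ge> - (lp * (M\<^sup>2 * G\<^sup>2))"
  proof -
    have "X4 * \<bar>T\<bar> \<le> (M * G\<^sup>2) * M" using X(5,8) X4 M by (intro mult_mono) auto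
    then have "X4 * (-T) \<le> M\<^sup>2 * G\<^sup>2"
      using mult_left_mono[of "-T" "\<bar>T\<bar>" X4, OF abs_ge_minus_self X4] by (simp add: power2_eq_square mult_ac)
    then have "lp * (X4 * (-T)) \<le> lp * (M\<^sup>2 * G\<^sup>2)" using lp by (intro mult_left_mono) auto
    then show ?thesis by simp
  qed
  have a5: "lp * (\<mu> * p * X4) \<ge> lp * ((6 * M\<^sup>2 + 1) * G\<^sup>2)"
  proof -
    have "M * ((6 * M\<^sup>2 + 1) * G\<^sup>2) = M * (6 * M\<^sup>2 + 1) * G\<^sup>2" by simp
    also have "\<dots> \<le> (\<mu> * c0) * G\<^sup>2" using l1 by (intro mult_right_mono) auto
    also have "\<dots> \<le> (\<mu> * p) * (M * X4)" using p l X(4) by (intro mult_mono) auto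
    finally have "M * ((6 * M\<^sup>2 + 1) * G\<^sup>2) \<le> M * (\<mu> * p * X4)" by (simp add: mult_ac)
    then have "(6 * M\<^sup>2 + 1) * G\<^sup>2 \<le> \<mu> * p * X4" using M by simp
    then show ?thesis using lp by (intro mult_left_mono) auto
  qed
  \<comment> \<open>The cross terms are cubic in \<mu>. Young's inequality with the weight
    \<open>\<mu>\<^sup>2\<close> on \<open>w\<close> keeps the gradient part at order \<mu> and
    pushes the excess into \<open>\<mu>^4 * w\<^sup>2\<close>, which carries no \<tau> and is beaten
    in \<open>a8\<close>.\<close>
  have a6: "(2 * \<mu>\<^sup>2 * \<phi> * X5 - 2 * \<mu>^3 * \<phi> * X2 * p) * w \<ge> - (lp * (2 * M\<^sup>2 * (G\<^sup>2 + \<mu>^4 * w\<^sup>2)))"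
  proof -
    have "\<bar>\<mu> * X5\<bar> \<le> \<mu>\<^sup>2 * (M\<^sup>2 * G)"
    proof -
      have "\<bar>\<mu>\<bar> * \<bar>X5\<bar> \<le> \<mu>\<^sup>2 * (M\<^sup>2 * G)"
        using X(6) l self_le_power[of \<mu> 2] by (intro mult_mono) auto
      then show ?thesis by (simp add: abs_mult)
    qed
    moreover have "\<bar>\<mu>\<^sup>2 * X2 * p\<bar> \<le> \<mu>\<^sup>2 * (M\<^sup>2 * G)"
    proof -
      have "\<bar>X2\<bar> * \<bar>p\<bar> \<le> (M * G) * M" using X(2) p M G by (intro mult_mono) auto
      then have "\<mu>\<^sup>2 * (\<bar>X2\<bar> * \<bar>p\<bar>) \<le> \<mu>\<^sup>2 * ((M * G) * M)" by (intro mult_left_mono) auto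
      then show ?thesis using l by (simp add: abs_mult power2_eq_square mult_ac)
    qed
    moreover have "\<bar>2 * (u1 - u2)\<bar> \<le> 4 * u3" if "\<bar>u1\<bar> \<le> u3" "\<bar>u2\<bar> \<le> u3" for u1 u2 u3 :: real
      using that unfolding abs_le_iff by auto
    ultimately have "\<bar>2 * (\<mu> * X5 - \<mu>\<^sup>2 * X2 * p)\<bar> \<le> 4 * (\<mu>\<^sup>2 * (M\<^sup>2 * G))" by blast
    then have "\<bar>2 * (\<mu> * X5 - \<mu>\<^sup>2 * X2 * p)\<bar> * \<bar>w\<bar> \<le> 4 * (\<mu>\<^sup>2 * (M\<^sup>2 * G)) * \<bar>w\<bar>"
      by (intro mult_right_mono) auto
    also have "\<dots> = 2 * M\<^sup>2 * (2 * G * (\<mu>\<^sup>2 * \<bar>w\<bar>))" by simp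
    also have "\<dots> \<le> 2 * M\<^sup>2 * (G\<^sup>2 + \<mu>^4 * w\<^sup>2)"
    proof (intro mult_left_mono)
      have "0 \<le> (G - \<mu>\<^sup>2 * \<bar>w\<bar>)\<^sup>2" by simp
      also have "\<dots> = G\<^sup>2 + \<mu>^4 * w\<^sup>2 - 2 * G * (\<mu>\<^sup>2 * \<bar>w\<bar>)"
        by (simp add: power2_diff power_mult_distrib mult_ac flip: power_mult)
      finally show "2 * G * (\<mu>\<^sup>2 * \<bar>w\<bar>) \<le> G\<^sup>2 + \<mu>^4 * w\<^sup>2" by simp
    qed auto
    finally have "\<bar>2 * (\<mu> * X5 - \<mu>\<^sup>2 * X2 * p) * w\<bar> \<le> 2 * M\<^sup>2 * (G\<^sup>2 + \<mu>^4 * w\<^sup>2)"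
      by (simp add: abs_mult)
    then have "- (2 * (\<mu> * X5 - \<mu>\<^sup>2 * X2 * p) * w) \<le> 2 * M\<^sup>2 * (G\<^sup>2 + \<mu>^4 * w\<^sup>2)" by linarith
    then have "lp * - (2 * (\<mu> * X5 - \<mu>\<^sup>2 * X2 * p) * w) \<le> lp * (2 * M\<^sup>2 * (G\<^sup>2 + \<mu>^4 * w\<^sup>2))"
      using lp by (intro mult_left_mono) auto
    then show ?thesis by (simp add: lp_def algebra_simps power2_eq_square power3_eq_cube)
  qed
  have a7: "\<tau>\<^sup>2 * (\<mu>^3 * \<phi>^3 * (\<mu> * p\<^sup>2 - p * T - X6)) * w\<^sup>2 \<ge> \<tau>\<^sup>2 * (\<mu>^3 * \<phi>^3) * w\<^sup>2"
  proof -
    have "p * \<bar>T\<bar> \<le> M * M" using p X(8) by (intro mult_mono) auto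
    then have "p * T \<le> M\<^sup>2" using mult_left_mono[of T "\<bar>T\<bar>" p, OF abs_ge_self] p unfolding power2_eq_square by linarith
    moreover have "\<mu> * c0\<^sup>2 \<le> \<mu> * p\<^sup>2" using p l by (intro mult_left_mono power_mono) auto
    ultimately have "\<mu> * p\<^sup>2 - p * T - X6 \<ge> 1" using X(7) l2 by linarith
    then have "\<tau>\<^sup>2 * (\<mu>^3 * \<phi>^3) * w\<^sup>2 * 1 \<le> \<tau>\<^sup>2 * (\<mu>^3 * \<phi>^3) * w\<^sup>2 * (\<mu> * p\<^sup>2 - p * T - X6)"
      using l phi by (intro mult_left_mono) auto
    then show ?thesis by (simp add: mult_ac)
  qed
  have a8: "lp * (2 * M\<^sup>2 * (\<mu>^4 * w\<^sup>2)) \<le> \<tau>\<^sup>2 * (\<mu>^3 * \<phi>^3) * w\<^sup>2 / 2"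
  proof -
    have "\<tau> * \<phi> \<ge> 2 * M * \<mu>" using t ph mult_left_mono[of \<phi>0 \<phi> \<tau>] by linarith
    then have "(2 * M * \<mu>)\<^sup>2 \<le> (\<tau> * \<phi>)\<^sup>2" using M l by (intro power_mono) auto
    then have "(2 * M * \<mu>)\<^sup>2 * (\<mu>^3 * \<phi> * w\<^sup>2) \<le> (\<tau> * \<phi>)\<^sup>2 * (\<mu>^3 * \<phi> * w\<^sup>2)"
      using l phi by (intro mult_right_mono) auto
    then show ?thesis unfolding lp_def
      by (simp add: power_mult_distrib algebra_simps power2_eq_square power3_eq_cube power4_eq_xxxx)
  qed
  have "?Q = -2 * (lp * X1) + 2 * \<mu>\<^sup>2 * \<phi> * X2\<^sup>2 + lp * (X4 * T) + lp * X3 + lp * (\<mu> * p * X4)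
      + (2 * \<mu>\<^sup>2 * \<phi> * X5 - 2 * \<mu>^3 * \<phi> * X2 * p) * w
      + \<tau>\<^sup>2 * (\<mu>^3 * \<phi>^3 * (\<mu> * p\<^sup>2 - p * T - X6)) * w\<^sup>2"
    by (simp add: lp_def algebra_simps power2_eq_square)
  moreover have "2 * \<mu>\<^sup>2 * \<phi> * X2\<^sup>2 \<ge> 0" using phi by simp
  ultimately have "?Q \<ge> -2 * (lp * (M\<^sup>2 * G\<^sup>2)) - lp * (M\<^sup>2 * G\<^sup>2) - lp * (M\<^sup>2 * G\<^sup>2) + lp * ((6 * M\<^sup>2 + 1) * G\<^sup>2)
     - lp * (2 * M\<^sup>2 * (G\<^sup>2 + \<mu>^4 * w\<^sup>2)) + \<tau>\<^sup>2 * (\<mu>^3 * \<phi>^3) * w\<^sup>2"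
    using a1 a3 a4 a5 a6 a7 by linarith
  then have "?Q \<ge> lp * G\<^sup>2 - lp * (2 * M\<^sup>2 * (\<mu>^4 * w\<^sup>2)) + \<tau>\<^sup>2 * (\<mu>^3 * \<phi>^3) * w\<^sup>2"
    by (simp add: algebra_simps)
  then have "?Q \<ge> lp * G\<^sup>2 + \<tau>\<^sup>2 * (\<mu>^3 * \<phi>^3) * w\<^sup>2 / 2" using a8 by linarith
  moreover have "lp * G\<^sup>2 \<ge> \<phi>0^3 / 2 * G\<^sup>2"
  proof (intro mult_right_mono)
    have "\<phi>0 ^ 3 \<le> \<phi> ^ 3" using ph by (intro power_mono) auto
    also have "\<dots> \<le> \<phi> ^ 1" using ph phi by (intro power_decreasing) auto
    also have "\<dots> \<le> lp" using l phi by (simp add: lp_def)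
    finally show "\<phi>0^3 / 2 \<le> lp" using lp by linarith
  qed auto
  moreover have "\<tau>\<^sup>2 * (\<mu>^3 * \<phi>^3) * w\<^sup>2 / 2 \<ge> \<phi>0^3 / 2 * (\<tau>\<^sup>2 * w\<^sup>2)"
  proof -
    have "1 * \<phi>0 ^ 3 \<le> \<mu>^3 * \<phi> ^ 3" using ph l by (intro mult_mono power_mono one_le_power) auto
    then have "\<phi>0 ^ 3 * (\<tau>\<^sup>2 * w\<^sup>2) \<le> \<mu>^3 * \<phi> ^ 3 * (\<tau>\<^sup>2 * w\<^sup>2)" by (intro mult_right_mono) auto
    then show ?thesis by (simp add: mult_ac)
  qed
  ultimately show ?thesis by (simp add: distrib_left)
qed

section \<open>An elliptic operator in divergence form on a ball\<close>

locale elliptic_ball =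
  fixes A :: "real ^ 'n \<Rightarrow> real ^ 'n ^ 'n" and A' :: "real ^ 'n \<Rightarrow> real ^ 'n \<Rightarrow> real ^ 'n ^ 'n"
    and y :: "real ^ 'n" and R \<kappa> :: real
  assumes R: "0 < R" and kappa: "0 < \<kappa>"
    and A: "bdiff_on (ball y R) A A'"
    and sym: "\<And>x g h. x \<in> ball y R \<Longrightarrow> (A x *v g) \<bullet> h = g \<bullet> (A x *v h)"
    and ell: "\<And>x g. x \<in> ball y R \<Longrightarrow> (norm g)\<^sup>2 \<le> \<kappa> * ((A x *v g) \<bullet> g)"
begin

text \<open>The gradient of the weight is a scalar multiple of \<open>x - y\<close>, so
  \<open>b\<close> and \<open>p\<close> are what remains of \<open>A \<nabla>ph\<close> and
  \<open>A \<nabla>ph \<bullet> \<nabla>ph\<close> once the factors in \<mu> and \<open>ph\<close>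
  are split off.\<close>

definition "b x = A x *v (x - y)"
definition "b' x h = A x *v h + A' x h *v (x - y)"
definition "p x = (x - y) \<bullet> b x"
definition "p' x h = (x - y) \<bullet> b' x h + h \<bullet> b x"

lemma bdiff_id: "bdiff_on (ball y R) (\<lambda>x. x - y) (\<lambda>x h. h)"
  by (rule bdiff_on_ident) simp

lemma bdiff_b: "bdiff_on (ball y R) b b'"
  unfolding b_def[abs_def] b'_def[abs_def] by (rule bdiff_on_mv[OF A bdiff_id])

lemma bdiff_p: "bdiff_on (ball y R) p p'"
  unfolding p_def[abs_def] p'_def[abs_def] by (rule bdiff_on_inner[OF bdiff_id bdiff_b])

text \<open>A single constant for all bounds turns the later thresholds on \<mu> and \<tau> into
  explicit powers of \<open>M\<close>.\<close>

lemma coefficient_bounds: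
  obtains M where "M \<ge> 1" "\<And>x. x \<in> ball y R \<Longrightarrow> norm (x - y) \<le> M \<and> norm (b x) \<le> M \<and> p x \<le> M \<and> \<bar>lin_trace (b' x)\<bar> \<le> M"
    "\<And>x h. x \<in> ball y R \<Longrightarrow> norm (b' x h) \<le> M * norm h"
    "\<And>x h. x \<in> ball y R \<Longrightarrow> \<bar>p' x h\<bar> \<le> M * norm h"
    "\<And>x h. x \<in> ball y R \<Longrightarrow> norm (A x *v h) \<le> M * norm h"
    "\<And>x h g. x \<in> ball y R \<Longrightarrow> norm (A' x h *v g) \<le> M * norm h * norm g"
    "\<And>x g. x \<in> ball y R \<Longrightarrow> (norm g)\<^sup>2 \<le> M * ((A x *v g) \<bullet> g)"
proof -
  obtain Ca where Ca: "Ca \<ge> 0" "\<And>x. x \<in> ball y R \<Longrightarrow> norm (A x) \<le> Ca \<and> (\<forall>h. norm (A' x h) \<le> Ca * norm h)"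
    using A unfolding bdiff_on_def by metis
  obtain Cb where Cb: "Cb \<ge> 0" "\<And>x. x \<in> ball y R \<Longrightarrow> norm (b x) \<le> Cb \<and> (\<forall>h. norm (b' x h) \<le> Cb * norm h)"
    using bdiff_b unfolding bdiff_on_def by metis
  obtain Cp where Cp: "Cp \<ge> 0" "\<And>x. x \<in> ball y R \<Longrightarrow> norm (p x) \<le> Cp \<and> (\<forall>h. norm (p' x h) \<le> Cp * norm h)"
    using bdiff_p unfolding bdiff_on_def by metis
  obtain k where k: "k \<ge> 0" "\<And>(B::real^'n^'n) h. norm (B *v h) \<le> norm B * norm h * k"
    using bounded_bilinear.nonneg_bounded[OF bounded_bilinear_matrix_vector_mult] by blast
  define M where "M = 1 + R + (1 + real CARD('n)) * Cb + Cp + Ca * k + \<kappa>"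
  have nb: "0 \<le> real CARD('n) * Cb" "0 \<le> Ca * k" using Cb(1) Ca(1) k(1) by auto
  have le: "R \<le> M" "Cb \<le> M" "real CARD('n) * Cb \<le> M" "Cp \<le> M" "Ca * k \<le> M" "\<kappa> \<le> M" "M \<ge> 1"
    unfolding M_def using nb Cb(1) Cp(1) R kappa by (auto simp: algebra_simps)
  show ?thesis
  proof (rule that[of M])
    fix x h g assume x: "x \<in> ball y R"
    have "\<bar>lin_trace (b' x)\<bar> \<le> DIM(real^'n) * Cb" by (rule abs_lin_trace_le) (use Cb x in auto)
    then have "\<bar>lin_trace (b' x)\<bar> \<le> M" using le by simp
    then show "norm (x - y) \<le> M \<and> norm (b x) \<le> M \<and> p x \<le> M \<and> \<bar>lin_trace (b' x)\<bar> \<le> M"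
      using x Cb(2)[OF x] Cp(2)[OF x] le by (auto simp: dist_norm norm_minus_commute)
    show "norm (b' x h) \<le> M * norm h"
      using Cb(2)[OF x] mult_right_mono[OF le(2) norm_ge_zero[of h]] order_trans by blast
    show "\<bar>p' x h\<bar> \<le> M * norm h"
      using Cp(2)[OF x] mult_right_mono[OF le(4) norm_ge_zero[of h]] order_trans unfolding real_norm_def by blast
    have "norm (A x *v h) \<le> norm (A x) * norm h * k" by (rule k)
    also have "\<dots> \<le> Ca * norm h * k" using Ca(2)[OF x] k by (intro mult_right_mono) auto
    also have "\<dots> = (Ca * k) * norm h" by simp
    also have "\<dots> \<le> M * norm h" using le by (intro mult_right_mono) auto
    finally show "norm (A x *v h) \<le> M * norm h" .
    have "norm (A' x h *v g) \<le> norm (A' x h) * norm g * k" by (rule k)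
    also have "\<dots> \<le> (Ca * norm h) * norm g * k" using Ca(2)[OF x] k by (intro mult_right_mono) auto
    also have "\<dots> = (Ca * k) * (norm h * norm g)" by simp
    also have "\<dots> \<le> M * (norm h * norm g)" using le by (intro mult_right_mono) auto
    finally show "norm (A' x h *v g) \<le> M * norm h * norm g" by simp
    show "(norm g)\<^sup>2 \<le> M * ((A x *v g) \<bullet> g)"
    proof -
      have "0 \<le> (A x *v g) \<bullet> g"
        using ell[OF x, of g] kappa by (smt (verit) zero_le_power2 mult_pos_neg)
      then have "\<kappa> * ((A x *v g) \<bullet> g) \<le> M * ((A x *v g) \<bullet> g)" using le by (intro mult_right_mono) auto
      then show ?thesis using ell[OF x, of g] by linarith
    qed
  qed (use le in auto)
qed

end

section \<open>Conjugation with the Carleman weight\<close>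

locale carleman_conjugation = elliptic_ball A A' y R \<kappa>
  for A :: "real ^ 'n \<Rightarrow> real ^ 'n ^ 'n" and A' y R \<kappa> +
  fixes v :: "real ^ 'n \<Rightarrow> real" and gv :: "real ^ 'n \<Rightarrow> real ^ 'n"
    and Hv :: "real ^ 'n \<Rightarrow> real ^ 'n \<Rightarrow> real ^ 'n" and \<mu> \<tau> :: real
  assumes v: "bdiff_on (ball y R) v (\<lambda>x h. gv x \<bullet> h)"
    and gv: "bdiff_on (ball y R) gv Hv"
    and symHv: "\<And>x h k. x \<in> ball y R \<Longrightarrow> Hv x h \<bullet> k = h \<bullet> Hv x k"
    and mu: "\<mu> \<ge> 1"
begin

text \<open>The Carleman weight is \<open>E = exp (\<tau> ph)\<close>, with \<open>N = A \<nabla>ph\<close> and \<open>q = A \<nabla>ph \<bullet> \<nabla>ph\<close>; \<open>w = E v\<close> has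
  gradient \<open>g\<close> and Hessian \<open>H\<close>.  The conjugated operator is multiplied by \<open>-2 \<tau> N \<bullet> g - \<tau> s w\<close>, and \<open>V\<close>
  collects the divergences produced by integrating by parts.  The factor 2 in \<open>s\<close> lies strictly
  between 1 and 3: above 1 makes the gradient term positive, below 3 the zeroth order term.\<close>

definition "ph x = exp (- (\<mu> / 2) * ((x - y) \<bullet> (x - y)))"
definition "ph' x h = ph x * (- \<mu> * ((x - y) \<bullet> h))"
definition "E x = exp (\<tau> * ph x)"
definition "E' x h = E x * (\<tau> * ph' x h)"
definition "N x = (- \<mu> * ph x) *\<^sub>R b x"
definition "N' x h = (- \<mu> * ph x) *\<^sub>R b' x h + (- \<mu> * ph' x h) *\<^sub>R b x"
definition "q x = \<mu>\<^sup>2 * (ph x * (ph x * p x))"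
definition "q' x h = \<mu>\<^sup>2 * (ph x * (ph x * p' x h + ph' x h * p x) + ph' x h * (ph x * p x))"
definition "s x = 2 * \<mu>\<^sup>2 * (ph x * p x)"
definition "s' x h = 2 * \<mu>\<^sup>2 * (ph x * p' x h + ph' x h * p x)"
definition "w x = E x * v x"
text \<open>The gradient of \<open>w\<close> without its exponential factor, that is \<nabla>v +
  \<tau> v \<nabla>ph, since \<nabla>ph is - \<mu> ph (x - y).\<close>

definition "k x = gv x + (- (\<tau> * \<mu>)) *\<^sub>R ((ph x * v x) *\<^sub>R (x - y))"
definition "k' x h = Hv x h + (- (\<tau> * \<mu>)) *\<^sub>R ((ph x * v x) *\<^sub>R h + (ph x * (gv x \<bullet> h) + ph' x h * v x) *\<^sub>R (x - y))"
definition "g x = E x *\<^sub>R k x"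
definition "H x h = E x *\<^sub>R k' x h + E' x h *\<^sub>R k x"
definition "a x = A x *v g x"
definition "B x h = A x *v H x h + A' x h *v g x"
definition "V x = (-2 * \<tau>) *\<^sub>R ((N x \<bullet> g x) *\<^sub>R a x) + \<tau> *\<^sub>R ((a x \<bullet> g x) *\<^sub>R N x)
   + (-\<tau>) *\<^sub>R ((s x * w x) *\<^sub>R a x) + (-(\<tau>^3)) *\<^sub>R ((q x * (w x * w x)) *\<^sub>R N x)"
definition "V' x h =
      (-2 * \<tau>) *\<^sub>R ((N x \<bullet> g x) *\<^sub>R B x h + (N x \<bullet> H x h + N' x h \<bullet> g x) *\<^sub>R a x)
      + \<tau> *\<^sub>R ((a x \<bullet> g x) *\<^sub>R N' x h + (a x \<bullet> H x h + B x h \<bullet> g x) *\<^sub>R N x)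
      + (-\<tau>) *\<^sub>R ((s x * w x) *\<^sub>R B x h + (s x * (g x \<bullet> h) + s' x h * w x) *\<^sub>R a x)
      + (-(\<tau>^3)) *\<^sub>R ((q x * (w x * w x)) *\<^sub>R N' x h
         + (q x * (w x * (g x \<bullet> h) + (g x \<bullet> h) * w x) + q' x h * (w x * w x)) *\<^sub>R N x)"
definition "P x = lin_trace (\<lambda>h. A x *v Hv x h + A' x h *v gv x)"

lemma ph_le_1: "ph x \<le> 1" using mu by (simp add: ph_def)
lemma ph_pos: "ph x > 0" by (simp add: ph_def)

lemma bdiff_ph: "bdiff_on (ball y R) ph ph'"
proof -
  have "bdiff_on (ball y R) (\<lambda>x. (- (\<mu> / 2)) *\<^sub>R ((x - y) \<bullet> (x - y)))
     (\<lambda>x h. (- (\<mu> / 2)) *\<^sub>R ((x - y) \<bullet> h + h \<bullet> (x - y)))"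
    by (rule bdiff_on_cmult[OF bdiff_on_inner[OF bdiff_id bdiff_id]])
  then have "bdiff_on (ball y R) (\<lambda>x. - (\<mu> / 2) * ((x - y) \<bullet> (x - y))) (\<lambda>x h. - \<mu> * ((x - y) \<bullet> h))"
    by (auto intro: bdiff_on_cong simp: inner_commute)
  then have "bdiff_on (ball y R) (\<lambda>x. exp (- (\<mu> / 2) * ((x - y) \<bullet> (x - y))))
     (\<lambda>x h. exp (- (\<mu> / 2) * ((x - y) \<bullet> (x - y))) * (- \<mu> * ((x - y) \<bullet> h)))"
    by (rule bdiff_on_compose_real[where B=1]) (use mu in \<open>auto intro: DERIV_exp\<close>)
  then show ?thesis unfolding ph_def[abs_def] ph'_def[abs_def] .
qed

lemma bdiff_E: "bdiff_on (ball y R) E E'"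
proof -
  have "bdiff_on (ball y R) (\<lambda>x. \<tau> * ph x) (\<lambda>x h. \<tau> * ph' x h)"
    using bdiff_on_cmult[OF bdiff_ph, of \<tau>] by simp
  then have "bdiff_on (ball y R) (\<lambda>x. exp (\<tau> * ph x)) (\<lambda>x h. exp (\<tau> * ph x) * (\<tau> * ph' x h))"
  proof (rule bdiff_on_compose_real[where B="exp \<bar>\<tau>\<bar>"])
    fix x
    have "\<tau> * ph x \<le> \<bar>\<tau>\<bar> * 1" using ph_le_1[of x] ph_pos[of x] by (intro mult_mono) auto
    then show "\<bar>exp (\<tau> * ph x)\<bar> \<le> exp \<bar>\<tau>\<bar>" "\<bar>exp (\<tau> * ph x)\<bar> \<le> exp \<bar>\<tau>\<bar>" by simp_all
  qed (auto intro: DERIV_exp)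
  then show ?thesis unfolding E_def[abs_def] E'_def[abs_def] .
qed

lemma bdiff_mu_ph: "bdiff_on (ball y R) (\<lambda>x. - \<mu> * ph x) (\<lambda>x h. - \<mu> * ph' x h)"
  using bdiff_on_cmult[OF bdiff_ph, of "-\<mu>"] by simp

lemma bdiff_N: "bdiff_on (ball y R) N N'"
  unfolding N_def[abs_def] N'_def[abs_def] by (rule bdiff_on_scaleR[OF bdiff_mu_ph bdiff_b])

lemma bdiff_q: "bdiff_on (ball y R) q q'"
  unfolding q_def[abs_def] q'_def[abs_def]
  using bdiff_on_cmult[OF bdiff_on_mult[OF bdiff_ph bdiff_on_mult[OF bdiff_ph bdiff_p]], of "\<mu>\<^sup>2"] by simp

lemma bdiff_s: "bdiff_on (ball y R) s s'"
  unfolding s_def[abs_def] s'_def[abs_def]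
  using bdiff_on_cmult[OF bdiff_on_mult[OF bdiff_ph bdiff_p], of "2 * \<mu>\<^sup>2"] by simp

lemma bdiff_k: "bdiff_on (ball y R) k k'"
  unfolding k_def[abs_def] k'_def[abs_def]
  by (rule bdiff_on_add[OF gv bdiff_on_cmult[OF bdiff_on_scaleR[OF bdiff_on_mult[OF bdiff_ph v] bdiff_id]]])

lemma bdiff_g: "bdiff_on (ball y R) g H"
  unfolding g_def[abs_def] H_def[abs_def] by (rule bdiff_on_scaleR[OF bdiff_E bdiff_k])

lemma bdiff_w: "bdiff_on (ball y R) w (\<lambda>x h. g x \<bullet> h)"
proof -
  have "bdiff_on (ball y R) w (\<lambda>x h. E x * (gv x \<bullet> h) + E' x h * v x)"
    unfolding w_def[abs_def] by (rule bdiff_on_mult[OF bdiff_E v])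
  then show ?thesis
    by (rule bdiff_on_cong) (simp add: g_def k_def E'_def ph'_def algebra_simps)
qed

lemma bdiff_a: "bdiff_on (ball y R) a B"
  unfolding a_def[abs_def] B_def[abs_def] by (rule bdiff_on_mv[OF A bdiff_g])

lemma bdiff_V: "bdiff_on (ball y R) V V'"
  unfolding V_def[abs_def] V'_def[abs_def]
  by (intro bdiff_on_add bdiff_on_cmult bdiff_on_scaleR bdiff_on_inner bdiff_on_mult
      bdiff_N bdiff_g bdiff_a bdiff_s bdiff_q bdiff_w)

lemma symH:
  assumes "x \<in> ball y R" shows "H x h \<bullet> j = h \<bullet> H x j"
  using symHv[OF assms, of h j]
  by (simp add: H_def k'_def k_def E'_def ph'_def inner_add_left inner_add_right algebra_simps inner_commute)

lemma trace_N':
  assumes "x \<in> ball y R"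
  shows "lin_trace (N' x) = - \<mu> * ph x * lin_trace (b' x) + \<mu>\<^sup>2 * ph x * p x"
proof -
  have "linear (\<lambda>h. - \<mu> * ph' x h)" using bdiff_on_linear[OF bdiff_mu_ph assms] .
  then show ?thesis unfolding N'_def lin_trace_add lin_trace_scaleR
    by (simp add: lin_trace_rank1 ph'_def p_def power2_eq_square)
qed

lemma trace_B:
  assumes x: "x \<in> ball y R"
  shows "lin_trace (B x) = E x * (P x - \<tau> * \<mu> * ph x * v x * lin_trace (b' x) + \<tau> * \<mu>\<^sup>2 * ph x * p x * v x
      - 2 * \<tau> * \<mu> * ph x * (gv x \<bullet> b x) + \<tau>\<^sup>2 * \<mu>\<^sup>2 * (ph x)\<^sup>2 * p x * v x)"
proof -
  have "B x h = E x *\<^sub>R (A x *v Hv x h + A' x h *v gv x) + (- (E x * (\<tau> * \<mu> * (ph x * v x)))) *\<^sub>R b' x h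
     + (- (E x * (\<tau> * \<mu>)) * (ph x * (gv x \<bullet> h) + ph' x h * v x)) *\<^sub>R b x
     + E' x h *\<^sub>R (A x *v gv x) + (E' x h * - (\<tau> * \<mu> * (ph x * v x))) *\<^sub>R b x" for h
    unfolding B_def H_def k'_def k_def g_def b'_def b_def
    by (simp add: matrix_vector_right_distrib matrix_vector_mult_scaleR scaleR_add_right
        algebra_simps matrix_vector_mult_diff_distrib)
  then have "B x = (\<lambda>h. E x *\<^sub>R (A x *v Hv x h + A' x h *v gv x) + (- (E x * (\<tau> * \<mu> * (ph x * v x)))) *\<^sub>R b' x h
     + (- (E x * (\<tau> * \<mu>)) * (ph x * (gv x \<bullet> h) + ph' x h * v x)) *\<^sub>R b x
     + E' x h *\<^sub>R (A x *v gv x) + (E' x h * - (\<tau> * \<mu> * (ph x * v x))) *\<^sub>R b x)" by (rule ext)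
  moreover have lE: "linear (E' x)" using bdiff_on_linear[OF bdiff_E x] .
  moreover have "linear (\<lambda>h. E' x h * c)" for c
    using lE by (auto intro!: linearI simp: linear_add linear_scale algebra_simps)
  moreover have "linear (\<lambda>h. - (E x * (\<tau> * \<mu>)) * (ph x * (gv x \<bullet> h) + ph' x h * v x))"
    using bdiff_on_linear[OF bdiff_ph x]
    by (auto intro!: linearI simp: linear_add linear_scale inner_add_right algebra_simps)
  ultimately have "lin_trace (B x) = E x * P x + (- (E x * (\<tau> * \<mu> * (ph x * v x)))) * lin_trace (b' x)
     + (- (E x * (\<tau> * \<mu>)) * (ph x * (gv x \<bullet> b x) + ph' x (b x) * v x))
     + E' x (A x *v gv x) + (E' x (b x) * - (\<tau> * \<mu> * (ph x * v x)))"
    by (simp only: lin_trace_add lin_trace_scaleR lin_trace_rank1 P_def)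
  moreover have "(x - y) \<bullet> (A x *v gv x) = gv x \<bullet> b x"
    using sym[OF x, of "x - y" "gv x"] by (simp add: b_def inner_commute)
  moreover have "(x - y) \<bullet> b x = p x" by (simp add: p_def)
  ultimately show ?thesis
    by (simp add: E'_def ph'_def) (simp add: algebra_simps power2_eq_square)
qed

text \<open>The operator acting on \<open>exp (- \<tau> * ph x) * w x\<close>, rewritten in
  \<open>w\<close>: an even part div (A \<nabla>w) + \<open>\<tau>\<^sup>2 * q * w\<close>, and a
  part odd in \<tau> whose zeroth order coefficient is the divergence of \<open>N\<close>.\<close>

lemma conjugated_operator:
  assumes x: "x \<in> ball y R"
  shows "lin_trace (B x) + \<tau>\<^sup>2 * q x * w x - 2 * \<tau> * (N x \<bullet> g x) - \<tau> * lin_trace (N' x) * w x = E x * P x"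
proof -
  have "N x \<bullet> g x = E x * (- \<mu> * ph x * (gv x \<bullet> b x) + \<tau> * \<mu>\<^sup>2 * (ph x)\<^sup>2 * p x * v x)"
    by (simp add: N_def g_def k_def p_def inner_commute inner_add_right algebra_simps power2_eq_square)
  then show ?thesis unfolding trace_B[OF x] trace_N'[OF x] \<open>N x \<bullet> g x = _\<close>
    by (simp add: q_def w_def algebra_simps power2_eq_square)
qed

text \<open>Specialises the multiplier identity to the weight. Apart from \<open>g\<close> and
  \<open>a\<close>, the quantities \<open>X1\<close> to \<open>X6\<close> and \<open>T\<close>
  contain only the coefficients, so the powers of \<mu> and \<open>ph\<close> stand openly and can
  be compared.\<close>

lemma trace_V':
  assumes x: "x \<in> ball y R"
  defines "X1 \<equiv> b' x (a x) \<bullet> g x" and "X2 \<equiv> b x \<bullet> g x" and "X3 \<equiv> (A' x (b x) *v g x) \<bullet> g x"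
    and "X4 \<equiv> a x \<bullet> g x" and "X5 \<equiv> p' x (a x)" and "X6 \<equiv> p' x (b x)" and "T \<equiv> lin_trace (b' x)"
  shows "lin_trace (V' x) = (lin_trace (B x) + \<tau>\<^sup>2 * q x * w x) * (-2 * \<tau> * (N x \<bullet> g x) - \<tau> * s x * w x)
    - \<tau> * (2 * (-\<mu> * ph x * X1 + \<mu>\<^sup>2 * ph x * X2\<^sup>2) - X4 * (\<mu>\<^sup>2 * ph x * p x - \<mu> * ph x * T) + \<mu> * ph x * X3
      + 2 * \<mu>\<^sup>2 * ph x * p x * X4 + (2 * \<mu>\<^sup>2 * ph x * X5 - 2 * \<mu>^3 * ph x * X2 * p x) * w x
      + \<tau>\<^sup>2 * (\<mu>^3 * ph x^3 * (\<mu> * (p x)\<^sup>2 - p x * T - X6)) * (w x)\<^sup>2)"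
proof -
  define \<beta> where "\<beta> = (A' x (N x) *v g x) \<bullet> g x"
  have lin: "linear (B x)" "linear (H x)" "linear (N' x)" "linear (q' x)" "linear (s' x)" "linear (A' x)" "linear (p' x)"
    using bdiff_on_linear x bdiff_a bdiff_g bdiff_N bdiff_q bdiff_s A bdiff_p by blast+
  have B: "B x (N x) \<bullet> g x = a x \<bullet> H x (N x) + \<beta>"
    using sym[OF x, of "H x (N x)" "g x"]
    by (simp add: B_def \<beta>_def a_def inner_add_left inner_add_right inner_commute)
  have zA: "(x - y) \<bullet> a x = X2"
    using sym[OF x, of "x - y" "g x"] by (simp add: a_def X2_def b_def)
  have e1: "N' x (a x) \<bullet> g x = -\<mu> * ph x * X1 + \<mu>\<^sup>2 * ph x * X2\<^sup>2"
    by (simp add: N'_def ph'_def zA X1_def inner_add_left power2_eq_square)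
      (simp add: X2_def inner_diff_left)
  have e2: "\<beta> = - \<mu> * ph x * X3"
    unfolding \<beta>_def N_def linear_scale[OF lin(6)] scaleR_matrix_vector_assoc[symmetric]
    by (simp add: X3_def)
  have e3: "s' x (a x) = 2 * \<mu>\<^sup>2 * ph x * X5 - 2 * \<mu>^3 * ph x * X2 * p x"
    unfolding s'_def ph'_def zA by (simp add: X5_def algebra_simps power2_eq_square power3_eq_cube)
  have zN: "(x - y) \<bullet> N x = - \<mu> * ph x * p x" by (simp add: N_def p_def)
  have pN: "p' x (N x) = - \<mu> * ph x * X6" unfolding N_def linear_scale[OF lin(7)] by (simp add: X6_def)
  have e4: "q' x (N x) = 2 * \<mu>^4 * ph x^3 * (p x)\<^sup>2 - \<mu>^3 * ph x^3 * X6"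
    unfolding q'_def ph'_def zN pN
    by (simp add: algebra_simps power2_eq_square power3_eq_cube power4_eq_xxxx)
  \<comment> \<open>The three sources of \<open>\<mu>^4 * ph^3 * p\<^sup>2\<close> contribute 1, 2
    and - 2, leaving the coefficient 1; this is where the factor in \<open>s\<close> has to stay
    below 3.\<close>
  have e5: "q x * lin_trace (N' x) + q' x (N x) - s x * q x = \<mu>^3 * ph x^3 * (\<mu> * (p x)\<^sup>2 - p x * T - X6)"
    unfolding e4 trace_N'[OF x] T_def q_def s_def
    by (simp add: algebra_simps power2_eq_square power3_eq_cube power4_eq_xxxx)
  have "lin_trace (V' x) = (lin_trace (B x) + \<tau>\<^sup>2 * q x * w x) * (-2 * \<tau> * (N x \<bullet> g x) - \<tau> * s x * w x)
      - \<tau> * (2 * (N' x (a x) \<bullet> g x) - (a x \<bullet> g x) * lin_trace (N' x) - \<beta> + s x * (a x \<bullet> g x) + s' x (a x) * w x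
          + \<tau>\<^sup>2 * (q x * lin_trace (N' x) + q' x (N x) - s x * q x) * (w x)\<^sup>2)"
    unfolding V'_def[abs_def] by (rule lin_trace_multiplier[OF lin(1-5) symH[OF x] B])
  then show ?thesis unfolding e1 e2 e3 e5 unfolding trace_N'[OF x]
    by (simp add: X4_def T_def s_def algebra_simps)
qed

text \<open>The conjugated operator is \<open>S + D + d\<close>, where \<open>S\<close> is the even
  part, \<open>D\<close> the multiplier and \<open>d\<close> the mismatch between \<open>s\<close>
  and the divergence of \<open>N\<close>. Completing squares bounds \<open>2 * (S * D)\<close> by
  \<open>(E x * P x)\<^sup>2 + d\<^sup>2\<close>, while \<open>S * D\<close> is the divergence of
  \<open>V\<close> plus \<tau> times the quadratic form. The mismatch is only of order \<tau> in
  \<open>w\<close>, so by \<open>t(3)\<close> its square is absorbed in the term with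
  \<open>\<tau>^3\<close>.\<close>

lemma carleman_pointwise:
  assumes M: "M \<ge> 1" "norm (x - y) \<le> M \<and> norm (b x) \<le> M \<and> p x \<le> M \<and> \<bar>lin_trace (b' x)\<bar> \<le> M"
    "\<And>h. norm (b' x h) \<le> M * norm h"
    "\<And>h. \<bar>p' x h\<bar> \<le> M * norm h"
    "\<And>h. norm (A x *v h) \<le> M * norm h"
    "\<And>h g. norm (A' x h *v g) \<le> M * norm h * norm g"
    "\<And>g. (norm g)\<^sup>2 \<le> M * ((A x *v g) \<bullet> g)"
    and x: "x \<in> ball y R" and c0: "0 < c0" "c0 \<le> p x"
    and l1: "\<mu> * c0 \<ge> M * (6 * M\<^sup>2 + 1)" and l2: "\<mu> * c0\<^sup>2 \<ge> 2 * M\<^sup>2 + 1"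
    and ph: "0 < \<phi>0" "\<phi>0 \<le> ph x"
    and t: "\<tau> * \<phi>0 \<ge> 2 * M * \<mu>" "\<tau> \<ge> 1" "\<phi>0^3 / 2 * \<tau> \<ge> 4 * \<mu>^4 * M\<^sup>2"
  shows "\<phi>0^3 / 2 * (\<tau> * (norm (g x))\<^sup>2 + \<tau>^3 * (w x)\<^sup>2) \<le> (E x * P x)\<^sup>2 - 2 * lin_trace (V' x)"
proof -
  define G where "G = norm (g x)"
  have G: "G \<ge> 0" by (simp add: G_def)
  have a: "norm (a x) \<le> M * G" using M(5) by (simp add: a_def G_def)
  have cs: "\<bar>u \<bullet> g x\<bar> \<le> c * G" if "norm u \<le> c" for u c
  proof -
    have "\<bar>u \<bullet> g x\<bar> \<le> norm u * norm (g x)" by (rule Cauchy_Schwarz_ineq2)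
    also have "\<dots> \<le> c * G" unfolding G_def using that by (rule mult_right_mono) simp
    finally show ?thesis .
  qed
  have Ma: "M * norm (a x) \<le> M\<^sup>2 * G"
    using mult_left_mono[OF a, of M] M(1) by (simp add: power2_eq_square)
  have Mb: "M * norm (b x) \<le> M\<^sup>2" using M(1,2) by (simp add: power2_eq_square)
  have X1: "\<bar>b' x (a x) \<bullet> g x\<bar> \<le> M\<^sup>2 * G\<^sup>2"
    using cs[of "b' x (a x)" "M\<^sup>2 * G"] M(3)[of "a x"] Ma by (simp add: power2_eq_square mult.assoc)
  have X2: "\<bar>b x \<bullet> g x\<bar> \<le> M * G" using cs[of "b x" M] M(2) by simp
  have X3: "\<bar>(A' x (b x) *v g x) \<bullet> g x\<bar> \<le> M\<^sup>2 * G\<^sup>2"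
  proof -
    have "norm (A' x (b x) *v g x) \<le> M\<^sup>2 * G"
      using M(6)[of "b x" "g x"] mult_right_mono[OF Mb G] by (simp add: G_def)
    from cs[OF this] show ?thesis by (simp add: power2_eq_square mult.assoc)
  qed
  have X4: "G\<^sup>2 \<le> M * (a x \<bullet> g x)" using M(7)[of "g x"] by (simp add: a_def G_def)
  have X4': "a x \<bullet> g x \<le> M * G\<^sup>2" using cs[OF a] by (simp add: power2_eq_square mult.assoc)
  have X5: "\<bar>p' x (a x)\<bar> \<le> M\<^sup>2 * G" using M(4)[of "a x"] Ma by simp
  have X6: "\<bar>p' x (b x)\<bar> \<le> M\<^sup>2" using M(4)[of "b x"] Mb by simp
  have Mp: "p x \<le> M" "\<bar>lin_trace (b' x)\<bar> \<le> M" using M(2) by auto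
  define S where "S = lin_trace (B x) + \<tau>\<^sup>2 * q x * w x"
  define D where "D = -2 * \<tau> * (N x \<bullet> g x) - \<tau> * s x * w x"
  define c where "c = \<phi>0^3 / 2"
  have t0: "\<tau> > 0" using t by simp
  have Q: "lin_trace (V' x) \<le> S * D - \<tau> * (c * (G\<^sup>2 + \<tau>\<^sup>2 * (w x)\<^sup>2))"
    unfolding trace_V'[OF x] S_def D_def c_def
    by (intro diff_left_mono mult_left_mono
      carleman_quadratic_form_ge[OF M(1) c0 Mp(1) mu l1 l2 ph ph_le_1 t(1) t0 G X1 X2 X3 X4 X4' X5 X6 Mp(2)])
      (use t0 in auto)
  define d where "d = \<tau> * (s x - lin_trace (N' x)) * w x"
  have SD: "S + D + d = E x * P x"
    using conjugated_operator[OF x] by (simp add: S_def D_def d_def algebra_simps)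
  have "4 * (S * D) \<le> (S + D)\<^sup>2"
  proof -
    have "0 \<le> (S - D)\<^sup>2" by simp
    then show ?thesis by (simp add: power2_sum power2_diff mult_ac)
  qed
  also have "(S + D)\<^sup>2 \<le> 2 * (E x * P x)\<^sup>2 + 2 * d\<^sup>2"
  proof -
    have "0 \<le> (S + D + 2 * d)\<^sup>2" by simp
    then show ?thesis unfolding SD[symmetric] by (simp add: power2_eq_square algebra_simps)
  qed
  finally have 1: "4 * (S * D) \<le> 2 * (E x * P x)\<^sup>2 + 2 * d\<^sup>2" .
  have dd: "d\<^sup>2 \<le> \<tau>\<^sup>2 * (4 * \<mu>^4 * M\<^sup>2) * (w x)\<^sup>2"
  proof -
    have "s x - lin_trace (N' x) = \<mu>\<^sup>2 * ph x * p x + \<mu> * ph x * lin_trace (b' x)"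
      unfolding trace_N'[OF x] s_def by (simp add: algebra_simps)
    moreover have "\<mu>\<^sup>2 * ph x * p x \<le> \<mu>\<^sup>2 * 1 * M"
      using ph_le_1[of x] Mp c0 ph_pos[of x] by (intro mult_mono) auto
    moreover have "0 \<le> \<mu>\<^sup>2 * ph x * p x" using ph_pos[of x] c0 by auto
    moreover have "\<bar>\<mu> * ph x * lin_trace (b' x)\<bar> \<le> \<mu>\<^sup>2 * 1 * M"
      unfolding abs_mult using mu ph_le_1[of x] ph_pos[of x] Mp self_le_power[of \<mu> 2]
      by (intro mult_mono) auto
    ultimately have "\<bar>s x - lin_trace (N' x)\<bar> \<le> 2 * \<mu>\<^sup>2 * M" by linarith
    then have "\<bar>s x - lin_trace (N' x)\<bar>\<^sup>2 \<le> (2 * \<mu>\<^sup>2 * M)\<^sup>2" by (intro power_mono) auto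
    then have "(s x - lin_trace (N' x))\<^sup>2 \<le> 4 * \<mu>^4 * M\<^sup>2"
      by (simp add: power_mult_distrib flip: power_mult)
    then have "\<tau>\<^sup>2 * (s x - lin_trace (N' x))\<^sup>2 * (w x)\<^sup>2 \<le> \<tau>\<^sup>2 * (4 * \<mu>^4 * M\<^sup>2) * (w x)\<^sup>2"
      by (intro mult_right_mono mult_left_mono) auto
    then show ?thesis by (simp add: d_def power_mult_distrib)
  qed
  have "\<tau>\<^sup>2 * (4 * \<mu>^4 * M\<^sup>2) * (w x)\<^sup>2 \<le> \<tau>\<^sup>2 * (c * \<tau>) * (w x)\<^sup>2"
    using t(3) unfolding c_def by (intro mult_right_mono mult_left_mono) auto
  then have "d\<^sup>2 \<le> c * (\<tau>^3 * (w x)\<^sup>2)" using dd by (simp add: power2_eq_square power3_eq_cube mult_ac)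
  then have "4 * lin_trace (V' x) + 4 * (\<tau> * (c * (G\<^sup>2 + \<tau>\<^sup>2 * (w x)\<^sup>2))) \<le> 2 * (E x * P x)\<^sup>2 + 2 * (c * (\<tau>^3 * (w x)\<^sup>2))"
    using Q 1 by linarith
  moreover have "\<tau> * (c * (G\<^sup>2 + \<tau>\<^sup>2 * (w x)\<^sup>2)) = c * (\<tau> * G\<^sup>2) + c * (\<tau>^3 * (w x)\<^sup>2)"
    by (simp add: algebra_simps power2_eq_square power3_eq_cube)
  moreover have "0 \<le> c * (\<tau> * G\<^sup>2)" using t0 ph by (simp add: c_def)
  ultimately have "c * (\<tau> * G\<^sup>2) + c * (\<tau>^3 * (w x)\<^sup>2) \<le> (E x * P x)\<^sup>2 - 2 * lin_trace (V' x)"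
    by argo
  then show ?thesis by (simp add: c_def G_def distrib_left)
qed

text \<open>Undoing the conjugation adds a multiple of \<open>\<tau> * \<mu> * ph x * w x\<close> to
  the gradient; its square is paid for by the third power of \<tau> in front of
  \<open>(w x)\<^sup>2\<close>.\<close>

lemma weighted_norm_le:
  assumes "norm (x - y) \<le> M" "\<tau> \<ge> 1"
  shows "\<tau> * (E x)\<^sup>2 * ((norm (gv x))\<^sup>2 + (v x)\<^sup>2) \<le> (2 * \<mu>\<^sup>2 * M\<^sup>2 + 2) * (\<tau> * (norm (g x))\<^sup>2 + \<tau>^3 * (w x)\<^sup>2)"
proof -
  define z where "z = (\<tau> * \<mu> * ph x * w x) *\<^sub>R (x - y)"
  have Eg: "E x *\<^sub>R gv x = g x + z" by (simp add: z_def g_def k_def w_def algebra_simps)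
  have "norm z = \<tau> * (\<bar>w x\<bar> * (\<mu> * (ph x * norm (x - y))))"
    using ph_pos[of x] mu assms by (simp add: z_def abs_mult mult_ac)
  also have "\<dots> \<le> \<tau> * (\<bar>w x\<bar> * (\<mu> * (1 * M)))"
    using ph_pos[of x] ph_le_1[of x] mu assms norm_ge_zero[of "x - y"] by (intro mult_left_mono mult_mono) auto
  finally have "(norm z)\<^sup>2 \<le> (\<tau> * (\<bar>w x\<bar> * (\<mu> * (1 * M))))\<^sup>2" by (intro power_mono) auto
  then have z: "(norm z)\<^sup>2 \<le> \<mu>\<^sup>2 * M\<^sup>2 * (\<tau>\<^sup>2 * (w x)\<^sup>2)" by (simp add: power_mult_distrib mult_ac)
  have "(norm (g x + z))\<^sup>2 \<le> (norm (g x) + norm z)\<^sup>2" by (intro power_mono norm_triangle_ineq) auto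
  also have "\<dots> \<le> 2 * (norm (g x))\<^sup>2 + 2 * (norm z)\<^sup>2"
    using sum_squares_ge_zero[of "norm (g x) - norm z" 0] by (simp add: power2_eq_square algebra_simps)
  finally have 1: "(norm (E x *\<^sub>R gv x))\<^sup>2 \<le> 2 * (norm (g x))\<^sup>2 + 2 * (\<mu>\<^sup>2 * M\<^sup>2 * (\<tau>\<^sup>2 * (w x)\<^sup>2))"
    unfolding Eg using z by linarith
  have "\<tau> * (E x)\<^sup>2 * ((norm (gv x))\<^sup>2 + (v x)\<^sup>2) = \<tau> * ((norm (E x *\<^sub>R gv x))\<^sup>2 + (w x)\<^sup>2)"
    by (simp add: w_def power_mult_distrib algebra_simps)
  also have "\<dots> \<le> \<tau> * (2 * (norm (g x))\<^sup>2 + 2 * (\<mu>\<^sup>2 * M\<^sup>2 * (\<tau>\<^sup>2 * (w x)\<^sup>2)) + \<tau>\<^sup>2 * (w x)\<^sup>2)"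
  proof -
    have "1 * (w x)\<^sup>2 \<le> \<tau>\<^sup>2 * (w x)\<^sup>2" using assms by (intro mult_right_mono one_le_power) auto
    then show ?thesis using 1 assms by (intro mult_left_mono) auto
  qed
  also have "\<dots> = 2 * (\<tau> * (norm (g x))\<^sup>2) + (2 * \<mu>\<^sup>2 * M\<^sup>2 + 1) * (\<tau>^3 * (w x)\<^sup>2)"
    by (simp add: algebra_simps power2_eq_square power3_eq_cube)
  also have "\<dots> \<le> (2 * \<mu>\<^sup>2 * M\<^sup>2 + 2) * (\<tau> * (norm (g x))\<^sup>2) + (2 * \<mu>\<^sup>2 * M\<^sup>2 + 2) * (\<tau>^3 * (w x)\<^sup>2)"
    using assms by (intro add_mono mult_right_mono) auto
  finally show ?thesis by (simp add: distrib_left)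
qed

end

text \<open>The constants depend on \<open>r0\<close> because \<open>p\<close> vanishes at the
  centre and is bounded below only away from it; \<mu> is chosen first, then \<tau>0. The integrable
  functions \<alpha> and \<beta> stand in for the two integrands as a minorant and a majorant, so
  that measurability of the gradient and of the second derivatives of \<open>v\<close> never has to
  be discussed. The majorant is asked for only where \<open>v\<close> can be nonzero.\<close>

lemma (in elliptic_ball) carleman_estimate:
  assumes r0: "0 < r0"
  obtains \<mu> C \<tau>0 where "\<mu> > 0" "C > 0" "\<tau>0 \<ge> 1"
    "\<And>\<tau> v gv Hv \<alpha> \<beta> R2. \<lbrakk>\<tau> \<ge> \<tau>0; bdiff_on (ball y R) v (\<lambda>x h. gv x \<bullet> h); bdiff_on (ball y R) gv Hv;
       \<And>x h k. x \<in> ball y R \<Longrightarrow> Hv x h \<bullet> k = h \<bullet> Hv x k; R2 < R;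
       \<And>x. x \<notin> cball y R2 \<Longrightarrow> v x = 0 \<and> gv x = 0; \<And>x. x \<in> ball y r0 \<Longrightarrow> v x = 0 \<and> gv x = 0;
       integrable lborel \<alpha>; integrable lborel \<beta>;
       \<And>x. x \<in> ball y R \<Longrightarrow>
         \<alpha> x \<le> \<tau> * (exp (\<tau> * exp (- (\<mu> / 2) * (norm (x - y))\<^sup>2)))\<^sup>2 * ((norm (gv x))\<^sup>2 + (v x)\<^sup>2);
       \<And>x. x \<notin> ball y R \<Longrightarrow> \<alpha> x \<le> 0; \<And>x. 0 \<le> \<beta> x;
       \<And>x. x \<in> ball y R \<Longrightarrow> r0 \<le> norm (x - y) \<Longrightarrow>
         (exp (\<tau> * exp (- (\<mu> / 2) * (norm (x - y))\<^sup>2)) * lin_trace (\<lambda>h. A x *v Hv x h + A' x h *v gv x))\<^sup>2 \<le> \<beta> x\<rbrakk>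
     \<Longrightarrow> (\<integral>x. \<alpha> x \<partial>lborel) \<le> C * (\<integral>x. \<beta> x \<partial>lborel)"
proof -
  obtain M where M: "M \<ge> 1" "\<And>x. x \<in> ball y R \<Longrightarrow> norm (x - y) \<le> M \<and> norm (b x) \<le> M \<and> p x \<le> M \<and> \<bar>lin_trace (b' x)\<bar> \<le> M"
    "\<And>x h. x \<in> ball y R \<Longrightarrow> norm (b' x h) \<le> M * norm h"
    "\<And>x h. x \<in> ball y R \<Longrightarrow> \<bar>p' x h\<bar> \<le> M * norm h"
    "\<And>x h. x \<in> ball y R \<Longrightarrow> norm (A x *v h) \<le> M * norm h"
    "\<And>x h g. x \<in> ball y R \<Longrightarrow> norm (A' x h *v g) \<le> M * norm h * norm g"
    "\<And>x g. x \<in> ball y R \<Longrightarrow> (norm g)\<^sup>2 \<le> M * ((A x *v g) \<bullet> g)"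
    using coefficient_bounds by blast
  define c0 where "c0 = r0\<^sup>2 / M"
  have c0: "c0 > 0" using r0 M(1) by (simp add: c0_def)
  have c0p: "c0 \<le> p x" if "x \<in> ball y R" "r0 \<le> norm (x - y)" for x
  proof -
    have "r0\<^sup>2 \<le> (norm (x - y))\<^sup>2" using that r0 by (intro power_mono) auto
    also have "\<dots> \<le> M * p x" using M(7)[OF that(1), of "x - y"] by (simp add: p_def b_def inner_commute)
    finally show ?thesis using M(1) by (simp add: c0_def field_simps)
  qed
  define \<mu> where "\<mu> = 1 + M * (6 * M\<^sup>2 + 1) / c0 + (2 * M\<^sup>2 + 1) / c0\<^sup>2"
  have mu1: "\<mu> \<ge> 1" using M(1) c0 by (auto simp: \<mu>_def)
  have l1: "\<mu> * c0 \<ge> M * (6 * M\<^sup>2 + 1)"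
  proof -
    have "M * (6 * M\<^sup>2 + 1) / c0 \<le> \<mu>" using M(1) c0 by (auto simp: \<mu>_def)
    then show ?thesis using c0 by (simp add: field_simps)
  qed
  have l2: "\<mu> * c0\<^sup>2 \<ge> 2 * M\<^sup>2 + 1"
  proof -
    have "(2 * M\<^sup>2 + 1) / c0\<^sup>2 \<le> \<mu>" using M(1) c0 by (auto simp: \<mu>_def)
    then show ?thesis using c0 by (simp add: field_simps)
  qed
  \<comment> \<open>A lower bound of \<open>ph\<close> on the whole ball; it turns the pointwise
    factor \<open>ph^3\<close> into the constant \<open>c\<close>.\<close>
  define \<phi>0 where "\<phi>0 = exp (- (\<mu> / 2) * R\<^sup>2)"
  have ph0: "\<phi>0 > 0" by (simp add: \<phi>0_def)
  define c where "c = \<phi>0^3 / 2"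
  have c: "c > 0" using ph0 by (simp add: c_def)
  define K where "K = 2 * \<mu>\<^sup>2 * M\<^sup>2 + 2"
  have K: "K > 0" unfolding K_def by (intro add_nonneg_pos) auto
  define \<tau>0 where "\<tau>0 = 1 + 2 * M * \<mu> / \<phi>0 + 4 * \<mu>^4 * M\<^sup>2 / c"
  have q: "0 \<le> 2 * M * \<mu> / \<phi>0" "0 \<le> 4 * \<mu>^4 * M\<^sup>2 / c" using M(1) mu1 ph0 c by auto
  show ?thesis
  proof (rule that[of \<mu> "K / c" \<tau>0])
    show "\<mu> > 0" "K / c > 0" "\<tau>0 \<ge> 1" using mu1 c K q by (auto simp: \<tau>0_def)
    fix \<tau> R2 :: real and v \<alpha> \<beta> :: "real ^ 'n \<Rightarrow> real" and gv :: "real ^ 'n \<Rightarrow> real ^ 'n" and Hv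
    assume tau: "\<tau> \<ge> \<tau>0" and v: "bdiff_on (ball y R) v (\<lambda>x h. gv x \<bullet> h)" and gv: "bdiff_on (ball y R) gv Hv"
      and symH: "\<And>x h k. x \<in> ball y R \<Longrightarrow> Hv x h \<bullet> k = h \<bullet> Hv x k" and R2: "R2 < R"
      and out: "\<And>x. x \<notin> cball y R2 \<Longrightarrow> v x = 0 \<and> gv x = 0"
      and inn: "\<And>x. x \<in> ball y r0 \<Longrightarrow> v x = 0 \<and> gv x = 0"
      and int: "integrable lborel \<alpha>" "integrable lborel \<beta>"
      and al: "\<And>x. x \<in> ball y R \<Longrightarrow>
         \<alpha> x \<le> \<tau> * (exp (\<tau> * exp (- (\<mu> / 2) * (norm (x - y))\<^sup>2)))\<^sup>2 * ((norm (gv x))\<^sup>2 + (v x)\<^sup>2)"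
      and al0: "\<And>x. x \<notin> ball y R \<Longrightarrow> \<alpha> x \<le> 0" and be0: "\<And>x. 0 \<le> \<beta> x"
      and be: "\<And>x. x \<in> ball y R \<Longrightarrow> r0 \<le> norm (x - y) \<Longrightarrow>
         (exp (\<tau> * exp (- (\<mu> / 2) * (norm (x - y))\<^sup>2)) * lin_trace (\<lambda>h. A x *v Hv x h + A' x h *v gv x))\<^sup>2 \<le> \<beta> x"
    interpret cc: carleman_conjugation A A' y R \<kappa> v gv Hv \<mu> \<tau>
      by unfold_locales (use v gv symH mu1 in auto)
    have E: "exp (\<tau> * exp (- (\<mu> / 2) * (norm (x - y))\<^sup>2)) = cc.E x" for x
      by (simp add: cc.E_def cc.ph_def power2_norm_eq_inner)
    have tau1: "\<tau> \<ge> 1" and tau2: "\<tau> * \<phi>0 \<ge> 2 * M * \<mu>" and tau3: "\<phi>0^3 / 2 * \<tau> \<ge> 4 * \<mu>^4 * M\<^sup>2"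
    proof -
      show "\<tau> \<ge> 1" using tau q by (auto simp: \<tau>0_def)
      have "2 * M * \<mu> / \<phi>0 \<le> \<tau>" using tau q by (auto simp: \<tau>0_def)
      then show "\<tau> * \<phi>0 \<ge> 2 * M * \<mu>" using ph0 by (simp add: field_simps)
      have "4 * \<mu>^4 * M\<^sup>2 / c \<le> \<tau>" using tau q by (auto simp: \<tau>0_def)
      then show "\<phi>0^3 / 2 * \<tau> \<ge> 4 * \<mu>^4 * M\<^sup>2" using c unfolding c_def[symmetric] by (simp add: field_simps)
    qed
    have V0: "cc.V x = 0" if "x \<notin> cball y R2" for x
      using out[OF that] by (simp add: cc.V_def cc.a_def cc.g_def cc.k_def cc.w_def)
    define D where "D x = (if x \<in> ball y R then lin_trace (cc.V' x) else 0)" for x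
    have "has_bochner_integral lborel D 0"
      unfolding D_def[abs_def]
      by (rule integral_divergence_eq_0[OF cc.bdiff_V, where K="cball y R2"]) (use V0 R2 in auto)
    then have D: "integrable lborel D" "(\<integral>x. D x \<partial>lborel) = 0" by (auto simp: has_bochner_integral_iff)
    have pt: "\<alpha> x \<le> K / c * (\<beta> x - 2 * D x)" for x
    proof (cases "x \<in> ball y R")
      case False
      have "0 \<le> K / c * \<beta> x" using K c be0[of x] by simp
      then show ?thesis unfolding D_def using False al0[OF False] by simp
    next
      case True
      show ?thesis
      proof (cases "x \<in> ball y r0")
        case in0: True
        have "v x = 0" "gv x = 0" using inn[OF in0] by auto
        \<comment> \<open>\<open>V\<close> is quadratic in \<open>v\<close> and its gradient, so
          every term of its derivative keeps an undifferentiated factor; nothing about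
          \<open>Hv\<close> has to be known.\<close>
        then have "cc.V' x h = 0" for h
          by (simp add: cc.V'_def cc.a_def cc.g_def cc.k_def cc.w_def)
        then have "D x = 0" by (simp add: D_def lin_trace_def)
        moreover have "\<alpha> x \<le> 0" using al[OF True] \<open>v x = 0\<close> \<open>gv x = 0\<close> by simp
        moreover have "0 \<le> K / c * \<beta> x" using K c be0[of x] by simp
        ultimately show ?thesis by simp
      next
        case False
        then have r: "r0 \<le> norm (x - y)" by (simp add: dist_norm norm_minus_commute)
        have "norm (x - y) \<le> R" using True by (simp add: dist_norm norm_minus_commute)
        then have "(norm (x - y))\<^sup>2 \<le> R\<^sup>2" by (intro power_mono) auto
        then have phx: "\<phi>0 \<le> cc.ph x"
          using mu1 by (simp add: \<phi>0_def cc.ph_def power2_norm_eq_inner)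
        have "\<phi>0^3 / 2 * (\<tau> * (norm (cc.g x))\<^sup>2 + \<tau>^3 * (cc.w x)\<^sup>2) \<le> (cc.E x * cc.P x)\<^sup>2 - 2 * lin_trace (cc.V' x)"
          by (rule cc.carleman_pointwise[OF M(1) M(2)[OF True] M(3)[OF True] M(4)[OF True] M(5)[OF True]
             M(6)[OF True] M(7)[OF True] True c0 c0p[OF True r] l1 l2 ph0 phx tau2 tau1 tau3])
        also have "\<dots> \<le> \<beta> x - 2 * D x"
          using be[OF True r] True unfolding E by (simp add: D_def cc.P_def)
        finally have 1: "\<tau> * (norm (cc.g x))\<^sup>2 + \<tau>^3 * (cc.w x)\<^sup>2 \<le> (\<beta> x - 2 * D x) / c"
          unfolding c_def[symmetric] using c by (simp add: field_simps)
        have "\<alpha> x \<le> \<tau> * (cc.E x)\<^sup>2 * ((norm (gv x))\<^sup>2 + (v x)\<^sup>2)" using al[OF True] unfolding E .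
        also have "\<dots> \<le> K * (\<tau> * (norm (cc.g x))\<^sup>2 + \<tau>^3 * (cc.w x)\<^sup>2)"
          unfolding K_def by (rule cc.weighted_norm_le) (use M(2)[OF True] tau1 in auto)
        also have "\<dots> \<le> K * ((\<beta> x - 2 * D x) / c)" using 1 K by (intro mult_left_mono) auto
        finally show ?thesis by simp
      qed
    qed
    have "(\<integral>x. \<alpha> x \<partial>lborel) \<le> (\<integral>x. K / c * (\<beta> x - 2 * D x) \<partial>lborel)"
      using int D(1) pt by (intro integral_mono) auto
    also have "\<dots> = K / c * (\<integral>x. \<beta> x \<partial>lborel)" using int D by simp
    finally show "(\<integral>x. \<alpha> x \<partial>lborel) \<le> K / c * (\<integral>x. \<beta> x \<partial>lborel)" .
  qed
qed

section \<open>A radial cutoff of class C^2\<close>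

lemma has_derivative_max_power:
  "((\<lambda>t::real. (max 0 t) ^ (Suc (Suc n))) has_real_derivative real (Suc (Suc n)) * (max 0 t) ^ Suc n) (at t)"
proof (cases t "0 :: real" rule: linorder_cases)
  case less
  have "((\<lambda>_. 0) has_real_derivative 0) (at t)" by simp
  then have "((\<lambda>t::real. (max 0 t) ^ (Suc (Suc n))) has_real_derivative 0) (at t)"
    by (rule has_field_derivative_transform_within_open[where S="{..<0}"]) (use less in auto)
  then show ?thesis using less by simp
next
  case greater
  have "((\<lambda>t. t ^ (Suc (Suc n))) has_real_derivative real (Suc (Suc n)) * t ^ Suc n) (at t)"
    using DERIV_pow[of "Suc (Suc n)" t] by simp
  then have "((\<lambda>t::real. (max 0 t) ^ (Suc (Suc n))) has_real_derivative real (Suc (Suc n)) * t ^ Suc n) (at t)"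
    by (rule has_field_derivative_transform_within_open[where S="{0<..}"]) (use greater in auto)
  then show ?thesis using greater by simp
next
  case equal
  \<comment> \<open>At the kink the quotient is at most \<open>\<bar>h\<bar> ^ Suc n\<close>; the
    exponent is written \<open>Suc (Suc n)\<close> because it must be at least 2 for this to tend to
    0.\<close>
  have "((\<lambda>h. (max 0 h) ^ (Suc (Suc n)) / h) \<longlongrightarrow> 0) (at (0::real))"
  proof (rule Lim_null_comparison)
    show "\<forall>\<^sub>F h in at 0. norm ((max 0 h) ^ (Suc (Suc n)) / h) \<le> \<bar>h :: real\<bar> ^ Suc n"
    proof (intro always_eventually allI)
      fix h :: real
      show "norm ((max 0 h) ^ (Suc (Suc n)) / h) \<le> \<bar>h\<bar> ^ Suc n"
      proof (cases "h > 0")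
        case False
        then have "max 0 h = 0" by simp
        moreover have "0 \<le> \<bar>h\<bar> ^ Suc n" by (rule zero_le_power) simp
        ultimately show ?thesis by (simp only: power_0_Suc div_0 norm_zero)
      qed (simp add: max_def)
    qed
    have "((\<lambda>h. \<bar>h\<bar> ^ Suc n) \<longlongrightarrow> \<bar>0\<bar> ^ Suc n) (at (0::real))" by (intro tendsto_intros)
    then show "((\<lambda>h. \<bar>h\<bar> ^ Suc n) \<longlongrightarrow> 0) (at (0::real))" by simp
  qed
  then show ?thesis using equal by (simp add: DERIV_def)
qed

lemma bdiff_on_max_power:
  fixes f :: "'a::real_normed_vector \<Rightarrow> real"
  assumes f: "bdiff_on S f f'"
  shows "bdiff_on S (\<lambda>x. (max 0 (f x)) ^ (Suc (Suc n))) (\<lambda>x h. real (Suc (Suc n)) * (max 0 (f x)) ^ Suc n * f' x h)"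
proof -
  obtain C where C: "C \<ge> 0" "\<And>x. x \<in> S \<Longrightarrow> \<bar>f x\<bar> \<le> C" using f unfolding bdiff_on_def by force
  show ?thesis
  proof (rule bdiff_on_compose_real[OF f has_derivative_max_power,
      where B="max (C ^ Suc (Suc n)) (real (Suc (Suc n)) * C ^ Suc n)"])
    fix x assume "x \<in> S"
    then have m: "0 \<le> max 0 (f x)" "max 0 (f x) \<le> C" using C(1) C(2)[of x] by auto
    show "\<bar>max 0 (f x) ^ Suc (Suc n)\<bar> \<le> max (C ^ Suc (Suc n)) (real (Suc (Suc n)) * C ^ Suc n)"
      using power_mono[OF m(2,1), of "Suc (Suc n)"] m(1) by (simp add: power_abs le_max_iff_disj del: power_Suc)
    show "\<bar>real (Suc (Suc n)) * max 0 (f x) ^ Suc n\<bar> \<le> max (C ^ Suc (Suc n)) (real (Suc (Suc n)) * C ^ Suc n)"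
      using mult_left_mono[OF power_mono[OF m(2,1), of "Suc n"], of "real (Suc (Suc n))"] m(1)
      by (simp add: abs_mult power_abs le_max_iff_disj del: power_Suc)
  qed
qed

lemma bdiff_on_diff_const:
  assumes "bdiff_on S f f'" shows "bdiff_on S (\<lambda>x. c - f x) (\<lambda>x h. - f' x h)"
  using bdiff_on_add[OF bdiff_on_const[of S c] bdiff_on_cmult[OF assms, of "-1"]] by simp

text \<open>With \<open>f t = (max 0 t)^3\<close>, the function \<open>1 - f (1 - f (1 - t))\<close> is of class \<open>C\<^sup>2\<close>, equal to 1 for
  \<open>t \<le> 0\<close> and to 0 for \<open>t \<ge> 1\<close>.\<close>

lemma radial_cutoff:
  fixes y :: "'a::euclidean_space"
  assumes R: "0 < R1" "R1 < R2"
  obtains \<theta> :: "'a \<Rightarrow> real" and g H where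
    "\<And>S. bounded S \<Longrightarrow> bdiff_on S \<theta> (\<lambda>x h. g x \<bullet> h)" "\<And>S. bounded S \<Longrightarrow> bdiff_on S g H"
    "\<And>x h k. H x h \<bullet> k = h \<bullet> H x k"
    "\<And>x. 0 \<le> \<theta> x" "\<And>x. \<theta> x \<le> 1"
    "\<And>x h. norm (x - y) \<le> R1 \<Longrightarrow> \<theta> x = 1 \<and> g x = 0 \<and> H x h = 0"
    "\<And>x h. norm (x - y) \<ge> R2 \<Longrightarrow> \<theta> x = 0 \<and> g x = 0 \<and> H x h = 0"
proof -
  \<comment> \<open>Chosen so that \<open>q\<close> falls from 1 at distance \<open>R1\<close> to 0
    at distance \<open>R2\<close>. Using the squared distance avoids the singularity of the norm at
    the centre.\<close>
  define c where "c = 1 / (R2\<^sup>2 - R1\<^sup>2)"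
  have "R1\<^sup>2 < R2\<^sup>2" using R by (intro power_strict_mono) auto
  then have c: "c > 0" by (simp add: c_def)
  define q where "q x = 1 - (c * ((x - y) \<bullet> (x - y)) - c * R1\<^sup>2)" for x
  define q' where "q' x h = - 2 * c * ((x - y) \<bullet> h)" for x h
  define m where "m x = max 0 (q x)" for x
  define n where "n x = max 0 (1 - m x ^ 3)" for x
  define \<theta> where "\<theta> x = 1 - n x ^ 3" for x
  \<comment> \<open>The number 18 is 2 * 3 * 3: a 3 from each of the two cubes and a 2 from the
    squared distance.\<close>
  define s where "s x = - 18 * c * ((n x)\<^sup>2 * (m x)\<^sup>2)" for x
  define s' where "s' x h = - 18 * c * ((n x)\<^sup>2 * (2 * m x * q' x h) + (2 * n x * (- (3 * (m x)\<^sup>2 * q' x h))) * (m x)\<^sup>2)" for x h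
  define g where "g x = s x *\<^sub>R (x - y)" for x
  define H where "H x h = s x *\<^sub>R h + s' x h *\<^sub>R (x - y)" for x h
  have b: "bdiff_on S \<theta> (\<lambda>x h. g x \<bullet> h)" "bdiff_on S g H" if S: "bounded S" for S
  proof -
    note i = bdiff_on_ident[OF S, of y]
    have "bdiff_on S (\<lambda>x. 1 + c * R1\<^sup>2 - c *\<^sub>R ((x - y) \<bullet> (x - y))) (\<lambda>x h. - (c *\<^sub>R ((x - y) \<bullet> h + h \<bullet> (x - y))))"
      by (rule bdiff_on_diff_const[OF bdiff_on_cmult[OF bdiff_on_inner[OF i i]]])
    moreover have "(\<lambda>x. 1 + c * R1\<^sup>2 - c *\<^sub>R ((x - y) \<bullet> (x - y))) = q" by (auto simp: q_def)
    ultimately have q: "bdiff_on S q q'"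
      by (auto intro: bdiff_on_cong simp: q'_def inner_commute)
    have m2: "bdiff_on S (\<lambda>x. (m x)\<^sup>2) (\<lambda>x h. 2 * m x * q' x h)"
      using bdiff_on_max_power[OF q, of 0] by (simp add: m_def numeral_2_eq_2)
    have m3: "bdiff_on S (\<lambda>x. m x ^ 3) (\<lambda>x h. 3 * (m x)\<^sup>2 * q' x h)"
      using bdiff_on_max_power[OF q, of 1] by (simp add: m_def numeral_2_eq_2 numeral_3_eq_3)
    note d = bdiff_on_diff_const[OF m3, of 1]
    have n2: "bdiff_on S (\<lambda>x. (n x)\<^sup>2) (\<lambda>x h. 2 * n x * (- (3 * (m x)\<^sup>2 * q' x h)))"
      using bdiff_on_max_power[OF d, of 0] by (simp add: n_def numeral_2_eq_2)
    have n3: "bdiff_on S (\<lambda>x. n x ^ 3) (\<lambda>x h. 3 * (n x)\<^sup>2 * (- (3 * (m x)\<^sup>2 * q' x h)))"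
      using bdiff_on_max_power[OF d, of 1] by (simp add: n_def numeral_2_eq_2 numeral_3_eq_3)
    have "bdiff_on S \<theta> (\<lambda>x h. - (3 * (n x)\<^sup>2 * (- (3 * (m x)\<^sup>2 * q' x h))))"
      unfolding \<theta>_def[abs_def] by (rule bdiff_on_diff_const[OF n3])
    then show "bdiff_on S \<theta> (\<lambda>x h. g x \<bullet> h)"
      by (rule bdiff_on_cong) (simp add: g_def s_def q'_def)
    have s: "bdiff_on S s s'"
      using bdiff_on_cmult[OF bdiff_on_mult[OF n2 m2], of "- 18 * c"] unfolding s_def[abs_def] s'_def[abs_def] by simp
    show "bdiff_on S g H" unfolding g_def[abs_def] H_def[abs_def] by (rule bdiff_on_scaleR[OF s i])
  qed
  have s'_eq: "\<exists>\<sigma>. \<forall>h. s' x h = \<sigma> * ((x - y) \<bullet> h)" for x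
    by (rule exI[of _ "- 18 * c * ((n x)\<^sup>2 * (2 * m x * (- 2 * c)) + (2 * n x * (- (3 * (m x)\<^sup>2 * (- 2 * c)))) * (m x)\<^sup>2)"])
       (simp add: s'_def q'_def algebra_simps)
  have sq: "(x - y) \<bullet> (x - y) = (norm (x - y))\<^sup>2" for x by (simp add: power2_norm_eq_inner)
  have m0: "m x \<ge> 0" for x by (simp add: m_def)
  have n01: "0 \<le> n x" "n x \<le> 1" for x using m0[of x] by (auto simp: n_def)
  show ?thesis
  proof (rule that[of \<theta> g H, OF b])
    show "H x h \<bullet> k = h \<bullet> H x k" for x h k
    proof -
      obtain \<sigma> where "\<And>h. s' x h = \<sigma> * ((x - y) \<bullet> h)" using s'_eq by blast
      then show ?thesis by (simp add: H_def inner_add_left inner_add_right inner_commute)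
    qed
    show "0 \<le> \<theta> x" for x using power_le_one[OF n01, of x 3] by (simp add: \<theta>_def)
    show "\<theta> x \<le> 1" for x using n01[of x] by (simp add: \<theta>_def)
    show "\<theta> x = 1 \<and> g x = 0 \<and> H x h = 0" if "norm (x - y) \<le> R1" for x h
    proof -
      have "(norm (x - y))\<^sup>2 \<le> R1\<^sup>2" using that by (intro power_mono) auto
      then have "c * (norm (x - y))\<^sup>2 \<le> c * R1\<^sup>2" using c by (intro mult_left_mono) auto
      then have "q x \<ge> 1" unfolding q_def sq by simp
      then have "m x \<ge> 1" by (simp add: m_def)
      then have "m x ^ 3 \<ge> 1" by (rule one_le_power)
      then have "n x = 0" by (simp add: n_def)
      then show ?thesis by (simp add: \<theta>_def g_def H_def s_def s'_def)
    qed
    show "\<theta> x = 0 \<and> g x = 0 \<and> H x h = 0" if "norm (x - y) \<ge> R2" for x h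
    proof -
      have "R2\<^sup>2 \<le> (norm (x - y))\<^sup>2" using that R by (intro power_mono) auto
      then have "c * R2\<^sup>2 \<le> c * (norm (x - y))\<^sup>2" using c by (intro mult_left_mono) auto
      moreover have "c * R2\<^sup>2 - c * R1\<^sup>2 = 1" using \<open>R1\<^sup>2 < R2\<^sup>2\<close> by (simp add: c_def flip: diff_divide_distrib)
      ultimately have "q x \<le> 0" unfolding q_def sq by linarith
      then have "m x = 0" by (simp add: m_def)
      then show ?thesis by (simp add: \<theta>_def g_def H_def s_def s'_def n_def)
    qed
  qed auto
qed

section \<open>Mollifiers\<close>

lemma power_div_fact_le_exp:
  fixes x :: real assumes "0 \<le> x" shows "x ^ n / fact n \<le> exp x"
proof -
  have s: "(\<lambda>n. x ^ n /\<^sub>R fact n) sums exp x" by (rule exp_converges)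
  have "(\<Sum>i\<in>{n}. x ^ i /\<^sub>R fact i) \<le> (\<Sum>n. x ^ n /\<^sub>R fact n)"
    using s assms by (intro sum_le_suminf) (auto simp: sums_iff)
  then show ?thesis using s by (simp add: sums_iff field_simps)
qed

text \<open>The classical flat function is the case \<open>k = 0\<close>. The powers of
  \<open>t\<close> in the denominator close the family under differentiation up to linear
  combinations, so smoothness reduces to one differentiability statement for all
  \<open>k\<close>.\<close>

definition flat_exp :: "nat \<Rightarrow> real \<Rightarrow> real" where
  "flat_exp k t = (if t > 0 then exp (- 1 / t) / t ^ k else 0)"

text \<open>Keeps only the term of order \<open>k + 2\<close> in the series of exp (1 / t). The two
  surplus powers of \<open>t\<close> make the difference quotient at the origin tend to 0.\<close>

lemma flat_exp_le:
  assumes "t > 0" shows "flat_exp k t \<le> fact (k + 2) * t\<^sup>2"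
proof -
  define F :: real where "F = fact (k + 2)"
  have F: "F > 0" by (simp add: F_def)
  have "(1 / t) ^ (k + 2) / F \<le> exp (1 / t)"
    unfolding F_def by (rule power_div_fact_le_exp) (use assms in simp)
  then have "(1 / t) ^ (k + 2) \<le> F * exp (1 / t)" using F by (simp only: pos_divide_le_eq mult.commute)
  then have "exp (- (1 / t)) * (1 / t) ^ (k + 2) \<le> exp (- (1 / t)) * (F * exp (1 / t))"
    by (intro mult_left_mono) auto
  also have "\<dots> = F" by (simp add: exp_minus)
  finally have "exp (- (1 / t)) / (t ^ k * t\<^sup>2) \<le> F"
    by (simp add: power_add power_one_over divide_inverse mult_ac power2_eq_square power_inverse)
  then show ?thesis using assms unfolding F_def[symmetric] by (simp add: flat_exp_def field_simps)
qed

lemma flat_exp_nonneg: "flat_exp k t \<ge> 0" by (simp add: flat_exp_def)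

lemma has_derivative_flat_exp:
  "(flat_exp k has_real_derivative flat_exp (k + 2) t - real k * flat_exp (k + 1) t) (at t)"
proof (cases t "0 :: real" rule: linorder_cases)
  case less
  have "((\<lambda>_. 0) has_real_derivative 0) (at t)" by simp
  then have "(flat_exp k has_real_derivative 0) (at t)"
    by (rule has_field_derivative_transform_within_open[where S="{..<0}"])
       (use less in \<open>auto simp: flat_exp_def\<close>)
  then show ?thesis using less by (simp add: flat_exp_def)
next
  case greater
  have "((\<lambda>t. exp (- 1 / t) / t ^ k) has_real_derivative
     (exp (- 1 / t) * (1 / t\<^sup>2) * t ^ k - exp (- 1 / t) * (real k * t ^ (k - 1))) / (t ^ k * t ^ k)) (at t)"
    using greater by (auto intro!: derivative_eq_intros simp: power2_eq_square)
  moreover have "(exp (- 1 / t) * (1 / t\<^sup>2) * t ^ k - exp (- 1 / t) * (real k * t ^ (k - 1))) / (t ^ k * t ^ k)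
      = flat_exp (k + 2) t - real k * flat_exp (k + 1) t"
    using greater by (cases k) (auto simp: flat_exp_def field_simps power2_eq_square)
  ultimately have "((\<lambda>t. exp (- 1 / t) / t ^ k) has_real_derivative flat_exp (k + 2) t - real k * flat_exp (k + 1) t) (at t)"
    by simp
  then show ?thesis
    by (rule has_field_derivative_transform_within_open[where S="{0<..}"])
       (use greater in \<open>auto simp: flat_exp_def\<close>)
next
  case equal
  have "((\<lambda>h. flat_exp k h / h) \<longlongrightarrow> 0) (at 0)"
  proof (rule Lim_null_comparison)
    show "\<forall>\<^sub>F h in at 0. norm (flat_exp k h / h) \<le> fact (k + 2) * \<bar>h\<bar>"
    proof (intro always_eventually allI)
      fix h :: real
      show "norm (flat_exp k h / h) \<le> fact (k + 2) * \<bar>h\<bar>"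
      proof (cases "h > 0")
        case True
        then show ?thesis using flat_exp_le[of h k] flat_exp_nonneg[of k h]
          by (simp del: fact_Suc add: pos_divide_le_eq power2_eq_square mult.assoc)
      next
        case False
        then have "norm (flat_exp k h / h) = 0" by (simp add: flat_exp_def)
        then show ?thesis by (metis abs_ge_zero fact_ge_zero mult_nonneg_nonneg)
      qed
    qed
    show "((\<lambda>h. fact (k + 2) * \<bar>h\<bar>) \<longlongrightarrow> (0::real)) (at 0)"
      by (auto intro!: tendsto_eq_intros)
  qed
  then show ?thesis using equal by (simp add: DERIV_def flat_exp_def)
qed

section \<open>Iterated partial derivatives of smooth functions\<close>

lemma partial_eqI:
  "(f has_derivative f') (at x) \<Longrightarrow> partial i f x = f' (axis i 1)"
  unfolding partial_def using frechet_derivative_at by metis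

lemma has_derivative_partials:
  assumes "f differentiable (at x)"
  shows "(f has_derivative (\<lambda>h. (\<chi> i. partial i f x) \<bullet> h)) (at x)"
proof -
  obtain f' where f': "(f has_derivative f') (at x)" using assms by (auto simp: differentiable_def)
  have "f' h = (\<chi> i. partial i f x) \<bullet> h" for h
  proof -
    have "f' h = f' (\<Sum>i\<in>UNIV. (h $ i) *\<^sub>R axis i 1)"
      by (simp add: basis_expansion[of h, unfolded scalar_mult_eq_scaleR])
    also have "\<dots> = (\<Sum>i\<in>UNIV. (h $ i) * f' (axis i 1))"
      using has_derivative_linear[OF f'] by (simp add: linear_sum linear_scale)
    finally show ?thesis by (simp add: inner_vec_def partial_eqI[OF f'] mult.commute)
  qed
  then have "f' = (\<lambda>h. (\<chi> i. partial i f x) \<bullet> h)" by (rule ext)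
  then show ?thesis using f' by simp
qed

lemma partials_snoc: "partials (\<alpha> @ [i]) f = partials \<alpha> (partial i f)"
  by (simp add: partials_def)

lemma partials_Cons: "partials (i # \<alpha>) f = partial i (partials \<alpha> f)"
  by (simp add: partials_def)

lemma partials_Nil [simp]: "partials [] f = f"
  by (simp add: partials_def)

definition smooth :: "(real ^ 'n \<Rightarrow> real) \<Rightarrow> bool" where
  "smooth f \<longleftrightarrow> (\<forall>\<alpha> x. partials \<alpha> f differentiable (at x))"

lemma smooth_differentiable: "smooth f \<Longrightarrow> f differentiable (at x)"
  unfolding smooth_def by (metis partials_Nil)

lemma smooth_partial: "smooth f \<Longrightarrow> smooth (partial i f)"
  unfolding smooth_def by (metis partials_snoc)

lemma smooth_continuous: "smooth f \<Longrightarrow> continuous_on UNIV f"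
  using smooth_differentiable differentiable_imp_continuous_within
  by (blast intro: continuous_at_imp_continuous_on)

text \<open>The affine argument serves twice: with \<open>r = 1 / \<epsilon>\<close> for the
  rescaled bump, and with \<open>r = - 1\<close> for the reflected kernel that is used as a test
  function.\<close>

lemma partials_affine:
  assumes "smooth f"
  shows "partials \<alpha> (\<lambda>x. c * f (r *\<^sub>R x + a)) = (\<lambda>x. c * r ^ length \<alpha> * partials \<alpha> f (r *\<^sub>R x + a))"
proof (induction \<alpha>)
  case (Cons i \<alpha>)
  show ?case
  proof
    fix x
    have "(partials \<alpha> f has_derivative (\<lambda>h. (\<chi> i. partial i (partials \<alpha> f) (r *\<^sub>R x + a)) \<bullet> h)) (at (r *\<^sub>R x + a))"
      by (rule has_derivative_partials) (use assms in \<open>auto simp: smooth_def\<close>)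
    then have "((\<lambda>x. c * r ^ length \<alpha> * partials \<alpha> f (r *\<^sub>R x + a)) has_derivative
       (\<lambda>h. c * r ^ length \<alpha> * ((\<chi> i. partial i (partials \<alpha> f) (r *\<^sub>R x + a)) \<bullet> (r *\<^sub>R h)))) (at x)"
      by (intro has_derivative_mult_right has_derivative_compose[where f="\<lambda>x. r *\<^sub>R x + a" and g="partials \<alpha> f"])
         (auto intro!: derivative_eq_intros)
    from partial_eqI[OF this, of i]
    show "partials (i # \<alpha>) (\<lambda>x. c * f (r *\<^sub>R x + a)) x
      = c * r ^ length (i # \<alpha>) * partials (i # \<alpha>) f (r *\<^sub>R x + a)"
      unfolding partials_Cons Cons.IH by (simp add: inner_axis)
  qed
qed simp

lemma smooth_affine:
  assumes "smooth f" shows "smooth (\<lambda>x. c * f (r *\<^sub>R x + a))"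
  unfolding smooth_def partials_affine[OF assms]
proof (intro allI differentiable_mult differentiable_const)
  fix \<alpha> x
  have "(partials \<alpha> f \<circ> (\<lambda>x. r *\<^sub>R x + a)) differentiable at x"
    using assms unfolding smooth_def
    by (intro differentiable_chain_at derivative_intros) auto
  then show "(\<lambda>x. partials \<alpha> f (r *\<^sub>R x + a)) differentiable at x" by (simp add: o_def)
qed

text \<open>A class of functions vanishing outside the unit ball and closed under partial
  derivatives. All iterated derivatives of the bump stay in it, and are therefore differentiable,
  bounded and integrable.\<close>

inductive bump_class :: "(real ^ 'n \<Rightarrow> real) \<Rightarrow> bool" where
  "bump_class (\<lambda>x. flat_exp k (1 - x \<bullet> x))"
| "bump_class f \<Longrightarrow> bump_class (\<lambda>x. c * f x)"
| "bump_class f \<Longrightarrow> bump_class (\<lambda>x. x $ i * f x)"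
| "bump_class f \<Longrightarrow> bump_class g \<Longrightarrow> bump_class (\<lambda>x. f x + g x)"

lemma has_derivative_flat_exp_radial:
  "((\<lambda>x. flat_exp k (1 - x \<bullet> x)) has_derivative
    (\<lambda>h. (-2 * (flat_exp (k + 2) (1 - x \<bullet> x) - real k * flat_exp (k + 1) (1 - x \<bullet> x))) * (x \<bullet> h))) (at x)"
proof -
  have "((\<lambda>x. 1 - x \<bullet> x) has_derivative (\<lambda>h. - 2 * (x \<bullet> h))) (at x)"
    by (auto intro!: derivative_eq_intros simp: inner_commute)
  from has_derivative_compose[OF this has_derivative_flat_exp[unfolded has_field_derivative_def], of k]
  show ?thesis by (simp add: algebra_simps)
qed

lemma bump_class_derivative:
  "bump_class f \<Longrightarrow> \<exists>f'. (\<forall>i. bump_class (\<lambda>x. f' x $ i)) \<and> (\<forall>x. (f has_derivative (\<lambda>h. f' x \<bullet> h)) (at x))"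
proof (induction rule: bump_class.induct)
  case (1 k)
  show ?case
  proof (intro exI conjI allI)
    fix x :: "real ^ 'a"
    show "((\<lambda>x. flat_exp k (1 - x \<bullet> x)) has_derivative
      (\<lambda>h. ((-2 * (flat_exp (k + 2) (1 - x \<bullet> x) + (- real k) * flat_exp (k + 1) (1 - x \<bullet> x))) *\<^sub>R x) \<bullet> h)) (at x)"
      using has_derivative_flat_exp_radial[of k x] by simp
    fix i
    have "bump_class (\<lambda>x::real^'a. x $ i * (-2 * (flat_exp (k + 2) (1 - x \<bullet> x) + (- real k) * flat_exp (k + 1) (1 - x \<bullet> x))))"
      by (intro bump_class.intros)
    then show "bump_class (\<lambda>x::real^'a. ((-2 * (flat_exp (k + 2) (1 - x \<bullet> x) + (- real k) * flat_exp (k + 1) (1 - x \<bullet> x))) *\<^sub>R x) $ i)"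
      by (simp add: mult_ac)
  qed
next
  case (2 f c)
  then obtain f' where f': "\<And>i. bump_class (\<lambda>x. f' x $ i)" "\<And>x. (f has_derivative (\<lambda>h. f' x \<bullet> h)) (at x)" by blast
  show ?case
  proof (intro exI conjI allI)
    show "((\<lambda>x. c * f x) has_derivative (\<lambda>h. (c *\<^sub>R f' x) \<bullet> h)) (at x)" for x
      using has_derivative_mult_right[OF f'(2)[of x], of c] by simp
    show "bump_class (\<lambda>x. (c *\<^sub>R f' x) $ i)" for i
      using bump_class.intros(2)[OF f'(1)[of i], of c] by simp
  qed
next
  case (3 f j)
  then obtain f' where f': "\<And>i. bump_class (\<lambda>x. f' x $ i)" "\<And>x. (f has_derivative (\<lambda>h. f' x \<bullet> h)) (at x)" by blast
  show ?case
  proof (intro exI conjI allI)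
    show "((\<lambda>x. x $ j * f x) has_derivative (\<lambda>h. (x $ j *\<^sub>R f' x + f x *\<^sub>R axis j 1) \<bullet> h)) (at x)" for x
    proof -
      have "((\<lambda>x. x $ j * f x) has_derivative (\<lambda>h. x $ j * (f' x \<bullet> h) + h $ j * f x)) (at x)"
        by (intro has_derivative_mult f' bounded_linear.has_derivative[OF bounded_linear_vec_nth] has_derivative_ident)
      then show ?thesis by (simp add: inner_add_left inner_axis' mult.commute)
    qed
    fix i
    show "bump_class (\<lambda>x. (x $ j *\<^sub>R f' x + f x *\<^sub>R axis j 1) $ i)"
      using bump_class.intros(4)[OF bump_class.intros(3)[OF f'(1)[of i], of j] bump_class.intros(2)[OF 3(1), of "axis j 1 $ i"]]
      by (simp add: mult.commute)
  qed
next
  case (4 f g)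
  then obtain f' g' where f': "\<And>i. bump_class (\<lambda>x. f' x $ i)" "\<And>x. (f has_derivative (\<lambda>h. f' x \<bullet> h)) (at x)"
    and g': "\<And>i. bump_class (\<lambda>x. g' x $ i)" "\<And>x. (g has_derivative (\<lambda>h. g' x \<bullet> h)) (at x)" by blast
  show ?case
  proof (intro exI conjI allI)
    show "((\<lambda>x. f x + g x) has_derivative (\<lambda>h. (f' x + g' x) \<bullet> h)) (at x)" for x
      using has_derivative_add[OF f'(2) g'(2), of x] by (simp add: inner_add_left)
    show "bump_class (\<lambda>x. (f' x + g' x) $ i)" for i
      using bump_class.intros(4)[OF f'(1)[of i] g'(1)[of i]] by simp
  qed
qed

lemma bump_class_partial:
  assumes "bump_class f" shows "bump_class (partial i f)"
proof -
  obtain f' where f': "\<And>i. bump_class (\<lambda>x. f' x $ i)" "\<And>x. (f has_derivative (\<lambda>h. f' x \<bullet> h)) (at x)"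
    using bump_class_derivative[OF assms] by blast
  have "partial i f = (\<lambda>x. f' x $ i)"
    by (rule ext) (simp add: partial_eqI[OF f'(2)] inner_axis)
  then show ?thesis using f' by simp
qed

lemma bump_class_smooth:
  assumes "bump_class f" shows "smooth f"
proof -
  have "bump_class (partials \<alpha> f)" for \<alpha>
    using assms by (induction \<alpha>) (auto simp: partials_Cons bump_class_partial)
  then show ?thesis unfolding smooth_def differentiable_def using bump_class_derivative by blast
qed

lemma bump_class_eq_0: "bump_class f \<Longrightarrow> norm x \<ge> 1 \<Longrightarrow> f x = 0"
proof (induction rule: bump_class.induct)
  case (1 k)
  have "1\<^sup>2 \<le> (norm x)\<^sup>2" using 1 by (intro power_mono) auto
  then show ?case by (simp add: flat_exp_def power2_norm_eq_inner)
qed auto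

lemma bump_class_bounded:
  assumes "bump_class f" obtains C where "\<And>x. \<bar>f x\<bar> \<le> C"
proof -
  have "continuous_on (cball 0 1) f"
    using smooth_continuous[OF bump_class_smooth[OF assms]] continuous_on_subset by blast
  then have "bounded (f ` cball 0 1)" by (intro compact_imp_bounded compact_continuous_image) auto
  then obtain C where C: "\<And>x. x \<in> cball 0 1 \<Longrightarrow> \<bar>f x\<bar> \<le> C"
    unfolding bounded_iff by force
  have "\<bar>f x\<bar> \<le> \<bar>C\<bar>" for x
    using C[of x] bump_class_eq_0[OF assms, of x] by (cases "norm x \<le> 1") auto
  then show ?thesis by (rule that)
qed

definition bump :: "real ^ 'n \<Rightarrow> real" where
  "bump x = flat_exp 0 (1 - x \<bullet> x)"

lemma bump_class_bump: "bump_class bump"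
  unfolding bump_def[abs_def] by (rule bump_class.intros)

lemma partial_bump: "partial i bump = (\<lambda>x. -2 * (x $ i * flat_exp 2 (1 - x \<bullet> x)))"
  unfolding bump_def[abs_def]
  by (rule ext) (simp add: partial_eqI[OF has_derivative_flat_exp_radial] inner_axis eval_nat_numeral)

text \<open>Read off from the explicit second derivatives. The symmetry passes to the Hessian of
  every mollification, where the Carleman estimate demands it.\<close>

lemma partial_partial_bump: "partial i (partial j bump) = partial j (partial i bump)"
proof
  fix x :: "real ^ 'a"
  have "((\<lambda>x. -2 * (x $ m * flat_exp 2 (1 - x \<bullet> x))) has_derivative
     (\<lambda>h. -2 * (x $ m * ((-2 * (flat_exp 4 (1 - x \<bullet> x) - 2 * flat_exp 3 (1 - x \<bullet> x))) * (x \<bullet> h)) + h $ m * flat_exp 2 (1 - x \<bullet> x)))) (at x)" for m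
    using has_derivative_flat_exp_radial[of 2 x]
    by (intro has_derivative_mult has_derivative_mult_right bounded_linear.has_derivative[OF bounded_linear_vec_nth] has_derivative_ident)
       (simp add: eval_nat_numeral)
  note d = partial_eqI[OF this]
  show "partial i (partial j bump) x = partial j (partial i bump) x"
    unfolding partial_bump d inner_axis by (cases "i = j") (simp_all add: axis_def mult_ac)
qed

lemma bump_nonneg: "bump x \<ge> 0" by (simp add: bump_def flat_exp_nonneg)

lemma bump_class_integrable:
  assumes "bump_class f" shows "integrable lborel f"
proof -
  obtain C where "\<And>x. \<bar>f x\<bar> \<le> C" using bump_class_bounded[OF assms] by blast
  then show ?thesis
    by (intro integrable_lborel_bounded_support[where C=C and a=0 and r=1])
       (use bump_class_eq_0[OF assms] smooth_continuous[OF bump_class_smooth[OF assms]]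
        in \<open>auto intro: borel_measurable_continuous_onI\<close>)
qed

lemma integral_bump_pos: "(\<integral>x. (bump :: real ^ 'n \<Rightarrow> real) x \<partial>lborel) > 0"
proof -
  let ?B = "cball (0 :: real ^ 'n) (1 / 2)"
  \<comment> \<open>On the ball of radius 1 / 2 the quantity \<open>1 - x \<bullet> x\<close> is at
    least 3 / 4, so the bump is at least exp (- 4 / 3) there.\<close>
  have ind: "integrable lborel (\<lambda>x. exp (- 4 / 3) * indicator ?B x :: real)"
    by (intro integrable_mult_right integrable_real_indicator)
       (use emeasure_lborel_cball_finite in \<open>auto simp: less_top[symmetric]\<close>)
  have "measure lborel ?B > 0" using content_cball_eq_0_iff[of "0 :: real ^ 'n" "1 / 2"] measure_nonneg[of lborel ?B]
    by linarith
  then have "0 < exp (- 4 / 3) * measure lborel ?B" by simp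
  also have "\<dots> = (\<integral>x. exp (- 4 / 3) * indicator ?B x \<partial>lborel)" by simp
  also have "\<dots> \<le> (\<integral>x. bump (x :: real ^ 'n) \<partial>lborel)"
  proof (rule integral_mono)
    show "integrable lborel (\<lambda>x. exp (- 4 / 3) * indicator ?B x :: real)" by (rule ind)
    show "integrable lborel (\<lambda>x::real ^ 'n. bump x)" using bump_class_integrable[OF bump_class_bump] by simp
    fix x :: "real ^ 'n"
    show "exp (- 4 / 3) * indicator ?B x \<le> bump x"
    proof (cases "x \<in> ?B")
      case True
      then have "(norm x)\<^sup>2 \<le> (1 / 2)\<^sup>2" by (intro power_mono) auto
      then have "x \<bullet> x \<le> (1 / 2)\<^sup>2" unfolding power2_norm_eq_inner .
      then have t: "1 - x \<bullet> x \<ge> 3 / 4" by (simp add: power2_eq_square)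
      then have "1 / (1 - x \<bullet> x) \<le> 4 / 3" by (simp add: field_simps)
      then show ?thesis using True t by (simp add: bump_def flat_exp_def)
    qed (simp add: bump_nonneg)
  qed
  finally show ?thesis .
qed

text \<open>Dividing by the integral of the bump spares its evaluation. The summand 0 brings the
  argument into the affine shape of \<open>partials_affine\<close>.\<close>

definition mollifier :: "real \<Rightarrow> real ^ 'n \<Rightarrow> real" where
  "mollifier \<epsilon> x = (1 / (\<epsilon> ^ CARD('n) * (\<integral>x. (bump :: real ^ 'n \<Rightarrow> real) x \<partial>lborel))) * bump ((1 / \<epsilon>) *\<^sub>R x + 0)"

lemma smooth_mollifier: "smooth (mollifier \<epsilon>)"
  unfolding mollifier_def[abs_def] by (rule smooth_affine[OF bump_class_smooth[OF bump_class_bump]])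

lemma partials_mollifier:
  "partials \<alpha> (mollifier \<epsilon> :: real ^ 'n \<Rightarrow> real) = (\<lambda>x. (1 / (\<epsilon> ^ CARD('n) * (\<integral>x. (bump :: real ^ 'n \<Rightarrow> real) x \<partial>lborel))) *
     (1 / \<epsilon>) ^ length \<alpha> * partials \<alpha> bump ((1 / \<epsilon>) *\<^sub>R x + 0))"
  unfolding mollifier_def[abs_def] by (rule partials_affine[OF bump_class_smooth[OF bump_class_bump]])

lemma partials_bump_class: "bump_class f \<Longrightarrow> bump_class (partials \<alpha> f)"
  by (induction \<alpha>) (auto simp: partials_Cons bump_class_partial)

lemma partials_mollifier_eq_0:
  assumes "\<epsilon> > 0" "norm x \<ge> \<epsilon>" shows "partials \<alpha> (mollifier \<epsilon>) x = 0"
proof -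
  have "norm ((1 / \<epsilon>) *\<^sub>R x + 0) \<ge> 1" using assms by simp
  from bump_class_eq_0[OF partials_bump_class[OF bump_class_bump] this]
  show ?thesis unfolding partials_mollifier by simp
qed

text \<open>By scaling, each derivative costs exactly one factor 1 / \<epsilon> and \<open>C\<close>
  is free of \<epsilon>; the commutator later wins this factor back.\<close>

lemma partials_mollifier_bound:
  obtains C where "C \<ge> 0"
    "\<And>\<epsilon> x. \<epsilon> > 0 \<Longrightarrow> \<bar>partials \<alpha> (mollifier \<epsilon> :: real ^ 'n \<Rightarrow> real) x\<bar> \<le> C / (\<epsilon> ^ CARD('n) * \<epsilon> ^ length \<alpha>)"
proof -
  obtain C where C: "\<And>x :: real ^ 'n. \<bar>partials \<alpha> bump x\<bar> \<le> C"
    using bump_class_bounded[OF partials_bump_class[OF bump_class_bump]] by blast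
  define I where "I = (\<integral>x. (bump :: real ^ 'n \<Rightarrow> real) x \<partial>lborel)"
  have I: "I > 0" unfolding I_def by (rule integral_bump_pos)
  have C0: "C \<ge> 0" using C[of 0] by linarith
  show ?thesis
  proof (rule that[of "C / I"])
    show "C / I \<ge> 0" using C0 I by simp
    fix \<epsilon> :: real and x :: "real ^ 'n" assume e: "\<epsilon> > 0"
    show "\<bar>partials \<alpha> (mollifier \<epsilon> :: real ^ 'n \<Rightarrow> real) x\<bar> \<le> C / I / (\<epsilon> ^ CARD('n) * \<epsilon> ^ length \<alpha>)"
      unfolding partials_mollifier I_def[symmetric] using C[of "(1 / \<epsilon>) *\<^sub>R x + 0"] e I
      by (simp add: abs_mult power_one_over field_simps)
  qed
qed

lemma integral_mollifier:
  assumes e: "\<epsilon> > 0"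
  shows "has_bochner_integral lborel (mollifier \<epsilon> :: real ^ 'n \<Rightarrow> real) 1"
proof -
  define I where "I = (\<integral>x. (bump :: real ^ 'n \<Rightarrow> real) x \<partial>lborel)"
  have I: "I > 0" unfolding I_def by (rule integral_bump_pos)
  have m: "(bump :: real ^ 'n \<Rightarrow> real) \<in> borel_measurable borel"
    by (rule borel_measurable_continuous_onI[OF smooth_continuous[OF bump_class_smooth[OF bump_class_bump]]])
  have m': "(mollifier \<epsilon> :: real ^ 'n \<Rightarrow> real) \<in> borel_measurable borel"
    by (rule borel_measurable_continuous_onI[OF smooth_continuous[OF smooth_mollifier]])
  have d: "(lborel :: (real ^ 'n) measure) = density (distr lborel borel (\<lambda>x. 0 + \<epsilon> *\<^sub>R x)) (\<lambda>_. \<bar>\<epsilon>\<bar> ^ CARD('n))"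
    using lborel_affine[of \<epsilon> "0 :: real ^ 'n"] e by simp
  have eq: "\<epsilon> ^ CARD('n) * mollifier \<epsilon> (\<epsilon> *\<^sub>R x) = bump x / I" for x :: "real ^ 'n"
    using e I by (simp add: mollifier_def I_def[symmetric])
  have "has_bochner_integral lborel (\<lambda>x::real^'n. \<epsilon> ^ CARD('n) * mollifier \<epsilon> (\<epsilon> *\<^sub>R x)) (I / I)"
    unfolding eq using bump_class_integrable[OF bump_class_bump, where 'a='n]
    by (intro has_bochner_integral_divide_zero) (simp add: I_def has_bochner_integral_iff)
  then have *: "integrable lborel (\<lambda>x::real^'n. \<epsilon> ^ CARD('n) * mollifier \<epsilon> (\<epsilon> *\<^sub>R x))"
     "(\<integral>x. \<epsilon> ^ CARD('n) * mollifier \<epsilon> (\<epsilon> *\<^sub>R x :: real ^ 'n) \<partial>lborel) = 1"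
    using I by (auto simp: has_bochner_integral_iff)
  have "integrable lborel (mollifier \<epsilon> :: real ^ 'n \<Rightarrow> real)"
    using *(1) m' e by (subst d) (simp add: integrable_density integrable_distr_eq)
  moreover have "(\<integral>x. mollifier \<epsilon> (x :: real ^ 'n) \<partial>lborel) = 1"
    using *(2) m' e by (subst d) (simp add: integral_density integral_distr)
  ultimately show ?thesis by (simp add: has_bochner_integral_iff)
qed

lemma partial_partial_mollifier: "partial i (partial j (mollifier \<epsilon>)) = partial j (partial i (mollifier \<epsilon>))"
  using partials_mollifier[of "[i, j]" \<epsilon>] partials_mollifier[of "[j, i]" \<epsilon>] partial_partial_bump[of i j]
  by (simp add: partials_Cons)

section \<open>Oscillation of integrable functions\<close>

lemma integral_lborel_reflect:
  fixes f :: "'a::euclidean_space \<Rightarrow> 'b::{banach, second_countable_topology}"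
  assumes "f \<in> borel_measurable borel"
  shows "(\<integral>t. f (x - t) \<partial>lborel) = (\<integral>t. f t \<partial>lborel)"
proof -
  have "(lborel :: 'a measure) = distr lborel borel (\<lambda>t. x - t)"
    using lborel_affine[of "-1" x] by (simp add: density_1)
  then have "(\<integral>t. f t \<partial>lborel) = (\<integral>t. f t \<partial>distr lborel borel (\<lambda>t. x - t))" by simp
  also have "\<dots> = (\<integral>t. f (x - t) \<partial>lborel)" by (rule integral_distr) (use assms in auto)
  finally show ?thesis by simp
qed

lemma integrable_lborel_minus:
  fixes f :: "'a::euclidean_space \<Rightarrow> 'b::{banach, second_countable_topology}"
  assumes "integrable lborel f"
  shows "integrable lborel (\<lambda>x. f (x - t))"
  using integrable_lborel_translate[OF assms, of "- t"] by (simp add: add.commute)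

lemma integral_lborel_minus:
  fixes f :: "'a::euclidean_space \<Rightarrow> 'b::{banach, second_countable_topology}"
  assumes "integrable lborel f"
  shows "(\<integral>x. f (x - t) \<partial>lborel) = (\<integral>x. f x \<partial>lborel)"
  using integral_lborel_translate[of f "- t"] assms by (simp add: add.commute)

text \<open>Three errors of size \<open>e / 3\<close>: an open set from outside, a closed set from
  inside, and the truncation of the closed set to a large ball. The last one needs the finite
  measure.\<close>

lemma compact_open_approximation:
  fixes B :: "'a::euclidean_space set"
  assumes B: "B \<in> sets borel" "emeasure lborel B < \<infinity>" and e: "e > 0"
  obtains K U where "compact K" "open U" "K \<subseteq> B" "B \<subseteq> U" "emeasure lborel (U - K) < ennreal e"
proof -
  have Bl: "B \<in> sets lebesgue" using B(1) by (simp add: sets_completionI_sets)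
  have e3: "e / 3 > 0" using e by simp
  obtain U where U: "open U" "B \<subseteq> U" "emeasure lebesgue (U - B) < ennreal (e / 3)"
    by (rule sets_lebesgue_outer_open[OF Bl e3])
  obtain T where T: "closed T" "T \<subseteq> B" "emeasure lebesgue (B - T) < ennreal (e / 3)"
    by (rule sets_lebesgue_inner_closed[OF Bl e3])
  have "(\<lambda>n. emeasure lborel (T - cball 0 (real n))) \<longlonglongrightarrow> emeasure lborel (\<Inter>n. T - cball 0 (real n))"
  proof (rule Lim_emeasure_decseq)
    show "range (\<lambda>n. T - cball 0 (real n)) \<subseteq> sets lborel" using T by auto
    show "decseq (\<lambda>n. T - cball 0 (real n))" by (auto simp: decseq_def)
    fix i
    have "emeasure lborel (T - cball 0 (real i)) \<le> emeasure lborel B"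
      by (rule emeasure_mono) (use T B in auto)
    then show "emeasure lborel (T - cball 0 (real i)) \<noteq> \<infinity>" using B by auto
  qed
  moreover have "(\<Inter>n. T - cball 0 (real n)) = {}"
  proof -
    have "\<exists>n. x \<in> cball 0 (real n)" for x :: 'a
      using real_arch_simple[of "norm x"] by simp
    then show ?thesis by blast
  qed
  ultimately have "(\<lambda>n. emeasure lborel (T - cball 0 (real n))) \<longlonglongrightarrow> 0" by (simp only: emeasure_empty)
  then have "\<forall>\<^sub>F n in sequentially. emeasure lborel (T - cball 0 (real n)) < ennreal (e / 3)"
    using e by (intro order_tendstoD(2)[where y=0]) auto
  then obtain n where n: "emeasure lborel (T - cball 0 (real n)) < ennreal (e / 3)"
    by (auto simp: eventually_sequentially)
  define K where "K = T \<inter> cball 0 (real n)"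
  have K: "compact K" unfolding K_def using T(1) by (simp add: closed_Int_compact)
  have sub: "K \<subseteq> B" using T by (auto simp: K_def)
  have m: "U - B \<in> sets lborel" "B - T \<in> sets lborel" "T - cball 0 (real n) \<in> sets lborel"
    using U T B by auto
  have "emeasure lborel (U - K) \<le> emeasure lborel ((U - B) \<union> ((B - T) \<union> (T - cball 0 (real n))))"
    using m by (intro emeasure_mono) (auto simp: K_def)
  also have "\<dots> \<le> emeasure lborel (U - B) + emeasure lborel ((B - T) \<union> (T - cball 0 (real n)))"
    using m by (intro emeasure_subadditive) auto
  also have "\<dots> \<le> emeasure lborel (U - B) + (emeasure lborel (B - T) + emeasure lborel (T - cball 0 (real n)))"
    using m by (intro add_left_mono emeasure_subadditive) auto
  also have "\<dots> < ennreal (e / 3) + (ennreal (e / 3) + ennreal (e / 3))"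
    using U(3) T(3) n m by (intro add_strict_mono) auto
  also have "\<dots> = ennreal e" using e by (simp flip: ennreal_plus)
  finally show ?thesis using that K U sub by blast
qed

section \<open>Continuity of translations in L^1\<close>

definition L1_continuous :: "('a::euclidean_space \<Rightarrow> 'b::{banach, second_countable_topology}) \<Rightarrow> bool" where
  "L1_continuous f \<longleftrightarrow> (\<forall>e>0. \<exists>\<delta>>0. \<forall>t. norm t \<le> \<delta> \<longrightarrow> (\<integral>x. norm (f (x - t) - f x) \<partial>lborel) < e)"

text \<open>A translation by at most half the distance from \<open>K\<close> to the complement of
  \<open>U\<close> changes the indicator only on \<open>U - K\<close> and on its translate, and both
  have small measure.\<close>

lemma L1_continuous_indicator:
  fixes B :: "'a::euclidean_space set" and c :: "'b::{banach, second_countable_topology}"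
  assumes B: "B \<in> sets borel" "emeasure lborel B < \<infinity>"
  shows "L1_continuous (\<lambda>x. indicator B x *\<^sub>R c)"
  unfolding L1_continuous_def
proof (intro allI impI)
  fix e :: real assume e: "e > 0"
  \<comment> \<open>The summand 1 keeps the quotient meaningful when \<open>c\<close> is 0.\<close>
  define d where "d = e / (2 * norm c + 1) / 2"
  have d: "d > 0" using e by (simp add: d_def add_nonneg_pos)
  obtain K U where KU: "compact K" "open U" "K \<subseteq> B" "B \<subseteq> U" "emeasure lborel (U - K) < ennreal d"
    using compact_open_approximation[OF B d] .
  have fin: "emeasure lborel (U - K) < \<infinity>" using KU(5) by (rule order.strict_trans) simp
  have m: "measure lborel (U - K) < d"
    using KU(5) fin d by (simp add: measure_def enn2real_less_iff)
  have "closed (- U)" "K \<inter> - U = {}" using KU by auto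
  then obtain \<delta> where del: "\<delta> > 0" "\<And>x y. x \<in> K \<Longrightarrow> y \<in> - U \<Longrightarrow> \<delta> \<le> dist x y"
    using separate_compact_closed[OF KU(1), of "- U"] by blast
  have intUK: "integrable lborel (indicator (U - K) :: 'a \<Rightarrow> real)"
  proof (intro integrable_real_indicator)
    have "U - K \<in> sets borel" using KU(1,2) by (intro sets.Diff borel_open borel_closed compact_imp_closed)
    then show "U - K \<in> sets lborel" by simp
  qed (rule fin)
  have intB: "integrable lborel (\<lambda>x. indicator B x *\<^sub>R c)"
    using B by (intro integrable_scaleR_left integrable_real_indicator) auto
  show "\<exists>\<delta>>0. \<forall>t. norm t \<le> \<delta> \<longrightarrow> (\<integral>x. norm (indicator B (x - t) *\<^sub>R c - indicator B x *\<^sub>R c) \<partial>lborel) < e"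
  proof (intro exI[of _ "\<delta> / 2"] conjI allI impI)
    fix t :: 'a assume t: "norm t \<le> \<delta> / 2"
    have pt: "norm (indicator B (x - t) *\<^sub>R c - indicator B x *\<^sub>R c)
       \<le> (indicator (U - K) x + indicator (U - K) (x - t)) * norm c" for x
    proof -
      have "x \<in> U" if "x - t \<in> K"
      proof (rule ccontr)
        assume "x \<notin> U"
        then have "\<delta> \<le> dist (x - t) x" using del(2) that by blast
        then show False using t del(1) by (simp add: dist_norm)
      qed
      moreover have "x - t \<in> U" if "x \<in> K"
      proof (rule ccontr)
        assume "x - t \<notin> U"
        then have "\<delta> \<le> dist x (x - t)" using del(2) that by blast
        then show False using t del(1) by (simp add: dist_norm)
      qed
      ultimately show ?thesis using KU(3,4) by (auto simp: indicator_def)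
    qed
    have "(\<integral>x. norm (indicator B (x - t) *\<^sub>R c - indicator B x *\<^sub>R c) \<partial>lborel)
       \<le> (\<integral>x. (indicator (U - K) x + indicator (U - K) (x - t)) * norm c \<partial>lborel)"
    proof (rule integral_mono[OF _ _ pt])
      show "integrable lborel (\<lambda>x. norm (indicator B (x - t) *\<^sub>R c - indicator B x *\<^sub>R c))"
        by (intro integrable_norm Bochner_Integration.integrable_diff integrable_lborel_minus[OF intB] intB)
      show "integrable lborel (\<lambda>x. (indicator (U - K) x + indicator (U - K) (x - t)) * norm c)"
        by (intro integrable_mult_left Bochner_Integration.integrable_add integrable_lborel_minus[OF intUK] intUK)
    qed
    also have "\<dots> = 2 * measure lborel (U - K) * norm c"
      using intUK integrable_lborel_minus[OF intUK] integral_lborel_minus[OF intUK, of t] by simp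
    also have "\<dots> \<le> 2 * d * norm c" using m by (intro mult_right_mono) auto
    also have "\<dots> < 2 * d * (2 * norm c + 1)" using d by (intro mult_strict_left_mono) (auto simp: add_nonneg_pos)
    also have "\<dots> = e"
    proof -
      have "2 * norm c + 1 \<noteq> 0" using norm_ge_zero[of c] by linarith
      moreover have "2 * (e / m / 2) * m = e" if "m \<noteq> 0" for m :: real using that by simp
      ultimately show ?thesis unfolding d_def by blast
    qed
    finally show "(\<integral>x. norm (indicator B (x - t) *\<^sub>R c - indicator B x *\<^sub>R c) \<partial>lborel) < e" .
  qed (use del in auto)
qed

lemma L1_continuous_add:
  fixes f g :: "'a::euclidean_space \<Rightarrow> 'b::{banach, second_countable_topology}"
  assumes i: "integrable lborel f" "integrable lborel g" and c: "L1_continuous f" "L1_continuous g"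
  shows "L1_continuous (\<lambda>x. f x + g x)"
  unfolding L1_continuous_def
proof (intro allI impI)
  fix e :: real assume "e > 0"
  then have e: "e / 2 > 0" by simp
  obtain d1 where d1: "d1 > 0" "\<And>t. norm t \<le> d1 \<Longrightarrow> (\<integral>x. norm (f (x - t) - f x) \<partial>lborel) < e / 2"
    using c(1) e unfolding L1_continuous_def by blast
  obtain d2 where d2: "d2 > 0" "\<And>t. norm t \<le> d2 \<Longrightarrow> (\<integral>x. norm (g (x - t) - g x) \<partial>lborel) < e / 2"
    using c(2) e unfolding L1_continuous_def by blast
  show "\<exists>\<delta>>0. \<forall>t. norm t \<le> \<delta> \<longrightarrow> (\<integral>x. norm (f (x - t) + g (x - t) - (f x + g x)) \<partial>lborel) < e"
  proof (intro exI[of _ "min d1 d2"] conjI allI impI)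
    fix t :: 'a assume t: "norm t \<le> min d1 d2"
    note ii = integrable_lborel_minus[OF i(1), of t] integrable_lborel_minus[OF i(2), of t] i
    have "(\<integral>x. norm (f (x - t) + g (x - t) - (f x + g x)) \<partial>lborel)
       \<le> (\<integral>x. norm (f (x - t) - f x) + norm (g (x - t) - g x) \<partial>lborel)"
      using ii by (intro integral_mono) (auto simp: add_diff_add norm_triangle_ineq)
    also have "\<dots> = (\<integral>x. norm (f (x - t) - f x) \<partial>lborel) + (\<integral>x. norm (g (x - t) - g x) \<partial>lborel)"
      using ii by (intro Bochner_Integration.integral_add) auto
    also have "\<dots> < e" using d1(2)[of t] d2(2)[of t] t by simp
    finally show "(\<integral>x. norm (f (x - t) + g (x - t) - (f x + g x)) \<partial>lborel) < e" .
  qed (use d1 d2 in auto)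
qed

text \<open>Induction over indicators, sums and dominated limits. In the limit step translation
  invariance makes the two approximation errors equal, so one index \<open>i\<close> controls
  both.\<close>

theorem L1_continuous_integrable:
  fixes f :: "'a::euclidean_space \<Rightarrow> 'b::{banach, second_countable_topology}"
  assumes "integrable lborel f" shows "L1_continuous f"
  using assms
proof (induction rule: integrable_induct)
  case (base A c)
  then show ?case by (intro L1_continuous_indicator) auto
next
  case (add f g)
  then show ?case by (intro L1_continuous_add)
next
  case (lim f s)
  show ?case unfolding L1_continuous_def
  proof (intro allI impI)
    fix e :: real assume e: "e > 0"
    have "(\<lambda>i. \<integral>x. norm (s i x - f x) \<partial>lborel) \<longlonglongrightarrow> (\<integral>x. 0 \<partial>(lborel :: 'a measure))"
    proof (rule integral_dominated_convergence[where w="\<lambda>x. 3 * norm (f x)"])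
      show "AE x in lborel. (\<lambda>i. norm (s i x - f x)) \<longlonglongrightarrow> 0"
      proof (rule AE_I2)
        fix x :: 'a
        have "(\<lambda>i. s i x) \<longlonglongrightarrow> f x" using lim.hyps(2)[of x] by simp
        then show "(\<lambda>i. norm (s i x - f x)) \<longlonglongrightarrow> 0" by (intro tendsto_norm_zero LIM_zero)
      qed
      show "AE x in lborel. norm (norm (s i x - f x)) \<le> 3 * norm (f x)" for i
      proof (rule AE_I2)
        fix x :: 'a
        show "norm (norm (s i x - f x)) \<le> 3 * norm (f x)"
          using lim.hyps(3)[of x i] norm_triangle_ineq4[of "s i x" "f x"] by simp
      qed
    qed (use lim.hyps(1,4) in auto)
    then have "(\<lambda>i. \<integral>x. norm (s i x - f x) \<partial>lborel) \<longlonglongrightarrow> 0" by simp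
    then have "\<forall>\<^sub>F i in sequentially. (\<integral>x. norm (s i x - f x) \<partial>lborel) < e / 3"
      using e by (intro order_tendstoD(2)[where y=0]) auto
    then obtain i where i: "(\<integral>x. norm (s i x - f x) \<partial>lborel) < e / 3" by (auto simp: eventually_sequentially)
    obtain \<delta> where del: "\<delta> > 0" "\<And>t. norm t \<le> \<delta> \<Longrightarrow> (\<integral>x. norm (s i (x - t) - s i x) \<partial>lborel) < e / 3"
      using lim.IH[of i] e unfolding L1_continuous_def by (metis zero_less_divide_iff zero_less_numeral)
    show "\<exists>\<delta>>0. \<forall>t. norm t \<le> \<delta> \<longrightarrow> (\<integral>x. norm (f (x - t) - f x) \<partial>lborel) < e"
    proof (intro exI[of _ \<delta>] conjI allI impI)
      fix t :: 'a assume t: "norm t \<le> \<delta>"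
      define d where "d x = norm (s i x - f x)" for x
      have di: "integrable lborel d" unfolding d_def using lim.hyps(1,4) by auto
      note ii = integrable_lborel_minus[OF lim.hyps(1)[of i], of t] integrable_lborel_minus[OF lim.hyps(4), of t] lim.hyps(1)[of i] lim.hyps(4)
        integrable_lborel_minus[OF di, of t] di
      have "(\<integral>x. norm (f (x - t) - f x) \<partial>lborel) \<le> (\<integral>x. d (x - t) + norm (s i (x - t) - s i x) + d x \<partial>lborel)"
      proof (rule integral_mono)
        fix x
        have "f (x - t) - f x = - (s i (x - t) - f (x - t)) + (s i (x - t) - s i x) + (s i x - f x)" by simp
        also have "norm \<dots> \<le> norm (- (s i (x - t) - f (x - t))) + norm (s i (x - t) - s i x) + norm (s i x - f x)"
          by (intro norm_triangle_le add_right_mono norm_triangle_ineq)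
        finally show "norm (f (x - t) - f x) \<le> d (x - t) + norm (s i (x - t) - s i x) + d x"
          unfolding d_def norm_minus_cancel .
      qed (use ii in auto)
      also have "\<dots> = (\<integral>x. d x \<partial>lborel) + (\<integral>x. norm (s i (x - t) - s i x) \<partial>lborel) + (\<integral>x. d x \<partial>lborel)"
        using ii integral_lborel_minus[OF di, of t] by simp
      also have "\<dots> < e" using i del(2)[OF t] unfolding d_def by simp
      finally show "(\<integral>x. norm (f (x - t) - f x) \<partial>lborel) < e" .
    qed (use del in auto)
  qed
qed

text \<open>The mean distance of \<open>U\<close> from its value at \<open>x\<close> over a ball of
  radius \<epsilon>, normalised by the power of \<epsilon> instead of the volume. It measures all
  errors of the mollification.\<close>

definition oscillation :: "real \<Rightarrow> ('a::euclidean_space \<Rightarrow> 'b::euclidean_space) \<Rightarrow> 'a \<Rightarrow> real" where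
  "oscillation \<epsilon> U x = (\<integral>t. indicator (cball 0 \<epsilon>) t * norm (U (x - t) - U x) \<partial>lborel) / \<epsilon> ^ DIM('a)"

lemma integral_indicator_cball:
  "\<epsilon> > 0 \<Longrightarrow> (\<integral>t. indicator (cball (0::'a::euclidean_space) \<epsilon>) t * c \<partial>lborel) = unit_ball_vol DIM('a) * \<epsilon> ^ DIM('a) * c"
  by (simp add: content_cball)

lemma integrable_indicator_cball:
  "integrable lborel (\<lambda>t. indicator (cball (0::'a::euclidean_space) \<epsilon>) t * c :: real)"
  by (intro integrable_mult_left integrable_real_indicator)
     (use emeasure_lborel_cball_finite in \<open>auto simp: less_top[symmetric]\<close>)

locale bounded_compact_support =
  fixes U :: "'a::euclidean_space \<Rightarrow> 'b::euclidean_space" and C :: real and a :: 'a and r :: real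
  assumes meas [measurable]: "U \<in> borel_measurable borel" and bound: "\<And>x. norm (U x) \<le> C"
    and supp: "\<And>x. x \<notin> cball a r \<Longrightarrow> U x = 0"
begin

lemma integrable: "integrable lborel U"
  by (rule integrable_lborel_bounded_support[OF meas bound supp])

lemma norm_diff_le: "norm (U x - U z) \<le> 2 * C"
  using norm_triangle_ineq4[of "U x" "U z"] bound[of x] bound[of z] by linarith

lemma integrable_kernel:
  fixes k :: "'a \<Rightarrow> 'c::euclidean_space" and prod :: "'c \<Rightarrow> 'b \<Rightarrow> 'd::euclidean_space"
  assumes "continuous_on UNIV k" "bounded_bilinear prod"
  shows "integrable lborel (\<lambda>z. prod (k (x - z)) (U z))"
proof -
  interpret bounded_bilinear prod by fact
  have "continuous_on (cball a r) (\<lambda>z. k (x - z))"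
    by (intro continuous_on_compose2[OF assms(1)] continuous_intros) auto
  then have "bounded ((\<lambda>z. k (x - z)) ` cball a r)"
    by (intro compact_imp_bounded compact_continuous_image) auto
  then obtain B where B: "\<And>z. z \<in> cball a r \<Longrightarrow> norm (k (x - z)) \<le> B"
    unfolding bounded_iff by force
  obtain K where K: "K \<ge> 0" "\<And>a b. norm (prod a b) \<le> norm a * norm b * K" using nonneg_bounded by blast
  have [measurable]: "(\<lambda>z. k (x - z)) \<in> borel_measurable borel"
    by (intro borel_measurable_continuous_onI continuous_on_compose2[OF assms(1)] continuous_intros) auto
  have "continuous_on UNIV (\<lambda>p. prod (fst p) (snd p))"
    by (intro continuous_on continuous_intros)
  then have m: "(\<lambda>z. prod (k (x - z)) (U z)) \<in> borel_measurable borel"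
    by (intro borel_measurable_continuous_Pair[where H=prod]) auto
  show ?thesis
  proof (rule integrable_lborel_bounded_support[OF m, where C="\<bar>B\<bar> * \<bar>C\<bar> * K" and a=a and r=r])
    fix z
    show "norm (prod (k (x - z)) (U z)) \<le> \<bar>B\<bar> * \<bar>C\<bar> * K"
    proof (cases "z \<in> cball a r")
      case True
      have "norm (k (x - z)) * norm (U z) * K \<le> \<bar>B\<bar> * \<bar>C\<bar> * K"
        using B[OF True] bound[of z] K(1) by (intro mult_right_mono mult_mono) auto
      then show ?thesis using K(2) order_trans by blast
    qed (use supp K(1) zero_right in simp)
  qed (use supp zero_right in simp)
qed

lemma integrable_osc: "integrable lborel (\<lambda>t. indicator (cball 0 \<epsilon>) t * norm (U (x - t) - U x))"
proof (rule integrable_lborel_bounded_support[where C="2 * C" and a=0 and r=\<epsilon>])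
  fix t
  show "norm (indicator (cball 0 \<epsilon>) t * norm (U (x - t) - U x)) \<le> 2 * C"
    using norm_diff_le[of "x - t" x] bound[of x] order_trans[OF norm_ge_zero bound[of x]]
    by (auto simp: indicator_def)
qed (auto simp: indicator_def)

lemma oscillation_nonneg: "\<epsilon> > 0 \<Longrightarrow> oscillation \<epsilon> U x \<ge> 0"
  unfolding oscillation_def by (intro divide_nonneg_nonneg integral_nonneg_AE) auto

lemma oscillation_le:
  assumes "\<epsilon> > 0" shows "oscillation \<epsilon> U x \<le> 2 * C * unit_ball_vol DIM('a)"
proof -
  have "(\<integral>t. indicator (cball 0 \<epsilon>) t * norm (U (x - t) - U x) \<partial>lborel)
     \<le> (\<integral>t. indicator (cball (0::'a) \<epsilon>) t * (2 * C) \<partial>lborel)"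
    using norm_diff_le by (intro integral_mono integrable_osc integrable_indicator_cball mult_left_mono) auto
  also have "\<dots> = unit_ball_vol DIM('a) * \<epsilon> ^ DIM('a) * (2 * C)" by (rule integral_indicator_cball[OF assms])
  finally show ?thesis unfolding oscillation_def using assms by (simp add: divide_le_eq mult_ac)
qed

text \<open>As the kernel has mass 1, \<open>U x\<close> is the integral of
  \<open>k t *\<^sub>R U x\<close>, so only differences \<open>U (x - t) - U x\<close> remain, and
  the size bound on \<open>k\<close> turns them into the oscillation.\<close>

lemma kernel_oscillation:
  fixes k :: "'a \<Rightarrow> real"
  assumes e: "\<epsilon> > 0" and k: "continuous_on UNIV k" "\<And>t. \<bar>k t\<bar> \<le> M / \<epsilon> ^ DIM('a)"
    "\<And>t. norm t > \<epsilon> \<Longrightarrow> k t = 0" "has_bochner_integral lborel k 1"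
  shows "norm ((\<integral>z. k (x - z) *\<^sub>R U z \<partial>lborel) - U x) \<le> M * oscillation \<epsilon> U x"
proof -
  have km [measurable]: "k \<in> borel_measurable borel" using k(1) by (rule borel_measurable_continuous_onI)
  have i1: "integrable lborel (\<lambda>t. k t *\<^sub>R U (x - t))"
  proof -
    have "integrable lborel (\<lambda>t. k (x - t) *\<^sub>R U t)" by (rule integrable_kernel[OF k(1) bounded_bilinear_scaleR])
    then have "integrable lborel (\<lambda>t. k (x - (x - t)) *\<^sub>R U (x - t))"
    proof -
      have d: "(lborel :: 'a measure) = distr lborel borel (\<lambda>t. x - t)"
        using lborel_affine[of "-1" x] by (simp add: density_1)
      assume "integrable lborel (\<lambda>t. k (x - t) *\<^sub>R U t)"
      then have "integrable (distr lborel borel (\<lambda>t. x - t)) (\<lambda>t. k (x - t) *\<^sub>R U t)" using d by simp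
      then show ?thesis by (subst (asm) integrable_distr_eq) auto
    qed
    then show ?thesis by simp
  qed
  have i2: "integrable lborel (\<lambda>t. k t *\<^sub>R U x)" "(\<integral>t. k t *\<^sub>R U x \<partial>lborel) = U x"
    using k(4) by (auto simp: has_bochner_integral_iff)
  have "(\<integral>z. k (x - z) *\<^sub>R U z \<partial>lborel) = (\<integral>t. k (x - (x - t)) *\<^sub>R U (x - t) \<partial>lborel)"
    by (rule integral_lborel_reflect[symmetric]) measurable
  then have "(\<integral>z. k (x - z) *\<^sub>R U z \<partial>lborel) - U x = (\<integral>t. k t *\<^sub>R (U (x - t) - U x) \<partial>lborel)"
    using i1 i2 by (simp add: scaleR_diff_right)
  also have "norm \<dots> \<le> (\<integral>t. norm (k t *\<^sub>R (U (x - t) - U x)) \<partial>lborel)"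
    by (rule integral_norm_bound)
  also have "\<dots> \<le> (\<integral>t. (M / \<epsilon> ^ DIM('a)) * (indicator (cball 0 \<epsilon>) t * norm (U (x - t) - U x)) \<partial>lborel)"
  proof (rule integral_mono)
    show "integrable lborel (\<lambda>t. norm (k t *\<^sub>R (U (x - t) - U x)))"
      using i1 i2 by (intro integrable_norm) (simp add: scaleR_diff_right)
    show "integrable lborel (\<lambda>t. (M / \<epsilon> ^ DIM('a)) * (indicator (cball 0 \<epsilon>) t * norm (U (x - t) - U x)))"
      by (intro integrable_mult_right integrable_osc)
    fix t
    show "norm (k t *\<^sub>R (U (x - t) - U x)) \<le> (M / \<epsilon> ^ DIM('a)) * (indicator (cball 0 \<epsilon>) t * norm (U (x - t) - U x))"
      using k(2)[of t] k(3)[of t] by (cases "norm t > \<epsilon>") (use mult_right_mono[OF k(2)[of t], of "norm (U (x - t) - U x)"] in \<open>auto simp: indicator_def\<close>)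
  qed
  also have "\<dots> = M * oscillation \<epsilon> U x" by (simp add: oscillation_def)
  finally show ?thesis .
qed

text \<open>This makes the later absorption possible: an average over nearby points is exchanged for
  the value at the point itself, at the price of an oscillation.\<close>

lemma average_le_oscillation:
  assumes e: "\<epsilon> > 0"
  shows "(\<integral>z. indicator (cball 0 \<epsilon>) (x - z) * norm (U z) \<partial>lborel) / \<epsilon> ^ DIM('a)
     \<le> oscillation \<epsilon> U x + unit_ball_vol DIM('a) * norm (U x)"
    and "integrable lborel (\<lambda>z. indicator (cball 0 \<epsilon>) (x - z) * norm (U z))"
proof -
  have [measurable]: "cball (0 :: 'a) \<epsilon> \<in> sets borel" by simp
  have m: "(\<lambda>z. indicator (cball 0 \<epsilon>) (x - z) * norm (U z)) \<in> borel_measurable borel"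
    by measurable
  have C0: "C \<ge> 0" using bound[of a] norm_ge_zero[of "U a"] by linarith
  show "integrable lborel (\<lambda>z. indicator (cball 0 \<epsilon>) (x - z) * norm (U z))"
    by (rule integrable_lborel_bounded_support[OF m, where C=C and a=a and r=r])
       (use bound supp C0 in \<open>auto simp: indicator_def\<close>)
  have i: "integrable lborel (\<lambda>t. indicator (cball 0 \<epsilon>) t * norm (U (x - t)))"
    by (rule integrable_lborel_bounded_support[where C=C and a=0 and r=\<epsilon>])
       (use bound C0 in \<open>auto simp: indicator_def\<close>)
  have "(\<integral>z. indicator (cball 0 \<epsilon>) (x - z) * norm (U z) \<partial>lborel)
      = (\<integral>t. indicator (cball 0 \<epsilon>) (x - (x - t)) * norm (U (x - t)) \<partial>lborel)"
    by (rule integral_lborel_reflect[symmetric, OF m])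
  also have "\<dots> = (\<integral>t. indicator (cball 0 \<epsilon>) t * norm (U (x - t)) \<partial>lborel)" by simp
  also have "\<dots> \<le> (\<integral>t. indicator (cball 0 \<epsilon>) t * norm (U (x - t) - U x) + indicator (cball 0 \<epsilon>) t * norm (U x) \<partial>lborel)"
  proof (rule integral_mono[OF i])
    show "integrable lborel (\<lambda>t. indicator (cball 0 \<epsilon>) t * norm (U (x - t) - U x) + indicator (cball 0 \<epsilon>) t * norm (U x))"
      by (intro Bochner_Integration.integrable_add integrable_osc integrable_indicator_cball)
    fix t show "indicator (cball 0 \<epsilon>) t * norm (U (x - t)) \<le> indicator (cball 0 \<epsilon>) t * norm (U (x - t) - U x) + indicator (cball 0 \<epsilon>) t * norm (U x)"
      using norm_triangle_ineq[of "U (x - t) - U x" "U x"] by (auto simp: indicator_def)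
  qed
  also have "\<dots> = (\<integral>t. indicator (cball 0 \<epsilon>) t * norm (U (x - t) - U x) \<partial>lborel)
       + (\<integral>t. indicator (cball (0::'a) \<epsilon>) t * norm (U x) \<partial>lborel)"
    by (rule Bochner_Integration.integral_add[OF integrable_osc integrable_indicator_cball])
  also have "(\<integral>t. indicator (cball (0::'a) \<epsilon>) t * norm (U x) \<partial>lborel) = unit_ball_vol DIM('a) * \<epsilon> ^ DIM('a) * norm (U x)"
    by (rule integral_indicator_cball[OF e])
  finally have "(\<integral>z. indicator (cball 0 \<epsilon>) (x - z) * norm (U z) \<partial>lborel) / \<epsilon> ^ DIM('a)
     \<le> ((\<integral>t. indicator (cball 0 \<epsilon>) t * norm (U (x - t) - U x) \<partial>lborel)
       + unit_ball_vol DIM('a) * \<epsilon> ^ DIM('a) * norm (U x)) / \<epsilon> ^ DIM('a)"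
    using e by (intro divide_right_mono) auto
  also have "\<dots> = oscillation \<epsilon> U x + unit_ball_vol DIM('a) * norm (U x)"
    unfolding oscillation_def using e by (simp add: add_divide_distrib)
  finally show "(\<integral>z. indicator (cball 0 \<epsilon>) (x - z) * norm (U z) \<partial>lborel) / \<epsilon> ^ DIM('a)
     \<le> oscillation \<epsilon> U x + unit_ball_vol DIM('a) * norm (U x)" .
qed

text \<open>By Fubini the integral over \<open>x\<close> is taken first; for a fixed shift
  \<open>t\<close> it is small by the continuity of translations. The shifts fill a ball whose
  volume cancels the power of \<epsilon> in the normalisation.\<close>

lemma integral_oscillation_small:
  assumes d: "d > 0"
  obtains \<delta> where "\<delta> > 0"
    "\<And>\<epsilon>. 0 < \<epsilon> \<Longrightarrow> \<epsilon> \<le> \<delta> \<Longrightarrow> integrable lborel (oscillation \<epsilon> U) \<and> (\<integral>x. oscillation \<epsilon> U x \<partial>lborel) \<le> d"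
proof -
  define v where "v = unit_ball_vol (real DIM('a))"
  have v: "v > 0" by (simp add: v_def)
  have "d / v > 0" using d v by simp
  then obtain \<delta> where del: "\<delta> > 0" "\<And>t. norm t \<le> \<delta> \<Longrightarrow> (\<integral>x. norm (U (x - t) - U x) \<partial>lborel) < d / v"
    using L1_continuous_integrable[OF integrable] unfolding L1_continuous_def by blast
  show ?thesis
  proof (rule that[OF del(1)], intro conjI)
    fix \<epsilon> :: real assume e: "0 < \<epsilon>" "\<epsilon> \<le> \<delta>"
    define F where "F x t = indicator (cball 0 \<epsilon>) t * norm (U (x - t) - U x)" for x t
    have [measurable]: "cball (0 :: 'a) \<epsilon> \<in> sets borel" by simp
    have "integrable lborel (\<lambda>p. F (fst p) (snd p))"
    \<comment> \<open>If \<open>t\<close> has norm at most \<epsilon> and \<open>x\<close> is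
      farther than \<bar>r\<bar> + \<epsilon> from \<open>a\<close>, then \<open>x\<close> and
      \<open>x - t\<close> both miss the support. The second \<epsilon> in the radius accounts for
      the component \<open>t\<close> in the product norm.\<close>
    proof (rule integrable_lborel_bounded_support[where C="2 * C" and a="(a, 0)" and r="(\<bar>r\<bar> + \<epsilon>) + \<epsilon>"])
      have "(\<lambda>p. F (fst p) (snd p)) \<in> borel_measurable (borel \<Otimes>\<^sub>M borel)"
        unfolding F_def by measurable
      then show "(\<lambda>p. F (fst p) (snd p)) \<in> borel_measurable borel" by (simp add: borel_prod)
      fix p :: "'a \<times> 'a"
      show "norm (F (fst p) (snd p)) \<le> 2 * C"
        using norm_diff_le[of "fst p - snd p" "fst p"] order_trans[OF norm_ge_zero bound[of 0]] by (auto simp: F_def indicator_def)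
      assume p: "p \<notin> cball (a, 0) (\<bar>r\<bar> + \<epsilon> + \<epsilon>)"
      show "F (fst p) (snd p) = 0"
      proof (cases "snd p \<in> cball 0 \<epsilon>")
        case True
        obtain x t where xt: "p = (x, t)" by (cases p)
        have "norm (a - x, - t) \<le> norm (a - x) + norm t"
          using norm_Pair_le[of "a - x" "- t"] by simp
        then have "\<bar>r\<bar> + \<epsilon> + \<epsilon> < norm (a - x) + norm t" using p by (simp add: xt dist_norm)
        then have f: "norm (a - x) > \<bar>r\<bar> + \<epsilon>" "norm t \<le> \<epsilon>" using True by (auto simp: xt)
        have "norm (a - (x - t)) > \<bar>r\<bar>"
          using norm_triangle_ineq4[of "a - (x - t)" t] f by (simp add: algebra_simps)
        then have "x \<notin> cball a r" "x - t \<notin> cball a r" using f e by (auto simp: dist_norm)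
        then show ?thesis using supp by (simp add: F_def xt)
      qed (simp add: F_def)
    qed
    then have I: "integrable (lborel \<Otimes>\<^sub>M lborel) (\<lambda>(x, t). F x t)"
      unfolding lborel_prod case_prod_beta' .
    have i1: "integrable lborel (\<lambda>x. \<integral>t. F x t \<partial>lborel)" using lborel_pair.integrable_fst'[OF I] by simp
    then show "integrable lborel (oscillation \<epsilon> U)"
      unfolding oscillation_def[abs_def] F_def[symmetric] by (rule integrable_divide)
    have "(\<integral>x. (\<integral>t. F x t \<partial>lborel) \<partial>lborel) = (\<integral>t. (\<integral>x. F x t \<partial>lborel) \<partial>lborel)"
      using lborel_pair.Fubini_integral[OF I] by simp
    also have "\<dots> \<le> (\<integral>t. indicator (cball (0::'a) \<epsilon>) t * (d / v) \<partial>lborel)"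
    proof (rule integral_mono)
      show "integrable lborel (\<lambda>t. \<integral>x. F x t \<partial>lborel)" using lborel_pair.integrable_snd[OF I] .
      show "integrable lborel (\<lambda>t. indicator (cball (0::'a) \<epsilon>) t * (d / v))" by (rule integrable_indicator_cball)
      fix t
      show "(\<integral>x. F x t \<partial>lborel) \<le> indicator (cball (0::'a) \<epsilon>) t * (d / v)"
        using del(2)[of t] e by (auto simp: F_def indicator_def intro: less_imp_le)
    qed
    also have "\<dots> = v * \<epsilon> ^ DIM('a) * (d / v)" unfolding v_def by (rule integral_indicator_cball[OF e(1)])
    also have "\<dots> = \<epsilon> ^ DIM('a) * d" using v by simp
    finally show "(\<integral>x. oscillation \<epsilon> U x \<partial>lborel) \<le> d"
      unfolding oscillation_def F_def[symmetric] using e by (simp add: divide_le_eq mult_ac)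
  qed
qed

end

section \<open>Mollified weak solutions\<close>

text \<open>Bounds on derivatives of every order make the class closed under partial derivatives, so
  that the differentiation of convolutions can be iterated.\<close>

definition mollifying_kernel :: "(real ^ 'n \<Rightarrow> real) \<Rightarrow> bool" where
  "mollifying_kernel k \<longleftrightarrow> smooth k \<and> (\<forall>\<alpha>. \<exists>B. \<forall>x. \<bar>partials \<alpha> k x\<bar> \<le> B)"

lemma mollifying_kernel_partial: "mollifying_kernel k \<Longrightarrow> mollifying_kernel (partial i k)"
  unfolding mollifying_kernel_def using smooth_partial partials_snoc by metis

lemma mollifying_kernel_mollifier:
  assumes "\<epsilon> > 0" shows "mollifying_kernel (mollifier \<epsilon>)"
  unfolding mollifying_kernel_def
proof (intro conjI allI smooth_mollifier)
  fix \<alpha> :: "'a list"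
  obtain C where "\<And>x :: real ^ 'a. \<bar>partials \<alpha> (mollifier \<epsilon>) x\<bar> \<le> C / (\<epsilon> ^ CARD('a) * \<epsilon> ^ length \<alpha>)"
    using partials_mollifier_bound[of \<alpha>] assms by metis
  then show "\<exists>B. \<forall>x :: real ^ 'a. \<bar>partials \<alpha> (mollifier \<epsilon>) x\<bar> \<le> B" by blast
qed

abbreviation grad :: "(real ^ 'n \<Rightarrow> real) \<Rightarrow> real ^ 'n \<Rightarrow> real ^ 'n" where
  "grad k x \<equiv> (\<chi> i. partial i k x)"

lemma smooth_mvt:
  assumes "smooth k"
  obtains s where "0 < s" "s < 1" "k (t + h) - k t = grad k (t + s *\<^sub>R h) \<bullet> h"
proof -
  have "\<exists>s. s > 0 \<and> s < 1 \<and> k (t + 1 *\<^sub>R h) - k (t + 0 *\<^sub>R h) = (1 - 0) * (grad k (t + s *\<^sub>R h) \<bullet> h)"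
  proof (rule MVT2)
    fix s :: real
    have "((\<lambda>s. k (t + s *\<^sub>R h)) has_derivative (\<lambda>d. grad k (t + s *\<^sub>R h) \<bullet> (d *\<^sub>R h))) (at s)"
      by (rule has_derivative_compose[where f="\<lambda>s. t + s *\<^sub>R h" and g=k])
         (auto intro!: derivative_eq_intros has_derivative_partials smooth_differentiable[OF assms])
    then show "((\<lambda>s. k (t + s *\<^sub>R h)) has_real_derivative grad k (t + s *\<^sub>R h) \<bullet> h) (at s)"
      by (simp add: has_field_derivative_def mult.commute[of _ "grad k (t + s *\<^sub>R h) \<bullet> h"])
  qed simp
  then show ?thesis using that by auto
qed

lemma kernel_lipschitz:
  assumes "mollifying_kernel k"
  obtains B where "B \<ge> 0" "\<And>t h. \<bar>k (t + h) - k t\<bar> \<le> B * norm h"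
proof -
  have "\<exists>B. \<forall>x. \<bar>partial i k x\<bar> \<le> B" for i
    using assms unfolding mollifying_kernel_def by (metis partials_Cons partials_Nil)
  then obtain B where B: "\<And>i x. \<bar>partial i k x\<bar> \<le> B i" by metis
  have B0: "B i \<ge> 0" for i using B[of i 0] by linarith
  have s: "smooth k" using assms by (simp add: mollifying_kernel_def)
  show ?thesis
  proof (rule that[of "\<Sum>i\<in>UNIV. B i"])
    show "(\<Sum>i\<in>UNIV. B i) \<ge> 0" using B0 by (simp add: sum_nonneg)
    fix t h
    obtain r where r: "k (t + h) - k t = grad k (t + r *\<^sub>R h) \<bullet> h" using smooth_mvt[OF s] by metis
    have "\<bar>grad k (t + r *\<^sub>R h) \<bullet> h\<bar> \<le> norm (grad k (t + r *\<^sub>R h)) * norm h" by (rule Cauchy_Schwarz_ineq2)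
    also have "\<dots> \<le> (\<Sum>i\<in>UNIV. B i) * norm h"
      by (intro mult_right_mono order_trans[OF norm_le_l1_cart] sum_mono) (use B in auto)
    finally show "\<bar>k (t + h) - k t\<bar> \<le> (\<Sum>i\<in>UNIV. B i) * norm h" unfolding r .
  qed
qed

text \<open>The remainder is uniform in \<open>t\<close>. Integrated against an integrable function
  it yields the derivative of a convolution directly, with no limit under the integral sign.\<close>

lemma kernel_taylor:
  fixes k :: "real ^ 'n \<Rightarrow> real"
  assumes "mollifying_kernel k"
  obtains B where "B \<ge> 0" "\<And>t h. \<bar>k (t + h) - k t - grad k t \<bullet> h\<bar> \<le> B * (norm h)\<^sup>2"
proof -
  have "\<exists>B\<ge>0. \<forall>t h. \<bar>partial i k (t + h) - partial i k t\<bar> \<le> B * norm h" for i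
    using kernel_lipschitz[OF mollifying_kernel_partial[OF assms]] by metis
  then obtain B where B0: "\<And>i. B i \<ge> 0" and B: "\<And>i t h. \<bar>partial i k (t + h) - partial i k t\<bar> \<le> B i * norm h" by metis
  have s: "smooth k" using assms by (simp add: mollifying_kernel_def)
  show ?thesis
  proof (rule that[of "\<Sum>i\<in>UNIV. B i"])
    show "(\<Sum>i\<in>UNIV. B i) \<ge> 0" using B0 by (simp add: sum_nonneg)
    fix t h :: "real ^ 'n"
    obtain r where r: "0 < r" "r < 1" "k (t + h) - k t = grad k (t + r *\<^sub>R h) \<bullet> h" using smooth_mvt[OF s] by metis
    have "\<bar>partial i k (t + r *\<^sub>R h) - partial i k t\<bar> \<le> B i * norm h" for i
    proof -
      have "B i * norm (r *\<^sub>R h) \<le> B i * norm h" using r B0[of i] by (intro mult_left_mono) (auto simp: mult_left_le_one_le)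
      then show ?thesis using B[of i t "r *\<^sub>R h"] by linarith
    qed
    then have "norm (grad k (t + r *\<^sub>R h) - grad k t) \<le> (\<Sum>i\<in>UNIV. B i * norm h)"
      by (intro order_trans[OF norm_le_l1_cart] sum_mono) auto
    then have "norm (grad k (t + r *\<^sub>R h) - grad k t) * norm h \<le> (\<Sum>i\<in>UNIV. B i) * norm h * norm h"
      by (intro mult_right_mono) (auto simp: sum_distrib_right)
    moreover have "\<bar>(grad k (t + r *\<^sub>R h) - grad k t) \<bullet> h\<bar> \<le> norm (grad k (t + r *\<^sub>R h) - grad k t) * norm h"
      by (rule Cauchy_Schwarz_ineq2)
    ultimately show "\<bar>k (t + h) - k t - grad k t \<bullet> h\<bar> \<le> (\<Sum>i\<in>UNIV. B i) * (norm h)\<^sup>2"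
      unfolding r(3) by (simp add: inner_diff_left power2_eq_square mult.assoc)
  qed
qed

section \<open>Convolution with a kernel\<close>

definition conv :: "(real ^ 'n \<Rightarrow> real) \<Rightarrow> (real ^ 'n \<Rightarrow> 'b::euclidean_space) \<Rightarrow> real ^ 'n \<Rightarrow> 'b" where
  "conv k f x = (\<integral>z. k (x - z) *\<^sub>R f z \<partial>lborel)"

lemma kernel_continuous: "mollifying_kernel k \<Longrightarrow> continuous_on UNIV k"
  unfolding mollifying_kernel_def using smooth_continuous by blast

lemma conv_integrable:
  fixes f :: "real ^ 'n \<Rightarrow> 'b::euclidean_space"
  assumes "bounded_compact_support f C a r" "mollifying_kernel k"
  shows "integrable lborel (\<lambda>z. k (x - z) *\<^sub>R f z)"
  using bounded_compact_support.integrable_kernel[OF assms(1) kernel_continuous[OF assms(2)] bounded_bilinear_scaleR] .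

lemma conv_bounded:
  fixes f :: "real ^ 'n \<Rightarrow> 'b::euclidean_space"
  assumes f: "bounded_compact_support f C a r" and k: "mollifying_kernel k"
  obtains B where "\<And>x. norm (conv k f x) \<le> B"
proof -
  obtain D where D: "\<And>x. \<bar>k x\<bar> \<le> D" using k unfolding mollifying_kernel_def by (metis partials_Nil)
  have i: "integrable lborel f" using bounded_compact_support.integrable[OF f] .
  have "norm (conv k f x) \<le> D * (\<integral>z. norm (f z) \<partial>lborel)" for x
  proof -
    have "norm (conv k f x) \<le> (\<integral>z. norm (k (x - z) *\<^sub>R f z) \<partial>lborel)"
      unfolding conv_def by (rule integral_norm_bound)
    also have "\<dots> \<le> (\<integral>z. D * norm (f z) \<partial>lborel)"
      using i conv_integrable[OF f k] D by (intro integral_mono integrable_norm integrable_mult_right) (auto intro: mult_right_mono)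
    finally show ?thesis by simp
  qed
  then show ?thesis by (rule that)
qed

lemma has_derivative_conv:
  fixes f :: "real ^ 'n \<Rightarrow> real"
  assumes f: "bounded_compact_support f C a r" and k: "mollifying_kernel k"
  shows "(conv k f has_derivative (\<lambda>h. (\<chi> i. conv (partial i k) f x) \<bullet> h)) (at x)"
proof -
  obtain B where B: "B \<ge> 0" "\<And>t h. \<bar>k (t + h) - k t - grad k t \<bullet> h\<bar> \<le> B * (norm h)\<^sup>2"
    using kernel_taylor[OF k] by blast
  note ik = conv_integrable[OF f k] and ip = conv_integrable[OF f mollifying_kernel_partial[OF k]]
  have i: "integrable lborel f" using bounded_compact_support.integrable[OF f] .
  define D where "D = B * (\<integral>z. norm (f z) \<partial>lborel)"
  have D: "D \<ge> 0" unfolding D_def using B(1) by simp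
  have bnd: "\<bar>conv k f (x + h) - conv k f x - (\<chi> i. conv (partial i k) f x) \<bullet> h\<bar> \<le> D * (norm h)\<^sup>2" for h
  proof -
    have e: "(\<chi> i. conv (partial i k) f x) \<bullet> h = (\<integral>z. (grad k (x - z) \<bullet> h) * f z \<partial>lborel)"
      and ii: "integrable lborel (\<lambda>z. (grad k (x - z) \<bullet> h) * f z)"
    proof -
      have eq: "(\<lambda>z. (grad k (x - z) \<bullet> h) * f z) = (\<lambda>z. \<Sum>i\<in>UNIV. h $ i * (partial i k (x - z) *\<^sub>R f z))"
        by (auto simp: inner_vec_def sum_distrib_right sum_distrib_left mult_ac)
      have i': "integrable lborel (\<lambda>z. h $ i * (partial i k (x - z) *\<^sub>R f z))" for i
        by (rule integrable_mult_right[OF ip])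
      show "integrable lborel (\<lambda>z. (grad k (x - z) \<bullet> h) * f z)"
        unfolding eq by (rule Bochner_Integration.integrable_sum[OF i'])
      have "(\<chi> i. conv (partial i k) f x) \<bullet> h = (\<Sum>i\<in>UNIV. h $ i * conv (partial i k) f x)"
        by (simp add: inner_vec_def mult.commute)
      also have "\<dots> = (\<Sum>i\<in>UNIV. \<integral>z. h $ i * (partial i k (x - z) *\<^sub>R f z) \<partial>lborel)"
        unfolding conv_def by (intro sum.cong refl integral_mult_right_zero[symmetric])
      also have "\<dots> = (\<integral>z. (\<Sum>i\<in>UNIV. h $ i * (partial i k (x - z) *\<^sub>R f z)) \<partial>lborel)"
        by (rule Bochner_Integration.integral_sum[symmetric, OF i'])
      finally show "(\<chi> i. conv (partial i k) f x) \<bullet> h = (\<integral>z. (grad k (x - z) \<bullet> h) * f z \<partial>lborel)"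
        unfolding eq .
    qed
    note I1 = ik[of "x + h", unfolded real_scaleR_def] and I2 = ik[of x, unfolded real_scaleR_def]
    have d: "conv k f (x + h) - conv k f x - (\<chi> i. conv (partial i k) f x) \<bullet> h
       = (\<integral>z. (k (x + h - z) - k (x - z) - grad k (x - z) \<bullet> h) * f z \<partial>lborel)"
      unfolding e unfolding conv_def real_scaleR_def left_diff_distrib
        Bochner_Integration.integral_diff[OF Bochner_Integration.integrable_diff[OF I1 I2] ii]
        Bochner_Integration.integral_diff[OF I1 I2] ..
    have "\<bar>\<integral>z. (k (x + h - z) - k (x - z) - grad k (x - z) \<bullet> h) * f z \<partial>lborel\<bar>
        \<le> (\<integral>z. \<bar>(k (x + h - z) - k (x - z) - grad k (x - z) \<bullet> h) * f z\<bar> \<partial>lborel)"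
      by (rule integral_abs_bound)
    also have "\<dots> \<le> (\<integral>z. B * (norm h)\<^sup>2 * norm (f z) \<partial>lborel)"
    proof (rule integral_mono)
      show "integrable lborel (\<lambda>z. \<bar>(k (x + h - z) - k (x - z) - grad k (x - z) \<bullet> h) * f z\<bar>)"
        unfolding left_diff_distrib
        by (intro integrable_abs Bochner_Integration.integrable_diff I1 I2 ii)
      show "integrable lborel (\<lambda>z. B * (norm h)\<^sup>2 * norm (f z))" by (intro integrable_mult_right integrable_norm i)
      fix z
      show "\<bar>(k (x + h - z) - k (x - z) - grad k (x - z) \<bullet> h) * f z\<bar> \<le> B * (norm h)\<^sup>2 * norm (f z)"
      proof -
        have "x - z + h = x + h - z" by simp
        then have "\<bar>k (x + h - z) - k (x - z) - grad k (x - z) \<bullet> h\<bar> \<le> B * (norm h)\<^sup>2"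
          using B(2)[of "x - z" h] by (simp only:)
        then show ?thesis unfolding abs_mult real_norm_def by (rule mult_right_mono) simp
      qed
    qed
    also have "\<dots> = D * (norm h)\<^sup>2" by (simp add: D_def)
    finally show ?thesis unfolding d .
  qed
  show ?thesis
    unfolding has_derivative_at
  proof (intro conjI)
    show "bounded_linear (\<lambda>h. (\<chi> i. conv (partial i k) f x) \<bullet> h)" by (rule bounded_linear_inner_right)
    show "(\<lambda>h. norm (conv k f (x + h) - conv k f x - (\<chi> i. conv (partial i k) f x) \<bullet> h) / norm h) \<midarrow>0\<rightarrow> 0"
    proof (rule Lim_null_comparison)
      show "\<forall>\<^sub>F h in at 0. norm (norm (conv k f (x + h) - conv k f x - (\<chi> i. conv (partial i k) f x) \<bullet> h) / norm h) \<le> D * norm h"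
      proof (intro always_eventually allI)
        fix h :: "real ^ 'n"
        show "norm (norm (conv k f (x + h) - conv k f x - (\<chi> i. conv (partial i k) f x) \<bullet> h) / norm h) \<le> D * norm h"
          using bnd[of h] D by (cases "h = 0") (auto simp: divide_le_eq power2_eq_square mult.assoc)
      qed
      show "((\<lambda>h. D * norm h) \<longlongrightarrow> 0) (at (0 :: real ^ 'n))" by (auto intro!: tendsto_eq_intros)
    qed
  qed
qed

lemma bdiff_on_conv:
  fixes f :: "real ^ 'n \<Rightarrow> real"
  assumes f: "bounded_compact_support f C a r" and k: "mollifying_kernel k"
  shows "bdiff_on S (conv k f) (\<lambda>x h. (\<chi> i. conv (partial i k) f x) \<bullet> h)"
proof -
  obtain B where B: "\<And>x. norm (conv k f x) \<le> B" using conv_bounded[OF f k] by blast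
  have "\<exists>B. \<forall>x. norm (conv (partial i k) f x) \<le> B" for i
    using conv_bounded[OF f mollifying_kernel_partial[OF k]] by metis
  then obtain D where D: "\<And>i x. norm (conv (partial i k) f x) \<le> D i" by metis
  show ?thesis
  proof (rule bdiff_onI[where B=B and C="\<Sum>i\<in>UNIV. D i"])
    fix x h
    show "(conv k f has_derivative (\<lambda>h. (\<chi> i. conv (partial i k) f x) \<bullet> h)) (at x)"
      by (rule has_derivative_conv[OF f k])
    show "norm (conv k f x) \<le> B" by (rule B)
    have "\<bar>(\<chi> i. conv (partial i k) f x) \<bullet> h\<bar> \<le> norm (\<chi> i. conv (partial i k) f x) * norm h"
      by (rule Cauchy_Schwarz_ineq2)
    also have "\<dots> \<le> (\<Sum>i\<in>UNIV. D i) * norm h"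
      by (intro mult_right_mono order_trans[OF norm_le_l1_cart] sum_mono) (use D in auto)
    finally show "norm ((\<chi> i. conv (partial i k) f x) \<bullet> h) \<le> (\<Sum>i\<in>UNIV. D i) * norm h" by simp
  qed
qed

text \<open>Serves for gradients and, applied twice, for matrix fields given by their
  entries.\<close>

lemma bdiff_on_vec:
  fixes f :: "'a::real_normed_vector \<Rightarrow> 'b::euclidean_space ^ 'n"
  assumes "\<And>i. bdiff_on S (\<lambda>x. f x $ i) (\<lambda>x h. f' x h $ i)"
  shows "bdiff_on S f f'"
proof -
  have "\<forall>i. \<exists>C. \<forall>x\<in>S. ((\<lambda>x. f x $ i) has_derivative (\<lambda>h. f' x h $ i)) (at x) \<and> norm (f x $ i) \<le> C \<and>
     (\<forall>h. norm (f' x h $ i) \<le> C * norm h)"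
  proof
    fix i show "\<exists>C. \<forall>x\<in>S. ((\<lambda>x. f x $ i) has_derivative (\<lambda>h. f' x h $ i)) (at x) \<and> norm (f x $ i) \<le> C \<and>
     (\<forall>h. norm (f' x h $ i) \<le> C * norm h)"
      using assms[of i] unfolding bdiff_on_def by (elim exE conjE) (rule exI)
  qed
  from choice[OF this] obtain C where "\<forall>i. \<forall>x\<in>S. ((\<lambda>x. f x $ i) has_derivative (\<lambda>h. f' x h $ i)) (at x) \<and> norm (f x $ i) \<le> C i \<and>
     (\<forall>h. norm (f' x h $ i) \<le> C i * norm h)" ..
  then have C: "((\<lambda>x. f x $ i) has_derivative (\<lambda>h. f' x h $ i)) (at x)" "norm (f x $ i) \<le> C i"
     "norm (f' x h $ i) \<le> C i * norm h" if "x \<in> S" for i x h using that by auto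
  have norm_le: "norm v \<le> (\<Sum>i\<in>UNIV. norm (v $ i))" for v :: "'b ^ 'n"
    unfolding norm_vec_def by (rule L2_set_le_sum) simp
  show ?thesis
  proof (rule bdiff_onI[where B="\<Sum>i\<in>UNIV. C i" and C="\<Sum>i\<in>UNIV. C i"])
    fix x h assume x: "x \<in> S"
    show "(f has_derivative f' x) (at x)"
      by (subst has_derivative_componentwise_within) (use C(1)[OF x] in \<open>auto simp: Basis_vec_def inner_axis intro: has_derivative_inner_left\<close>)
    show "norm (f x) \<le> (\<Sum>i\<in>UNIV. C i)"
      by (intro order_trans[OF norm_le] sum_mono) (use C(2)[OF x] in auto)
    show "norm (f' x h) \<le> (\<Sum>i\<in>UNIV. C i) * norm h"
      unfolding sum_distrib_right
      by (intro order_trans[OF norm_le] sum_mono) (use C(3)[OF x] in auto)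
  qed
qed

lemma sum_Basis_vec:
  fixes f :: "real ^ 'n \<Rightarrow> 'b::comm_monoid_add"
  shows "(\<Sum>b\<in>Basis. f b) = (\<Sum>i\<in>UNIV. f (axis i (1::real)))"
proof -
  have B: "(Basis :: (real ^ 'n) set) = (\<lambda>i. axis i 1) ` UNIV" by (auto simp: Basis_vec_def)
  show ?thesis unfolding B by (subst sum.reindex) (auto simp: inj_on_def axis_eq_axis)
qed

text \<open>\<open>A\<close> is controlled on \<open>S\<close> alone, and \<open>G\<close> hides its
  values elsewhere, so \<open>A\<close> may be replaced by its product with the indicator of
  \<open>S\<close>.\<close>

lemma borel_measurable_matrix_field:
  fixes A :: "real ^ 'n \<Rightarrow> real ^ 'n ^ 'm"
  assumes "continuous_on S A" "S \<in> sets borel" "G \<in> borel_measurable borel" "\<And>x. x \<notin> S \<Longrightarrow> G x = 0"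
  shows "(\<lambda>x. A x *v G x) \<in> borel_measurable borel"
proof -
  have m: "(\<lambda>x. indicator S x *\<^sub>R A x) \<in> borel_measurable borel"
    by (rule borel_measurable_continuous_on_indicator[OF assms(2,1)])
  have "continuous_on UNIV (\<lambda>p. fst p *v snd p :: real ^ 'm)"
    by (intro bounded_bilinear.continuous_on[OF bounded_bilinear_matrix_vector_mult] continuous_intros)
  then have "(\<lambda>x. (indicator S x *\<^sub>R A x) *v G x) \<in> borel_measurable borel"
    by (intro borel_measurable_continuous_Pair[OF m assms(3)])
  moreover have "(\<lambda>x. (indicator S x *\<^sub>R A x) *v G x) = (\<lambda>x. A x *v G x)"
    using assms(4) by (auto simp: indicator_def)
  ultimately show ?thesis by simp
qed

text \<open>The data on one ball in clean form: Borel functions, bounds at every point, zero outside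
  the ball. Test functions vanish outside a smaller concentric ball, so the mollified identities are
  available at points whose distance from the boundary exceeds \<epsilon>.\<close>

locale weak_solution_ball = elliptic_ball A A' y R \<kappa>
  for A :: "real ^ 'n \<Rightarrow> real ^ 'n ^ 'n" and A' y R \<kappa> +
  fixes u F :: "real ^ 'n \<Rightarrow> real" and G :: "real ^ 'n \<Rightarrow> real ^ 'n" and C L :: real
  assumes u_meas [measurable]: "u \<in> borel_measurable borel"
    and G_meas [measurable]: "G \<in> borel_measurable borel"
    and F_meas [measurable]: "F \<in> borel_measurable borel"
    and U_bound: "\<And>x. norm (u x, G x) \<le> C"
    and zero: "\<And>x. x \<notin> ball y R \<Longrightarrow> u x = 0 \<and> G x = 0"
    and L0: "0 \<le> L" and F_le: "\<And>x. \<bar>F x\<bar> \<le> L * norm (u x, G x)"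
    and weak_grad: "\<And>\<phi> i R'. smooth \<phi> \<Longrightarrow> R' < R \<Longrightarrow> (\<And>x. x \<notin> cball y R' \<Longrightarrow> \<phi> x = 0) \<Longrightarrow>
      (\<integral>x. u x * partial i \<phi> x \<partial>lborel) = - (\<integral>x. G x $ i * \<phi> x \<partial>lborel)"
    and weak_eq: "\<And>\<phi> R'. smooth \<phi> \<Longrightarrow> R' < R \<Longrightarrow> (\<And>x. x \<notin> cball y R' \<Longrightarrow> \<phi> x = 0) \<Longrightarrow>
      (\<integral>x. (A x *v G x) \<bullet> grad \<phi> x \<partial>lborel) = (\<integral>x. F x * \<phi> x \<partial>lborel)"
begin

definition "U x = (u x, G x)"

lemma C0: "C \<ge> 0" using U_bound[of y] norm_ge_zero[of "(u y, G y)"] by linarith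

lemma zero': "x \<notin> cball y R \<Longrightarrow> u x = 0 \<and> G x = 0"
  using zero by (meson ball_subset_cball subsetD)

lemma U_bcs: "bounded_compact_support U C y R"
  by unfold_locales (use U_bound zero' in \<open>auto simp: U_def[abs_def] zero_prod_def\<close>)

lemma u_bcs: "bounded_compact_support u C y R"
proof
  show "norm (u x) \<le> C" for x using U_bound[of x] norm_fst_le[of "u x" "G x"] by simp
qed (use zero' in auto)

lemma G_bcs: "bounded_compact_support G C y R"
proof
  show "norm (G x) \<le> C" for x using U_bound[of x] norm_snd_le[of "G x" "u x"] by simp
qed (use zero' in auto)

lemma F_bcs: "bounded_compact_support F (L * C) y R"
proof
  show "norm (F x) \<le> L * C" for x
    using F_le[of x] mult_left_mono[OF U_bound[of x] L0] by simp
  show "F x = 0" if "x \<notin> cball y R" for x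
    using F_le[of x] zero'[OF that] by (simp add: zero_prod_def[symmetric])
qed auto

lemma AG_bcs: "\<exists>C'. bounded_compact_support (\<lambda>x. A x *v G x) C' y R"
proof -
  obtain Ca where Ca: "Ca \<ge> 0" "\<And>x. x \<in> ball y R \<Longrightarrow> (A has_derivative A' x) (at x) \<and> norm (A x) \<le> Ca"
    using A unfolding bdiff_on_def by metis
  obtain k where k: "k \<ge> 0" "\<And>(B::real^'n^'n) h. norm (B *v h) \<le> norm B * norm h * k"
    using bounded_bilinear.nonneg_bounded[OF bounded_bilinear_matrix_vector_mult] by blast
  have "continuous_on (ball y R) A"
    using Ca(2) by (meson continuous_at_imp_continuous_on has_derivative_continuous)
  then have m': "(\<lambda>x. A x *v G x) \<in> borel_measurable borel"
    using zero by (intro borel_measurable_matrix_field[where S="ball y R"]) auto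
  have "norm (A x *v G x) \<le> Ca * C * k" for x
  proof (cases "x \<in> ball y R")
    case True
    have "norm (A x) * norm (G x) * k \<le> Ca * C * k"
      using Ca True bounded_compact_support.bound[OF G_bcs, of x] k by (intro mult_right_mono mult_mono) auto
    then show ?thesis using k(2) order_trans by blast
  qed (use zero Ca C0 k in auto)
  then show ?thesis using m' zero' by (intro exI[of _ "Ca * C * k"], unfold_locales) auto
qed

text \<open>The derivatives are defined by differentiating the kernel and hence exist everywhere.
  They agree with mollifications of \<open>G\<close> only away from the boundary, since the
  extension of \<open>u\<close> by zero may jump there.\<close>

definition "ue \<epsilon> = conv (mollifier \<epsilon>) u"
definition "gu \<epsilon> x = (\<chi> i. conv (partial i (mollifier \<epsilon>)) u x)"
definition "Hu \<epsilon> x h = (\<chi> i. (\<chi> j. conv (partial j (partial i (mollifier \<epsilon>))) u x) \<bullet> h)"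

lemma bdiff_ue: "\<epsilon> > 0 \<Longrightarrow> bdiff_on S (ue \<epsilon>) (\<lambda>x h. gu \<epsilon> x \<bullet> h)"
  unfolding ue_def gu_def[abs_def] by (rule bdiff_on_conv[OF u_bcs mollifying_kernel_mollifier])

lemma bdiff_gu:
  assumes "\<epsilon> > 0" shows "bdiff_on S (gu \<epsilon>) (Hu \<epsilon>)"
proof (rule bdiff_on_vec)
  fix i
  show "bdiff_on S (\<lambda>x. gu \<epsilon> x $ i) (\<lambda>x h. Hu \<epsilon> x h $ i)"
    unfolding gu_def Hu_def vec_lambda_beta
    by (rule bdiff_on_conv[OF u_bcs mollifying_kernel_partial[OF mollifying_kernel_mollifier[OF assms]]])
qed

lemma Hu_sym: "Hu \<epsilon> x h \<bullet> k = h \<bullet> Hu \<epsilon> x k"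
proof -
  have "Hu \<epsilon> x h \<bullet> k = (\<Sum>i\<in>UNIV. \<Sum>j\<in>UNIV. conv (partial j (partial i (mollifier \<epsilon>))) u x * h $ j * k $ i)"
    by (simp add: Hu_def inner_vec_def sum_distrib_right)
  also have "\<dots> = (\<Sum>j\<in>UNIV. \<Sum>i\<in>UNIV. conv (partial j (partial i (mollifier \<epsilon>))) u x * h $ j * k $ i)"
    by (rule sum.swap)
  also have "\<dots> = (\<Sum>j\<in>UNIV. \<Sum>i\<in>UNIV. conv (partial i (partial j (mollifier \<epsilon>))) u x * h $ j * k $ i)"
    by (simp only: partial_partial_mollifier)
  also have "\<dots> = h \<bullet> Hu \<epsilon> x k"
    by (simp add: Hu_def inner_vec_def sum_distrib_left mult_ac)
  finally show ?thesis .
qed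

text \<open>As long as the \<epsilon>-ball around \<open>x\<close> stays inside the ball, the
  reflected kernel centred at \<open>x\<close> is an admissible test function; mollifying at
  \<open>x\<close> then amounts to testing with it.\<close>

lemma partials_mollifier_reflect:
  fixes x :: "real ^ 'n" and \<alpha> :: "'n list"
  assumes e: "\<epsilon> > 0" and x: "norm (x - y) < R - \<epsilon>"
  defines "\<phi> \<equiv> \<lambda>z. partials \<alpha> (mollifier \<epsilon>) (x - z)"
  shows "smooth \<phi>" "\<And>i z. partial i \<phi> z = - partial i (partials \<alpha> (mollifier \<epsilon>)) (x - z)"
    "\<And>z. z \<notin> cball y (norm (x - y) + \<epsilon>) \<Longrightarrow> \<phi> z = 0"
proof -
  have s: "smooth (partials \<alpha> (mollifier \<epsilon>) :: real ^ 'n \<Rightarrow> real)"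
    by (induction \<alpha>) (auto simp: partials_Cons smooth_mollifier smooth_partial)
  have p: "\<phi> = (\<lambda>z. 1 * partials \<alpha> (mollifier \<epsilon>) ((- 1) *\<^sub>R z + x))" by (auto simp: \<phi>_def)
  show "smooth \<phi>" unfolding p by (rule smooth_affine[OF s])
  show "partial i \<phi> z = - partial i (partials \<alpha> (mollifier \<epsilon>)) (x - z)" for i z
    using partials_affine[OF s, of "[i]" 1 "-1" x] unfolding p[symmetric] by (simp add: partials_Cons)
  show "\<phi> z = 0" if "z \<notin> cball y (norm (x - y) + \<epsilon>)" for z
  proof -
    have "norm (z - y) > norm (x - y) + \<epsilon>" using that by (simp add: dist_norm norm_minus_commute)
    then have "norm (x - z) \<ge> \<epsilon>" using norm_triangle_ineq[of "x - y" "z - x"] norm_minus_commute[of x z] by simp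
    then show ?thesis unfolding \<phi>_def by (rule partials_mollifier_eq_0[OF e])
  qed
qed

text \<open>Two signs cancel, one from the reflection of the kernel and one from the weak
  derivative.\<close>

lemma conv_partial:
  assumes e: "\<epsilon> > 0" and x: "norm (x - y) < R - \<epsilon>"
  shows "conv (partial i (partials \<alpha> (mollifier \<epsilon>))) u x = conv (partials \<alpha> (mollifier \<epsilon>)) (\<lambda>z. G z $ i) x"
proof -
  note r = partials_mollifier_reflect[OF e x, where \<alpha>=\<alpha>]
  have R': "norm (x - y) + \<epsilon> < R" using x by simp
  have "(\<integral>z. u z * partial i (\<lambda>z. partials \<alpha> (mollifier \<epsilon>) (x - z)) z \<partial>lborel)
     = - (\<integral>z. G z $ i * partials \<alpha> (mollifier \<epsilon>) (x - z) \<partial>lborel)"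
    by (rule weak_grad[OF r(1) R' r(3)])
  then show ?thesis unfolding r(2) conv_def by (simp add: mult.commute)
qed

lemma conv_zero:
  assumes e: "\<epsilon> > 0" and r: "AE z in lborel. z \<in> ball y r \<longrightarrow> u z = 0" and x: "x \<in> ball y (r - \<epsilon>)"
  shows "conv (partials \<alpha> (mollifier \<epsilon>)) u x = 0"
proof -
  have "AE z in lborel. partials \<alpha> (mollifier \<epsilon>) (x - z) *\<^sub>R u z = 0"
    using r
  proof eventually_elim
    fix z assume z: "z \<in> ball y r \<longrightarrow> u z = 0"
    show "partials \<alpha> (mollifier \<epsilon>) (x - z) *\<^sub>R u z = 0"
    proof (cases "norm (x - z) \<ge> \<epsilon>")
      case False
      then have "z \<in> ball y r" using x norm_triangle_ineq[of "y - x" "x - z"] by (simp add: dist_norm)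
      then show ?thesis using z by simp
    qed (simp add: partials_mollifier_eq_0[OF e])
  qed
  then show ?thesis unfolding conv_def by (rule integral_eq_zero_AE)
qed

lemma ue_gu_zero:
  assumes "\<epsilon> > 0" "AE z in lborel. z \<in> ball y r \<longrightarrow> u z = 0" "x \<in> ball y (r - \<epsilon>)"
  shows "ue \<epsilon> x = 0" "gu \<epsilon> x = 0"
  using conv_zero[OF assms, of "[]"] conv_zero[OF assms, of "[_]"]
  by (simp_all add: ue_def gu_def partials_Cons vec_eq_iff)

lemma gu_eq:
  assumes e: "\<epsilon> > 0" and x: "norm (x - y) < R - \<epsilon>"
  shows "gu \<epsilon> x = conv (mollifier \<epsilon>) G x"
proof -
  have "gu \<epsilon> x $ i = conv (mollifier \<epsilon>) G x $ i" for i
    using conv_partial[OF e x, of i "[]"] integral_bounded_linear[OF bounded_linear_vec_nth conv_integrable[OF G_bcs mollifying_kernel_mollifier[OF e]], of x i]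
    by (simp add: gu_def conv_def)
  then show ?thesis by (simp add: vec_eq_iff)
qed

lemma Hu_axis:
  assumes e: "\<epsilon> > 0" and x: "norm (x - y) < R - \<epsilon>"
  shows "Hu \<epsilon> x (axis i 1) = conv (partial i (mollifier \<epsilon>)) G x"
proof -
  have mk: "mollifying_kernel (partial i (mollifier \<epsilon>) :: real ^ 'n \<Rightarrow> real)"
    by (rule mollifying_kernel_partial[OF mollifying_kernel_mollifier[OF e]])
  have "Hu \<epsilon> x (axis i 1) $ l = conv (partial i (mollifier \<epsilon>)) G x $ l" for l
  proof -
    have "Hu \<epsilon> x (axis i 1) $ l = conv (partial i (partial l (mollifier \<epsilon>))) u x"
      by (simp add: Hu_def inner_axis)
    also have "\<dots> = conv (partial l (partials [i] (mollifier \<epsilon>))) u x"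
      by (simp only: partials_Cons partials_Nil partial_partial_mollifier)
    also have "\<dots> = conv (partials [i] (mollifier \<epsilon>)) (\<lambda>z. G z $ l) x" by (rule conv_partial[OF e x])
    also have "\<dots> = conv (partial i (mollifier \<epsilon>)) G x $ l"
      using integral_bounded_linear[OF bounded_linear_vec_nth conv_integrable[OF G_bcs mk], of x l]
      by (simp add: conv_def partials_Cons)
    finally show ?thesis .
  qed
  then show ?thesis by (simp add: vec_eq_iff)
qed

lemma integrable_grad_inner:
  assumes e: "\<epsilon> > 0" and f: "bounded_compact_support f B y R"
  shows "integrable lborel (\<lambda>z. grad (mollifier \<epsilon>) (x - z) \<bullet> f z)"
proof -
  have "continuous_on UNIV (\<lambda>z. grad (mollifier \<epsilon>) z)"
    by (intro continuous_on_vec_lambda kernel_continuous mollifying_kernel_partial mollifying_kernel_mollifier e)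
  then show ?thesis by (rule bounded_compact_support.integrable_kernel[OF f _ bounded_bilinear_inner])
qed

text \<open>Friedrichs' commutator: the second derivatives of the mollification are paired with \<open>A x - A z\<close>,
  which is small of order \<open>\<epsilon>\<close> on the support of the kernel, so that the error is bounded by an average
  of \<open>\<bar>G\<bar>\<close> uniformly in \<open>\<epsilon>\<close>.\<close>

lemma trace_Hu:
  assumes e: "\<epsilon> > 0" and x: "norm (x - y) < R - \<epsilon>"
  shows "lin_trace (\<lambda>h. A x *v Hu \<epsilon> x h)
     = (\<integral>z. grad (mollifier \<epsilon>) (x - z) \<bullet> ((A x - A z) *v G z) \<partial>lborel) - (\<integral>z. F z * mollifier \<epsilon> (x - z) \<partial>lborel)"
    and "integrable lborel (\<lambda>z. grad (mollifier \<epsilon>) (x - z) \<bullet> ((A x - A z) *v G z))"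
proof -
  have k: "mollifying_kernel (partial i (mollifier \<epsilon>) :: real ^ 'n \<Rightarrow> real)" for i
    by (rule mollifying_kernel_partial[OF mollifying_kernel_mollifier[OF e]])
  have bl: "bounded_linear (\<lambda>v. (A x *v v) \<bullet> axis i 1)" for i
    by (intro bounded_linear_compose[OF bounded_linear_inner_left] matrix_vector_mul_bounded_linear)
  have Ax: "bounded_compact_support (\<lambda>z. A x *v G z) (onorm ((*v) (A x)) * C) y R"
  proof
    show "(\<lambda>z. A x *v G z) \<in> borel_measurable borel"
      by (intro borel_measurable_continuous_on[OF _ G_meas] linear_continuous_on matrix_vector_mul_bounded_linear)
    fix z
    have "norm (A x *v G z) \<le> onorm ((*v) (A x)) * norm (G z)" by (rule onorm) simp
    also have "\<dots> \<le> onorm ((*v) (A x)) * C"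
      using bounded_compact_support.bound[OF G_bcs] by (intro mult_left_mono onorm_pos_le) auto
    finally show "norm (A x *v G z) \<le> onorm ((*v) (A x)) * C" .
  qed (use zero' in auto)
  obtain C' where AG: "bounded_compact_support (\<lambda>x. A x *v G x) C' y R" using AG_bcs by blast
  note i1 = integrable_grad_inner[OF e Ax, of x] and i2 = integrable_grad_inner[OF e AG, of x]
  show "integrable lborel (\<lambda>z. grad (mollifier \<epsilon>) (x - z) \<bullet> ((A x - A z) *v G z))"
    using Bochner_Integration.integrable_diff[OF i1 i2]
    by (simp add: matrix_vector_mult_diff_rdistrib inner_diff_right)
  have "lin_trace (\<lambda>h. A x *v Hu \<epsilon> x h) = (\<Sum>i\<in>UNIV. (A x *v Hu \<epsilon> x (axis i 1)) \<bullet> axis i 1)"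
    unfolding lin_trace_def by (rule sum_Basis_vec)
  also have "\<dots> = (\<Sum>i\<in>UNIV. \<integral>z. (A x *v (partial i (mollifier \<epsilon>) (x - z) *\<^sub>R G z)) \<bullet> axis i 1 \<partial>lborel)"
    unfolding Hu_axis[OF e x] conv_def
    by (intro sum.cong refl integral_bounded_linear[symmetric, OF bl conv_integrable[OF G_bcs k]])
  also have "\<dots> = (\<integral>z. (\<Sum>i\<in>UNIV. (A x *v (partial i (mollifier \<epsilon>) (x - z) *\<^sub>R G z)) \<bullet> axis i 1) \<partial>lborel)"
    by (intro Bochner_Integration.integral_sum[symmetric] integrable_bounded_linear[OF bl conv_integrable[OF G_bcs k]])
  also have "\<dots> = (\<integral>z. grad (mollifier \<epsilon>) (x - z) \<bullet> (A x *v G z) \<partial>lborel)"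
    unfolding inner_vec_def[of "grad _ _"] by (simp add: inner_axis matrix_vector_mult_scaleR)
  also have "\<dots> = (\<integral>z. grad (mollifier \<epsilon>) (x - z) \<bullet> ((A x - A z) *v G z) \<partial>lborel)
       + (\<integral>z. grad (mollifier \<epsilon>) (x - z) \<bullet> (A z *v G z) \<partial>lborel)"
    using i1 i2 by (simp add: matrix_vector_mult_diff_rdistrib inner_diff_right)
  \<comment> \<open>The part with the coefficient at \<open>z\<close> is the weak equation tested
    with the reflected kernel, so no derivative of the kernel is left on it.\<close>
  also have "(\<integral>z. grad (mollifier \<epsilon>) (x - z) \<bullet> (A z *v G z) \<partial>lborel) = - (\<integral>z. F z * mollifier \<epsilon> (x - z) \<partial>lborel)"
  proof -
    note r = partials_mollifier_reflect[OF e x, where \<alpha>="[]", unfolded partials_Nil]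
    have R': "norm (x - y) + \<epsilon> < R" using x by simp
    have "(\<integral>z. (A z *v G z) \<bullet> grad (\<lambda>z. mollifier \<epsilon> (x - z)) z \<partial>lborel) = (\<integral>z. F z * mollifier \<epsilon> (x - z) \<partial>lborel)"
      by (rule weak_eq[OF r(1) R' r(3)])
    moreover have "grad (\<lambda>z. mollifier \<epsilon> (x - z)) z = - grad (mollifier \<epsilon>) (x - z)" for z
      by (simp add: r(2) vec_eq_iff)
    ultimately show ?thesis by (simp add: inner_commute)
  qed
  finally show "lin_trace (\<lambda>h. A x *v Hu \<epsilon> x h)
     = (\<integral>z. grad (mollifier \<epsilon>) (x - z) \<bullet> ((A x - A z) *v G z) \<partial>lborel) - (\<integral>z. F z * mollifier \<epsilon> (x - z) \<partial>lborel)"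
    by simp
qed

lemma A_lipschitz:
  assumes Ca: "Ca \<ge> 0" "\<And>x h. x \<in> ball y R \<Longrightarrow> norm (A' x h) \<le> Ca * norm h"
    and x: "x \<in> ball y R" "z \<in> ball y R"
  shows "norm (A x - A z) \<le> Ca * norm (x - z)"
proof (rule differentiable_bound[OF convex_ball _ _ x(1) x(2)])
  fix p assume p: "p \<in> ball y R"
  show "(A has_derivative A' p) (at p within ball y R)"
    using bdiff_onD[OF A p] by (rule has_derivative_at_withinI)
  show "onorm (A' p) \<le> Ca" by (rule onorm_bound[OF Ca(1) Ca(2)[OF p]])
qed

text \<open>The kernel gradient has size \<epsilon>^(-n-1), with n the dimension; the Lipschitz
  bound on \<open>A\<close> gives back one \<epsilon>, and the remaining average is replaced by
  value plus oscillation. The second estimate compares the mollified pair with \<open>U\<close>, so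
  that both sides of the Carleman estimate can be expressed through \<open>U\<close>.\<close>

lemma mollified_estimates:
  obtains D where "D > 0"
    "\<And>\<epsilon> x. 0 < \<epsilon> \<Longrightarrow> norm (x - y) < R - \<epsilon> \<Longrightarrow>
      \<bar>lin_trace (\<lambda>h. A x *v Hu \<epsilon> x h + A' x h *v gu \<epsilon> x)\<bar> \<le> D * (norm (U x) + oscillation \<epsilon> U x)"
    "\<And>\<epsilon> x. 0 < \<epsilon> \<Longrightarrow> norm (x - y) < R - \<epsilon> \<Longrightarrow> norm ((ue \<epsilon> x, gu \<epsilon> x) - U x) \<le> D * oscillation \<epsilon> U x"
proof -
  interpret Ub: bounded_compact_support U C y R by (rule U_bcs)
  let ?n = "CARD('n)"
  obtain M0 where M0: "M0 \<ge> 0" "\<And>\<epsilon> x. \<epsilon> > 0 \<Longrightarrow> \<bar>(mollifier \<epsilon> :: real ^ 'n \<Rightarrow> real) x\<bar> \<le> M0 / \<epsilon> ^ ?n"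
    using partials_mollifier_bound[of "[] :: 'n list"] by auto
  have "\<exists>C\<ge>0. \<forall>\<epsilon> x. \<epsilon> > 0 \<longrightarrow> \<bar>partial i (mollifier \<epsilon> :: real ^ 'n \<Rightarrow> real) x\<bar> \<le> C / (\<epsilon> ^ ?n * \<epsilon>)" for i
    using partials_mollifier_bound[of "[i]"] unfolding partials_Cons partials_Nil list.size power_Suc by (metis One_nat_def add_0 mult.right_neutral power_0 power_one_right)
  then obtain Mi where Mi: "\<And>i. Mi i \<ge> 0" "\<And>i \<epsilon> x. \<epsilon> > 0 \<Longrightarrow> \<bar>partial i (mollifier \<epsilon> :: real ^ 'n \<Rightarrow> real) x\<bar> \<le> Mi i / (\<epsilon> ^ ?n * \<epsilon>)"
    by metis
  define M1 where "M1 = (\<Sum>i\<in>UNIV. Mi i)"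
  have M1: "M1 \<ge> 0" unfolding M1_def using Mi by (simp add: sum_nonneg)
  have gb: "norm (grad (mollifier \<epsilon> :: real ^ 'n \<Rightarrow> real) x) \<le> M1 / (\<epsilon> ^ ?n * \<epsilon>)" if "\<epsilon> > 0" for \<epsilon> x
    unfolding M1_def sum_divide_distrib
    by (intro order_trans[OF norm_le_l1_cart] sum_mono) (use Mi(2)[OF that] in auto)
  obtain Ca where Ca: "Ca \<ge> 0" "\<And>x h. x \<in> ball y R \<Longrightarrow> norm (A' x h) \<le> Ca * norm h"
    using A unfolding bdiff_on_def by metis
  obtain k where k: "k \<ge> 0" "\<And>(B::real^'n^'n) h. norm (B *v h) \<le> norm B * norm h * k"
    using bounded_bilinear.nonneg_bounded[OF bounded_bilinear_matrix_vector_mult] by blast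
  have GU: "norm (G x) \<le> norm (U x)" for x unfolding U_def by (rule norm_snd_le)
  define v where "v = unit_ball_vol (real ?n)"
  have v: "v > 0" by (simp add: v_def)
  define avg where "avg \<epsilon> x = (\<integral>z. indicator (cball 0 \<epsilon>) (x - z) * norm (U z) \<partial>lborel) / \<epsilon> ^ ?n" for \<epsilon> x
  have avg: "avg \<epsilon> x \<le> (1 + v) * (norm (U x) + oscillation \<epsilon> U x)" if "\<epsilon> > 0" for \<epsilon> x
  proof -
    have "avg \<epsilon> x \<le> oscillation \<epsilon> U x + v * norm (U x)"
      using Ub.average_le_oscillation(1)[OF that, of x] by (simp add: avg_def v_def)
    also have "\<dots> \<le> (1 + v) * (norm (U x) + oscillation \<epsilon> U x)"
      using v Ub.oscillation_nonneg[OF that, of x] by (simp add: algebra_simps)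
    finally show ?thesis .
  qed
  have avg_bound: "norm (\<integral>z. f z \<partial>lborel) \<le> B * avg \<epsilon> x"
    if e: "\<epsilon> > 0" and f: "integrable lborel f" and fb: "\<And>z. norm (f z) \<le> B / \<epsilon> ^ ?n * (indicator (cball 0 \<epsilon>) (x - z) * norm (U z))"
    for f :: "real ^ 'n \<Rightarrow> 'b::euclidean_space" and B \<epsilon> x
  proof -
    have "norm (\<integral>z. f z \<partial>lborel) \<le> (\<integral>z. norm (f z) \<partial>lborel)" by (rule integral_norm_bound)
    also have "\<dots> \<le> (\<integral>z. B / \<epsilon> ^ ?n * (indicator (cball 0 \<epsilon>) (x - z) * norm (U z)) \<partial>lborel)"
      by (intro integral_mono integrable_norm f integrable_mult_right Ub.average_le_oscillation(2)[OF e] fb)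
    also have "\<dots> = B * avg \<epsilon> x" by (simp add: avg_def)
    finally show ?thesis .
  qed
  have out: "mollifier \<epsilon> (x - z) = 0" "grad (mollifier \<epsilon>) (x - z) = 0" if "\<epsilon> > 0" "x - z \<notin> cball 0 \<epsilon>" for \<epsilon> and x z :: "real ^ 'n"
    using partials_mollifier_eq_0[OF that(1), of "x - z" "[]"] partials_mollifier_eq_0[OF that(1), of "x - z" "[_]"] that(2)
    by (simp_all add: partials_Cons vec_eq_iff)
  \<comment> \<open>The three summands in the bracket belong to the commutator, to \<open>F\<close>
    and to the derivative of \<open>A\<close> paired with \<open>gu \<epsilon> x\<close>; the factor
    \<open>1 + v\<close> converts averages, \<open>M0\<close> serves the second estimate, and 1
    gives positivity.\<close>
  define D where "D = (M1 * Ca * k + L * M0 + real ?n * (Ca * k * M0)) * (1 + v) + M0 + 1"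
  have nn: "0 \<le> (M1 * Ca * k + L * M0 + real ?n * (Ca * k * M0))"
    using M0(1) M1 Ca(1) k(1) L0 by (intro add_nonneg_nonneg mult_nonneg_nonneg) auto
  have D: "D > 0" "M0 \<le> D" "(M1 * Ca * k + L * M0 + real ?n * (Ca * k * M0)) * (1 + v) \<le> D"
    unfolding D_def using nn M0(1) v by (auto intro: add_nonneg_pos)
  show ?thesis
  proof (rule that[OF D(1)])
    fix \<epsilon> and x :: "real ^ 'n" assume e: "0 < \<epsilon>" and x: "norm (x - y) < R - \<epsilon>"
    have xb: "x \<in> ball y R" using x e by (simp add: dist_norm norm_minus_commute)
    have mk: "mollifying_kernel (mollifier \<epsilon> :: real ^ 'n \<Rightarrow> real)" by (rule mollifying_kernel_mollifier[OF e])
    have "norm (\<integral>z. grad (mollifier \<epsilon>) (x - z) \<bullet> ((A x - A z) *v G z) \<partial>lborel) \<le> (M1 * Ca * k) * avg \<epsilon> x"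
    proof (rule avg_bound[OF e trace_Hu(2)[OF e x]])
      fix z
      show "norm (grad (mollifier \<epsilon>) (x - z) \<bullet> ((A x - A z) *v G z)) \<le> M1 * Ca * k / \<epsilon> ^ ?n * (indicator (cball 0 \<epsilon>) (x - z) * norm (U z))"
      proof (cases "x - z \<in> cball 0 \<epsilon> \<and> z \<in> ball y R")
        case True
        have "norm ((A x - A z) *v G z) \<le> norm (A x - A z) * norm (G z) * k" by (rule k)
        also have "\<dots> \<le> (Ca * \<epsilon>) * norm (U z) * k"
        proof (intro mult_right_mono mult_mono)
          have "norm (A x - A z) \<le> Ca * norm (x - z)" using A_lipschitz[OF Ca xb] True by blast
          also have "\<dots> \<le> Ca * \<epsilon>" using True Ca(1) by (intro mult_left_mono) auto
          finally show "norm (A x - A z) \<le> Ca * \<epsilon>" .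
        qed (use GU Ca(1) e k(1) in auto)
        finally have 1: "norm ((A x - A z) *v G z) \<le> (Ca * \<epsilon>) * norm (U z) * k" .
        have "norm (grad (mollifier \<epsilon>) (x - z) \<bullet> ((A x - A z) *v G z))
           \<le> norm (grad (mollifier \<epsilon>) (x - z)) * norm ((A x - A z) *v G z)"
          unfolding real_norm_def by (rule Cauchy_Schwarz_ineq2)
        also have "\<dots> \<le> (M1 / (\<epsilon> ^ ?n * \<epsilon>)) * ((Ca * \<epsilon>) * norm (U z) * k)"
          using gb[OF e] 1 M1 e by (intro mult_mono) auto
        also have "\<dots> = M1 * Ca * k / \<epsilon> ^ ?n * (indicator (cball 0 \<epsilon>) (x - z) * norm (U z))"
          using True e by (simp add: indicator_def)
        finally show ?thesis .
      next
        case False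
        \<comment> \<open>For \<open>z\<close> outside the ball there is no Lipschitz bound on
          \<open>A\<close>, but \<open>G z\<close> is 0 there.\<close>
        then have "grad (mollifier \<epsilon>) (x - z) = 0 \<or> G z = 0" using out(2)[OF e] zero by blast
        moreover have "0 \<le> M1 * Ca * k / \<epsilon> ^ ?n * (indicator (cball 0 \<epsilon>) (x - z) * norm (U z))"
          using M1 Ca(1) k(1) e by simp
        ultimately show ?thesis by auto
      qed
    qed
    moreover have "norm (\<integral>z. F z * mollifier \<epsilon> (x - z) \<partial>lborel) \<le> (L * M0) * avg \<epsilon> x"
    proof (rule avg_bound[OF e])
      show "integrable lborel (\<lambda>z. F z * mollifier \<epsilon> (x - z))"
        using conv_integrable[OF F_bcs mk, of x] by (simp add: mult.commute)
      fix z
      show "norm (F z * mollifier \<epsilon> (x - z)) \<le> L * M0 / \<epsilon> ^ ?n * (indicator (cball 0 \<epsilon>) (x - z) * norm (U z))"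
      proof (cases "x - z \<in> cball 0 \<epsilon>")
        case True
        have "\<bar>F z\<bar> * \<bar>mollifier \<epsilon> (x - z)\<bar> \<le> (L * norm (U z)) * (M0 / \<epsilon> ^ ?n)"
          using F_le[of z] M0(2)[OF e] L0 by (intro mult_mono) (auto simp: U_def)
        then show ?thesis using True by (simp add: abs_mult mult_ac)
      qed (use out(1)[OF e] in simp)
    qed
    ultimately have t1: "\<bar>lin_trace (\<lambda>h. A x *v Hu \<epsilon> x h)\<bar> \<le> (M1 * Ca * k) * avg \<epsilon> x + (L * M0) * avg \<epsilon> x"
      unfolding trace_Hu(1)[OF e x] real_norm_def by linarith
    have "norm (gu \<epsilon> x) \<le> M0 * avg \<epsilon> x"
      unfolding gu_eq[OF e x] conv_def
    proof (rule avg_bound[OF e conv_integrable[OF G_bcs mk]])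
      fix z
      show "norm (mollifier \<epsilon> (x - z) *\<^sub>R G z) \<le> M0 / \<epsilon> ^ ?n * (indicator (cball 0 \<epsilon>) (x - z) * norm (U z))"
      proof (cases "x - z \<in> cball 0 \<epsilon>")
        case True
        have "\<bar>mollifier \<epsilon> (x - z)\<bar> * norm (G z) \<le> (M0 / \<epsilon> ^ ?n) * norm (U z)"
          using GU[of z] M0(2)[OF e, of "x - z"] M0(1) e by (intro mult_mono) auto
        then show ?thesis using True by simp
      qed (use out(1)[OF e] in simp)
    qed
    then have "Ca * k * norm (gu \<epsilon> x) \<le> Ca * k * (M0 * avg \<epsilon> x)" using Ca(1) k(1) by (intro mult_left_mono) auto
    moreover have "\<bar>lin_trace (\<lambda>h. A' x h *v gu \<epsilon> x)\<bar> \<le> DIM(real ^ 'n) * (Ca * k * norm (gu \<epsilon> x))"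
    proof (rule abs_lin_trace_le)
      fix h
      have "norm (A' x h *v gu \<epsilon> x) \<le> norm (A' x h) * norm (gu \<epsilon> x) * k" by (rule k)
      also have "\<dots> \<le> (Ca * norm h) * norm (gu \<epsilon> x) * k" using Ca(2)[OF xb, of h] k(1) by (intro mult_right_mono) auto
      finally show "norm (A' x h *v gu \<epsilon> x) \<le> Ca * k * norm (gu \<epsilon> x) * norm h" by (simp add: mult_ac)
    qed
    ultimately have t2: "\<bar>lin_trace (\<lambda>h. A' x h *v gu \<epsilon> x)\<bar> \<le> real ?n * (Ca * k * (M0 * avg \<epsilon> x))"
      by (simp add: mult_left_mono order_trans)
    have "\<bar>lin_trace (\<lambda>h. A x *v Hu \<epsilon> x h + A' x h *v gu \<epsilon> x)\<bar> \<le> (M1 * Ca * k + L * M0 + real ?n * (Ca * k * M0)) * avg \<epsilon> x"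
      using t1 t2 abs_triangle_ineq[of "lin_trace (\<lambda>h. A x *v Hu \<epsilon> x h)" "lin_trace (\<lambda>h. A' x h *v gu \<epsilon> x)"]
      unfolding lin_trace_add by (simp add: algebra_simps)
    also have "\<dots> \<le> (M1 * Ca * k + L * M0 + real ?n * (Ca * k * M0)) * ((1 + v) * (norm (U x) + oscillation \<epsilon> U x))"
      using nn avg[OF e] by (intro mult_left_mono) auto
    also have "\<dots> \<le> D * (norm (U x) + oscillation \<epsilon> U x)"
      using mult_right_mono[OF D(3), of "norm (U x) + oscillation \<epsilon> U x"] Ub.oscillation_nonneg[OF e, of x]
      by (simp add: mult.assoc)
    finally show "\<bar>lin_trace (\<lambda>h. A x *v Hu \<epsilon> x h + A' x h *v gu \<epsilon> x)\<bar> \<le> D * (norm (U x) + oscillation \<epsilon> U x)" .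
    have "norm (conv (mollifier \<epsilon>) U x - U x) \<le> M0 * oscillation \<epsilon> U x"
      unfolding conv_def
      by (rule Ub.kernel_oscillation[OF e kernel_continuous[OF mk] _ _ integral_mollifier[OF e]])
         (use M0(2)[OF e] partials_mollifier_eq_0[OF e, of _ "[]", OF less_imp_le] in auto)
    moreover have "conv (mollifier \<epsilon>) U x = (ue \<epsilon> x, gu \<epsilon> x)"
      using integral_bounded_linear[OF bounded_linear_fst conv_integrable[OF U_bcs mk], of x]
        integral_bounded_linear[OF bounded_linear_snd conv_integrable[OF U_bcs mk], of x]
      unfolding ue_def gu_eq[OF e x] conv_def by (simp add: U_def prod_eq_iff)
    ultimately show "norm ((ue \<epsilon> x, gu \<epsilon> x) - U x) \<le> D * oscillation \<epsilon> U x"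
      using mult_right_mono[OF D(2) Ub.oscillation_nonneg[OF e, of x]] by simp
  qed
qed

end

section \<open>Unique continuation in a ball\<close>

context weak_solution_ball
begin

text \<open>\<open>J \<tau>\<close> is the weighted energy on the inner ball. Once \<epsilon> is
  gone, the estimate bounds \<tau> times \<open>J \<tau>\<close> by a multiple of
  \<open>J \<tau>\<close>, which is absorbed, plus a multiple of \<open>(W1 \<tau>)\<^sup>2\<close>
  from the annulus of the cutoff. Since \<open>(W1 \<tau>)\<^sup>2 * J0\<close> is at most
  \<open>J \<tau>\<close>, the weight divides out and the unweighted energy \<open>J0\<close> is of
  order 1 / \<tau>.\<close>

lemma unique_continuation_smaller_ball:
  assumes r: "0 < r" and R1: "0 < R1" "R1 < R"
    and u0: "AE z in lborel. z \<in> ball y r \<longrightarrow> u z = 0"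
  shows "AE z in lborel. z \<in> cball y R1 \<longrightarrow> u z = 0"
proof -
  interpret Ub: bounded_compact_support U C y R by (rule U_bcs)
  define R2 where "R2 = (R1 + R) / 2"
  have R2: "R1 < R2" "R2 < R" using R1 by (auto simp: R2_def)
  obtain \<theta> gt Ht where th: "\<And>S. bounded S \<Longrightarrow> bdiff_on S \<theta> (\<lambda>x h. gt x \<bullet> h)" "\<And>S. bounded S \<Longrightarrow> bdiff_on S gt Ht"
    "\<And>x h k. Ht x h \<bullet> k = h \<bullet> Ht x k" "\<And>x. 0 \<le> \<theta> x" "\<And>x. \<theta> x \<le> 1"
    "\<And>x h. norm (x - y) \<le> R1 \<Longrightarrow> \<theta> x = 1 \<and> gt x = 0 \<and> Ht x h = 0"
    "\<And>x h. norm (x - y) \<ge> R2 \<Longrightarrow> \<theta> x = 0 \<and> gt x = 0 \<and> Ht x h = 0"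
    by (rule radial_cutoff[OF R1(1) R2(1), of y]) (rule that)
  \<comment> \<open>The other half of \<open>r\<close> is reserved for the mollification: with
    \<epsilon> at most \<open>r0\<close> the mollified function still vanishes on
    \<open>ball y r0\<close>.\<close>
  define r0 where "r0 = r / 2"
  have r0: "r0 > 0" using r by (simp add: r0_def)
  show ?thesis
  proof (rule carleman_estimate[OF r0])
  fix \<mu> Cc \<tau>0 :: real
  assume mu: "\<mu> > 0" and Cc: "Cc > 0" and tau0: "\<tau>0 \<ge> 1" and carl:
    "\<And>\<tau> v gv Hv \<alpha> \<beta> R2. \<lbrakk>\<tau> \<ge> \<tau>0; bdiff_on (ball y R) v (\<lambda>x h. gv x \<bullet> h); bdiff_on (ball y R) gv Hv;
       \<And>x h k. x \<in> ball y R \<Longrightarrow> Hv x h \<bullet> k = h \<bullet> Hv x k; R2 < R;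
       \<And>x. x \<notin> cball y R2 \<Longrightarrow> v x = 0 \<and> gv x = 0; \<And>x. x \<in> ball y r0 \<Longrightarrow> v x = 0 \<and> gv x = 0;
       integrable lborel \<alpha>; integrable lborel \<beta>;
       \<And>x. x \<in> ball y R \<Longrightarrow>
         \<alpha> x \<le> \<tau> * (exp (\<tau> * exp (- (\<mu> / 2) * (norm (x - y))\<^sup>2)))\<^sup>2 * ((norm (gv x))\<^sup>2 + (v x)\<^sup>2);
       \<And>x. x \<notin> ball y R \<Longrightarrow> \<alpha> x \<le> 0; \<And>x. 0 \<le> \<beta> x;
       \<And>x. x \<in> ball y R \<Longrightarrow> r0 \<le> norm (x - y) \<Longrightarrow>
         (exp (\<tau> * exp (- (\<mu> / 2) * (norm (x - y))\<^sup>2)) * lin_trace (\<lambda>h. A x *v Hv x h + A' x h *v gv x))\<^sup>2 \<le> \<beta> x\<rbrakk>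
     \<Longrightarrow> (\<integral>x. \<alpha> x \<partial>lborel) \<le> Cc * (\<integral>x. \<beta> x \<partial>lborel)"
  obtain D where D0: "D > 0" and D1: "\<And>\<epsilon> x. 0 < \<epsilon> \<Longrightarrow> norm (x - y) < R - \<epsilon> \<Longrightarrow>
      \<bar>lin_trace (\<lambda>h. A x *v Hu \<epsilon> x h + A' x h *v gu \<epsilon> x)\<bar> \<le> D * (norm (U x) + oscillation \<epsilon> U x)"
    and D2: "\<And>\<epsilon> x. 0 < \<epsilon> \<Longrightarrow> norm (x - y) < R - \<epsilon> \<Longrightarrow> norm ((ue \<epsilon> x, gu \<epsilon> x) - U x) \<le> D * oscillation \<epsilon> U x"
    by (rule mollified_estimates) (rule that)
  define Osc where "Osc = 2 * C * unit_ball_vol (real CARD('n))"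
  have osc_le: "oscillation \<epsilon> U x \<le> Osc" if "\<epsilon> > 0" for \<epsilon> x
    using Ub.oscillation_le[OF that, of x] by (simp add: Osc_def)
  have Osc0: "Osc \<ge> 0" using C0 by (simp add: Osc_def)

  obtain T where T: "T \<ge> 0" "\<And>x. x \<in> ball y R \<Longrightarrow> norm (gt x) \<le> T" "\<And>x h. x \<in> ball y R \<Longrightarrow> norm (Ht x h) \<le> T * norm h"
    using th(2)[OF bounded_ball, of y R] unfolding bdiff_on_def by blast
  obtain M where M: "M \<ge> 1"
    "\<And>x h. x \<in> ball y R \<Longrightarrow> norm (A x *v h) \<le> M * norm h"
    "\<And>x h g. x \<in> ball y R \<Longrightarrow> norm (A' x h *v g) \<le> M * norm h * norm g"
    by (rule coefficient_bounds) (rule that)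
  \<comment> \<open>\<open>E\<close> bounds the mollified pair, and \<open>C2\<close> bounds the
    operator applied to the cut off function in the annulus, where no smallness is required. Its
    four summands match the four terms of \<open>split\<close>.\<close>
  define E where "E = C + D * Osc"
  define C2 where "C2 = D * (C + Osc) + T * (M * E) + E * (real CARD('n) * (M * T + M * T)) + E * (M * T)"
  have E0: "E \<ge> 0" using C0 D0 Osc0 by (simp add: E_def)

  define W where "W \<tau> x = exp (\<tau> * exp (- (\<mu> / 2) * (norm (x - y))\<^sup>2))" for \<tau> and x :: "real ^ 'n"
  \<comment> \<open>The value of the weight on the sphere of radius \<open>R1\<close>: a lower bound
    inside it and an upper bound outside.\<close>
  define W1 where "W1 \<tau> = exp (\<tau> * exp (- (\<mu> / 2) * R1\<^sup>2))" for \<tau>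
  have W1: "W1 \<tau> > 0" for \<tau> by (simp add: W1_def)
  have Wc: "continuous_on UNIV (W \<tau>)" for \<tau> unfolding W_def by (intro continuous_intros)
  have Wm: "W \<tau> \<in> borel_measurable borel" for \<tau> by (rule borel_measurable_continuous_onI[OF Wc])
  have W_le: "(W \<tau> x)\<^sup>2 \<le> exp (2 * \<tau>)" if "\<tau> \<ge> 0" for \<tau> x
  proof -
    have "exp (- (\<mu> / 2) * (norm (x - y))\<^sup>2) \<le> 1" using mu by simp
    from mult_left_mono[OF this that] have "W \<tau> x \<le> exp \<tau>" by (simp add: W_def)
    then have "(W \<tau> x)\<^sup>2 \<le> (exp \<tau>)\<^sup>2" by (intro power_mono) (auto simp: W_def)
    also have "\<dots> = exp (2 * \<tau>)" by (simp add: power2_eq_square flip: exp_add)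
    finally show ?thesis .
  qed
  have W_in: "W1 \<tau> \<le> W \<tau> x" if "norm (x - y) \<le> R1" "\<tau> \<ge> 0" for \<tau> x
  proof -
    have "(norm (x - y))\<^sup>2 \<le> R1\<^sup>2" using that by (intro power_mono) auto
    then have "exp (- (\<mu> / 2) * R1\<^sup>2) \<le> exp (- (\<mu> / 2) * (norm (x - y))\<^sup>2)" using mu by simp
    from mult_left_mono[OF this that(2)] show ?thesis by (simp add: W_def W1_def)
  qed
  have W_out: "W \<tau> x \<le> W1 \<tau>" if "norm (x - y) \<ge> R1" "\<tau> \<ge> 0" for \<tau> x
  proof -
    have "R1\<^sup>2 \<le> (norm (x - y))\<^sup>2" using that R1 by (intro power_mono) auto
    then have "exp (- (\<mu> / 2) * (norm (x - y))\<^sup>2) \<le> exp (- (\<mu> / 2) * R1\<^sup>2)" using mu by simp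
    from mult_left_mono[OF this that(2)] show ?thesis by (simp add: W_def W1_def)
  qed

  define i1 :: "real ^ 'n \<Rightarrow> real" where "i1 = indicator (cball y R1)"
  define i2 :: "real ^ 'n \<Rightarrow> real" where "i2 = indicator (cball y R2)"
  have i1m: "i1 \<in> borel_measurable borel" unfolding i1_def by (rule borel_measurable_indicator) simp
  have Um: "(\<lambda>x. (norm (U x))\<^sup>2) \<in> borel_measurable borel"
    by (intro borel_measurable_power borel_measurable_continuous_on[OF _ Ub.meas, of norm] continuous_intros)
  define J where "J \<tau> = (\<integral>x. i1 x * (W \<tau> x)\<^sup>2 * (norm (U x))\<^sup>2 \<partial>lborel)" for \<tau>
  define J0 where "J0 = (\<integral>x. i1 x * (norm (U x))\<^sup>2 \<partial>lborel)"
  define V2 where "V2 = (\<integral>x. i2 x \<partial>lborel)"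
  have i2int: "integrable lborel i2" unfolding i2_def
    by (intro integrable_real_indicator) (use emeasure_lborel_cball_finite in \<open>auto simp: less_top[symmetric]\<close>)
  have U2: "(norm (U x))\<^sup>2 \<le> C\<^sup>2" for x using Ub.bound[of x] by (intro power_mono) auto
  have Jint: "integrable lborel (\<lambda>x. i1 x * (W \<tau> x)\<^sup>2 * (norm (U x))\<^sup>2)" if "\<tau> \<ge> 0" for \<tau>
  proof (rule integrable_lborel_bounded_support[where C="exp (2 * \<tau>) * C\<^sup>2" and a=y and r=R1])
    show "(\<lambda>x. i1 x * (W \<tau> x)\<^sup>2 * (norm (U x))\<^sup>2) \<in> borel_measurable borel"
      by (intro borel_measurable_times borel_measurable_power Wm i1m Um)
    fix x
    have "(W \<tau> x)\<^sup>2 * (norm (U x))\<^sup>2 \<le> exp (2 * \<tau>) * C\<^sup>2" using W_le[OF that] U2 by (intro mult_mono) auto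
    then show "norm (i1 x * (W \<tau> x)\<^sup>2 * (norm (U x))\<^sup>2) \<le> exp (2 * \<tau>) * C\<^sup>2"
      by (auto simp: i1_def indicator_def abs_mult)
  qed (simp add: i1_def)
  have J0int: "integrable lborel (\<lambda>x. i1 x * (norm (U x))\<^sup>2)"
    using Jint[of 0] by (simp add: W_def)
  have J_ge: "(W1 \<tau>)\<^sup>2 * J0 \<le> J \<tau>" if "\<tau> \<ge> 0" for \<tau>
  proof -
    have "(\<integral>x. (W1 \<tau>)\<^sup>2 * (i1 x * (norm (U x))\<^sup>2) \<partial>lborel) \<le> J \<tau>"
      unfolding J_def
    proof (rule integral_mono[OF integrable_mult_right[OF J0int] Jint[OF that]])
      fix x
      show "(W1 \<tau>)\<^sup>2 * (i1 x * (norm (U x))\<^sup>2) \<le> i1 x * (W \<tau> x)\<^sup>2 * (norm (U x))\<^sup>2"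
      proof (cases "x \<in> cball y R1")
        case True
        then have "norm (x - y) \<le> R1" by (simp add: dist_norm norm_minus_commute)
        from W_in[OF this that] have "(W1 \<tau>)\<^sup>2 \<le> (W \<tau> x)\<^sup>2" using W1[of \<tau>] by (intro power_mono) auto
        then show ?thesis using True by (simp add: i1_def mult_right_mono)
      qed (simp add: i1_def)
    qed
    then show ?thesis by (simp add: J0_def)
  qed
  \<comment> \<open>Collects the coefficients of the oscillation, with
    \<open>exp (2 * \<tau>)\<close> as a crude bound for the squared weight. Its growth in \<tau> is
    harmless because \<open>d\<close> tends to 0 while \<tau> is fixed.\<close>
  define K where "K \<tau> = (\<tau> * D\<^sup>2 * Osc + Cc * (2 * D\<^sup>2 * Osc)) * exp (2 * \<tau>)" for \<tau>

  have main: "\<tau> / 2 * J \<tau> \<le> Cc * (2 * D\<^sup>2) * J \<tau> + Cc * (C2\<^sup>2 * (W1 \<tau>)\<^sup>2 * V2) + K \<tau> * d"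
    if tau: "\<tau> \<ge> \<tau>0" and d: "d > 0" for \<tau> d
  proof -
    have t0: "\<tau> \<ge> 0" using tau tau0 by simp
    obtain \<delta> where del: "\<delta> > 0"
      "\<And>\<epsilon>. 0 < \<epsilon> \<Longrightarrow> \<epsilon> \<le> \<delta> \<Longrightarrow> integrable lborel (oscillation \<epsilon> U) \<and> (\<integral>x. oscillation \<epsilon> U x \<partial>lborel) \<le> d"
      using Ub.integral_oscillation_small[OF d] by blast
    \<comment> \<open>Three demands: small mean oscillation, room between \<open>cball y R2\<close>
      and the boundary of the ball, and survival of the zero region around the centre.\<close>
    define \<epsilon> where "\<epsilon> = min \<delta> (min ((R - R2) / 2) r0)"
    have e: "\<epsilon> > 0" "\<epsilon> \<le> \<delta>" "\<epsilon> < R - R2" "\<epsilon> \<le> r0" using del(1) R2 r0 by (auto simp: \<epsilon>_def min_def)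
    define os where "os = oscillation \<epsilon> U"
    have os: "integrable lborel os" "(\<integral>x. os x \<partial>lborel) \<le> d" using del(2)[OF e(1,2)] by (auto simp: os_def)
    have os0: "0 \<le> os x" "os x \<le> Osc" for x
      using Ub.oscillation_nonneg[OF e(1)] osc_le[OF e(1)] by (auto simp: os_def)
    have os2: "(os x)\<^sup>2 \<le> Osc * os x" for x
      unfolding power2_eq_square using os0[of x] by (intro mult_right_mono) auto
    define Os where "Os = (\<integral>x. i1 x * (W \<tau> x)\<^sup>2 * os x \<partial>lborel)"
    have Osint: "integrable lborel (\<lambda>x. i1 x * (W \<tau> x)\<^sup>2 * os x)"
    proof (rule Bochner_Integration.integrable_bound)
      show "integrable lborel (\<lambda>x. exp (2 * \<tau>) * os x)" using os(1) by simp
      show "(\<lambda>x. i1 x * (W \<tau> x)\<^sup>2 * os x) \<in> borel_measurable lborel"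
        unfolding measurable_lborel2
        by (intro borel_measurable_times borel_measurable_power Wm i1m
            borel_measurable_integrable[OF os(1), unfolded measurable_lborel2])
      show "AE x in lborel. norm (i1 x * (W \<tau> x)\<^sup>2 * os x) \<le> norm (exp (2 * \<tau>) * os x)"
      proof (rule AE_I2)
        fix x
        have "(W \<tau> x)\<^sup>2 * os x \<le> exp (2 * \<tau>) * os x" using W_le[OF t0] os0 by (intro mult_right_mono) auto
        then show "norm (i1 x * (W \<tau> x)\<^sup>2 * os x) \<le> norm (exp (2 * \<tau>) * os x)"
          using os0[of x] by (auto simp: i1_def indicator_def abs_mult)
      qed
    qed
    have Os_le: "Os \<le> exp (2 * \<tau>) * d"
    proof -
      have "Os \<le> (\<integral>x. exp (2 * \<tau>) * os x \<partial>lborel)"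
        unfolding Os_def
      proof (rule integral_mono[OF Osint])
        fix x
        have "(W \<tau> x)\<^sup>2 * os x \<le> exp (2 * \<tau>) * os x" using W_le[OF t0] os0 by (intro mult_right_mono) auto
        then show "i1 x * (W \<tau> x)\<^sup>2 * os x \<le> exp (2 * \<tau>) * os x"
          using os0[of x] by (auto simp: i1_def indicator_def)
      qed (use os in simp)
      also have "\<dots> \<le> exp (2 * \<tau>) * d" using os by simp
      finally show ?thesis .
    qed
    define v where "v x = \<theta> x * ue \<epsilon> x" for x
    define gv where "gv x = \<theta> x *\<^sub>R gu \<epsilon> x + ue \<epsilon> x *\<^sub>R gt x" for x
    define Hv where "Hv x h = (\<theta> x *\<^sub>R Hu \<epsilon> x h + (gt x \<bullet> h) *\<^sub>R gu \<epsilon> x) + (ue \<epsilon> x *\<^sub>R Ht x h + (gu \<epsilon> x \<bullet> h) *\<^sub>R gt x)" for x h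
    note bu = bdiff_ue[OF e(1), of "ball y R"] and bg = bdiff_gu[OF e(1), of "ball y R"]
    note bt = th(1)[OF bounded_ball, of y R] and bgt = th(2)[OF bounded_ball, of y R]
    have v: "bdiff_on (ball y R) v (\<lambda>x h. gv x \<bullet> h)"
      unfolding v_def[abs_def]
      by (rule bdiff_on_cong[OF bdiff_on_mult[OF bt bu]]) (simp add: gv_def inner_add_left mult.commute)
    have gv: "bdiff_on (ball y R) gv Hv"
      unfolding gv_def[abs_def] Hv_def[abs_def]
      by (rule bdiff_on_add[OF bdiff_on_scaleR[OF bt bg] bdiff_on_scaleR[OF bu bgt]])
    have symv: "Hv x h \<bullet> k = h \<bullet> Hv x k" for x h k
      using Hu_sym[of \<epsilon> x h k] th(3)[of x h k]
      by (simp add: Hv_def inner_add_left inner_add_right inner_commute mult.commute)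
    have vout: "v x = 0 \<and> gv x = 0" if "x \<notin> cball y R2" for x
      using th(7)[of x] that by (simp add: v_def gv_def dist_norm norm_minus_commute)
    have vin: "v x = 0 \<and> gv x = 0" if "x \<in> ball y r0" for x
    proof -
      have "x \<in> ball y (r - \<epsilon>)" using that e(4) by (simp add: r0_def)
      from ue_gu_zero[OF e(1) u0 this] show ?thesis by (simp add: v_def gv_def)
    qed
    \<comment> \<open>\<open>\<bar>U\<bar>\<^sup>2 / 2 - D\<^sup>2 os\<^sup>2\<close> bounds the mollified square from below, and \<open>os\<^sup>2 \<le> Osc os\<close> leaves only
      the integral of \<open>os\<close>, which tends to 0 with \<open>\<epsilon>\<close>.\<close>
    define \<alpha> where "\<alpha> x = \<tau> / 2 * (i1 x * (W \<tau> x)\<^sup>2 * (norm (U x))\<^sup>2) - \<tau> * D\<^sup>2 * Osc * (i1 x * (W \<tau> x)\<^sup>2 * os x)" for x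
    define \<beta> where "\<beta> x = 2 * D\<^sup>2 * (i1 x * (W \<tau> x)\<^sup>2 * (norm (U x))\<^sup>2) + 2 * D\<^sup>2 * Osc * (i1 x * (W \<tau> x)\<^sup>2 * os x)
       + C2\<^sup>2 * (W1 \<tau>)\<^sup>2 * i2 x" for x
    have near: "norm (x - y) < R - \<epsilon>" if "norm (x - y) \<le> R2" for x using that e(3) by simp
    have "(\<integral>x. \<alpha> x \<partial>lborel) \<le> Cc * (\<integral>x. \<beta> x \<partial>lborel)"
    proof (rule carl[OF tau v gv symv R2(2) vout vin])
      show "integrable lborel \<alpha>" unfolding \<alpha>_def
        by (intro Bochner_Integration.integrable_diff integrable_mult_right Jint[OF t0] Osint)
      show "integrable lborel \<beta>" unfolding \<beta>_def
        by (intro Bochner_Integration.integrable_add integrable_mult_right Jint[OF t0] Osint i2int)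
      show "0 \<le> \<beta> x" for x using os0[of x] Osc0 by (simp add: \<beta>_def i1_def i2_def)
      show "\<alpha> x \<le> 0" if "x \<notin> ball y R" for x
        using that R1 by (simp add: \<alpha>_def i1_def indicator_def)
      show "\<alpha> x \<le> \<tau> * (exp (\<tau> * exp (- (\<mu> / 2) * (norm (x - y))\<^sup>2)))\<^sup>2 * ((norm (gv x))\<^sup>2 + (v x)\<^sup>2)" if "x \<in> ball y R" for x
      proof (cases "x \<in> cball y R1")
        case True
        then have nx: "norm (x - y) \<le> R1" by (simp add: dist_norm norm_minus_commute)
        then have vx: "v x = ue \<epsilon> x" "gv x = gu \<epsilon> x" using th(6)[OF nx] by (auto simp: v_def gv_def)
        have d2: "norm ((ue \<epsilon> x, gu \<epsilon> x) - U x) \<le> D * os x"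
          unfolding os_def by (rule D2[OF e(1) near]) (use nx R2 in simp)
        have "norm (U x) \<le> norm (ue \<epsilon> x, gu \<epsilon> x) + D * os x"
          using d2 norm_triangle_sub[of "U x" "(ue \<epsilon> x, gu \<epsilon> x)"] by (simp add: norm_minus_commute)
        then have "(norm (U x))\<^sup>2 \<le> (norm (ue \<epsilon> x, gu \<epsilon> x) + D * os x)\<^sup>2" by (intro power_mono) auto
        also have "\<dots> \<le> 2 * (norm (ue \<epsilon> x, gu \<epsilon> x))\<^sup>2 + 2 * (D\<^sup>2 * (os x)\<^sup>2)"
          using zero_le_power2[of "norm (ue \<epsilon> x, gu \<epsilon> x) - D * os x"]
          by (simp add: power2_sum power2_diff power_mult_distrib)
        also have "\<dots> \<le> 2 * ((norm (gv x))\<^sup>2 + (v x)\<^sup>2) + 2 * (D\<^sup>2 * (Osc * os x))"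
        proof (intro add_mono mult_left_mono)
          show "(norm (ue \<epsilon> x, gu \<epsilon> x))\<^sup>2 \<le> (norm (gv x))\<^sup>2 + (v x)\<^sup>2" by (simp add: norm_prod_def vx)
        qed (use os2 in auto)
        finally have "1 / 2 * (norm (U x))\<^sup>2 - D\<^sup>2 * (Osc * os x) \<le> (norm (gv x))\<^sup>2 + (v x)\<^sup>2" by simp
        then have "\<tau> * (W \<tau> x)\<^sup>2 * (1 / 2 * (norm (U x))\<^sup>2 - D\<^sup>2 * (Osc * os x)) \<le> \<tau> * (W \<tau> x)\<^sup>2 * ((norm (gv x))\<^sup>2 + (v x)\<^sup>2)"
          using t0 by (intro mult_left_mono) auto
        moreover have "\<alpha> x = \<tau> * (W \<tau> x)\<^sup>2 * (1 / 2 * (norm (U x))\<^sup>2 - D\<^sup>2 * (Osc * os x))"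
          using True by (simp add: \<alpha>_def i1_def algebra_simps)
        ultimately show ?thesis unfolding W_def by simp
      next
        case False
        then have "\<alpha> x = 0" by (simp add: \<alpha>_def i1_def)
        then show ?thesis using t0 by simp
      qed
      show "(exp (\<tau> * exp (- (\<mu> / 2) * (norm (x - y))\<^sup>2)) * lin_trace (\<lambda>h. A x *v Hv x h + A' x h *v gv x))\<^sup>2 \<le> \<beta> x"
        if xb: "x \<in> ball y R" for x
        unfolding W_def[symmetric] power_mult_distrib
      proof -
        define Lu where "Lu = lin_trace (\<lambda>h. A x *v Hu \<epsilon> x h + A' x h *v gu \<epsilon> x)"
        \<comment> \<open>Inside, the operator is controlled by \<open>U\<close> and the
          oscillation. In the annulus everything is merely bounded, but the weight is at most
          \<open>W1 \<tau>\<close>. Beyond \<open>R2\<close> the cutoff vanishes with its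
          derivatives.\<close>
        consider "norm (x - y) \<le> R1" | "R1 < norm (x - y)" "norm (x - y) \<le> R2" | "norm (x - y) > R2" by linarith
        then show "(W \<tau> x)\<^sup>2 * (lin_trace (\<lambda>h. A x *v Hv x h + A' x h *v gv x))\<^sup>2 \<le> \<beta> x"
        proof cases
          case 1
          have LL: "lin_trace (\<lambda>h. A x *v Hv x h + A' x h *v gv x) = Lu"
            using th(6)[OF 1] by (simp add: Lu_def Hv_def gv_def)
          have "\<bar>Lu\<bar> \<le> D * (norm (U x) + os x)"
            unfolding Lu_def os_def by (rule D1[OF e(1) near]) (use 1 R2 in simp)
          then have "\<bar>Lu\<bar>\<^sup>2 \<le> (D * (norm (U x) + os x))\<^sup>2" by (intro power_mono) auto
          then have "Lu\<^sup>2 \<le> D\<^sup>2 * (norm (U x) + os x)\<^sup>2" by (simp add: power_mult_distrib)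
          also have "\<dots> \<le> D\<^sup>2 * (2 * (norm (U x))\<^sup>2 + 2 * (Osc * os x))"
          proof (intro mult_left_mono)
            show "(norm (U x) + os x)\<^sup>2 \<le> 2 * (norm (U x))\<^sup>2 + 2 * (Osc * os x)"
              using zero_le_power2[of "norm (U x) - os x"] os2[of x] by (simp add: power2_sum power2_diff)
          qed auto
          finally have "(W \<tau> x)\<^sup>2 * Lu\<^sup>2 \<le> (W \<tau> x)\<^sup>2 * (D\<^sup>2 * (2 * (norm (U x))\<^sup>2 + 2 * (Osc * os x)))"
            by (intro mult_left_mono) auto
          also have "\<dots> \<le> \<beta> x"
            using 1 by (simp add: \<beta>_def i1_def i2_def dist_norm norm_minus_commute algebra_simps)
          finally show ?thesis unfolding LL .
        next
          case 2
          have ow: "norm (U x) \<le> C" "os x \<le> Osc" using Ub.bound os0 by auto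
          have UE: "norm (ue \<epsilon> x, gu \<epsilon> x) \<le> E"
          proof -
            have "norm ((ue \<epsilon> x, gu \<epsilon> x) - U x) \<le> D * os x"
              unfolding os_def by (rule D2[OF e(1) near[OF 2(2)]])
            also have "\<dots> \<le> D * Osc" using ow D0 by (intro mult_left_mono) auto
            finally show ?thesis
              using ow norm_triangle_sub[of "(ue \<epsilon> x, gu \<epsilon> x)" "U x"] by (simp add: E_def)
          qed
          have ueE: "\<bar>ue \<epsilon> x\<bar> \<le> E" and guE: "norm (gu \<epsilon> x) \<le> E"
            using UE norm_fst_le[of "ue \<epsilon> x" "gu \<epsilon> x"] norm_snd_le[of "gu \<epsilon> x" "ue \<epsilon> x"] by auto
          have LuE: "\<bar>Lu\<bar> \<le> D * (C + Osc)"
          proof -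
            have "\<bar>Lu\<bar> \<le> D * (norm (U x) + os x)"
              unfolding Lu_def os_def by (rule D1[OF e(1) near[OF 2(2)]])
            also have "\<dots> \<le> D * (C + Osc)" using ow D0 by (intro mult_left_mono) auto
            finally show ?thesis .
          qed
          define Lt where "Lt = lin_trace (\<lambda>h. A x *v Ht x h + A' x h *v gt x)"
          have "(\<lambda>h. A x *v Hv x h + A' x h *v gv x) = (\<lambda>h. \<theta> x *\<^sub>R (A x *v Hu \<epsilon> x h + A' x h *v gu \<epsilon> x)
             + (gt x \<bullet> h) *\<^sub>R (A x *v gu \<epsilon> x) + ue \<epsilon> x *\<^sub>R (A x *v Ht x h + A' x h *v gt x) + (gu \<epsilon> x \<bullet> h) *\<^sub>R (A x *v gt x))"
            by (auto simp: Hv_def gv_def matrix_vector_right_distrib matrix_vector_mult_scaleR algebra_simps)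
          moreover have "linear (\<lambda>h. gt x \<bullet> h)" "linear (\<lambda>h. gu \<epsilon> x \<bullet> h)"
            by (auto intro!: linearI simp: inner_add_right)
          ultimately have split: "lin_trace (\<lambda>h. A x *v Hv x h + A' x h *v gv x)
            = \<theta> x * Lu + gt x \<bullet> (A x *v gu \<epsilon> x) + ue \<epsilon> x * Lt + gu \<epsilon> x \<bullet> (A x *v gt x)"
            by (simp only: lin_trace_add lin_trace_scaleR lin_trace_rank1 Lu_def Lt_def)
          have b1: "\<bar>\<theta> x * Lu\<bar> \<le> 1 * (D * (C + Osc))"
            unfolding abs_mult using th(4,5)[of x] LuE by (intro mult_mono) auto
          have b2: "\<bar>gt x \<bullet> (A x *v gu \<epsilon> x)\<bar> \<le> T * (M * E)"
          proof -
            have "norm (A x *v gu \<epsilon> x) \<le> M * E" by (rule order_trans[OF M(2)[OF xb] mult_left_mono[OF guE]]) (use M(1) in simp)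
            then have "norm (gt x) * norm (A x *v gu \<epsilon> x) \<le> T * (M * E)" using T xb by (intro mult_mono) auto
            then show ?thesis using Cauchy_Schwarz_ineq2 order_trans by blast
          qed
          have b4: "\<bar>gu \<epsilon> x \<bullet> (A x *v gt x)\<bar> \<le> E * (M * T)"
          proof -
            have "norm (A x *v gt x) \<le> M * T" by (rule order_trans[OF M(2)[OF xb] mult_left_mono[OF T(2)[OF xb]]]) (use M(1) in simp)
            then have "norm (gu \<epsilon> x) * norm (A x *v gt x) \<le> E * (M * T)" using guE E0 by (intro mult_mono) auto
            then show ?thesis using Cauchy_Schwarz_ineq2 order_trans by blast
          qed
          have "\<bar>Lt\<bar> \<le> DIM(real ^ 'n) * (M * T + M * T)"
            unfolding Lt_def
          proof (rule abs_lin_trace_le)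
            fix h
            have "norm (A x *v Ht x h) \<le> M * (T * norm h)"
              by (rule order_trans[OF M(2)[OF xb] mult_left_mono[OF T(3)[OF xb]]]) (use M(1) in simp)
            moreover have "norm (A' x h *v gt x) \<le> M * norm h * T"
              by (rule order_trans[OF M(3)[OF xb] mult_left_mono[OF T(2)[OF xb]]]) (use M(1) in simp)
            ultimately show "norm (A x *v Ht x h + A' x h *v gt x) \<le> (M * T + M * T) * norm h"
              using norm_triangle_ineq[of "A x *v Ht x h" "A' x h *v gt x"] by (simp add: algebra_simps)
          qed
          then have b3: "\<bar>ue \<epsilon> x * Lt\<bar> \<le> E * (real CARD('n) * (M * T + M * T))"
            unfolding abs_mult using ueE E0 by (intro mult_mono) auto
          have "\<bar>lin_trace (\<lambda>h. A x *v Hv x h + A' x h *v gv x)\<bar> \<le> C2"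
            unfolding split C2_def using b1 b2 b3 b4 by linarith
          then have "\<bar>lin_trace (\<lambda>h. A x *v Hv x h + A' x h *v gv x)\<bar>\<^sup>2 \<le> C2\<^sup>2" by (intro power_mono) auto
          moreover have "(W \<tau> x)\<^sup>2 \<le> (W1 \<tau>)\<^sup>2" using W_out[OF less_imp_le[OF 2(1)] t0] by (intro power_mono) (auto simp: W_def)
          ultimately have "(W \<tau> x)\<^sup>2 * (lin_trace (\<lambda>h. A x *v Hv x h + A' x h *v gv x))\<^sup>2 \<le> (W1 \<tau>)\<^sup>2 * C2\<^sup>2"
            by (intro mult_mono) auto
          also have "\<dots> = \<beta> x"
            using 2 by (simp add: \<beta>_def i1_def i2_def indicator_def dist_norm norm_minus_commute)
          finally show ?thesis .
        next
          case 3
          have "lin_trace (\<lambda>h. A x *v Hv x h + A' x h *v gv x) = 0"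
            using th(7)[of x] 3 by (simp add: Hv_def gv_def lin_trace_def)
          moreover have "0 \<le> \<beta> x" using os0[of x] Osc0 by (simp add: \<beta>_def i1_def i2_def)
          ultimately show ?thesis by simp
        qed
      qed
    qed
    moreover have "(\<integral>x. \<alpha> x \<partial>lborel) = \<tau> / 2 * J \<tau> - \<tau> * D\<^sup>2 * Osc * Os"
      unfolding \<alpha>_def J_def Os_def using Jint[OF t0] Osint by simp
    moreover have "(\<integral>x. \<beta> x \<partial>lborel) = 2 * D\<^sup>2 * J \<tau> + 2 * D\<^sup>2 * Osc * Os + C2\<^sup>2 * (W1 \<tau>)\<^sup>2 * V2"
      unfolding \<beta>_def J_def Os_def V2_def using Jint[OF t0] Osint i2int by simp
    ultimately have "\<tau> / 2 * J \<tau> \<le> Cc * (2 * D\<^sup>2) * J \<tau> + Cc * (C2\<^sup>2 * (W1 \<tau>)\<^sup>2 * V2) + (\<tau> * D\<^sup>2 * Osc + Cc * (2 * D\<^sup>2 * Osc)) * Os"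
      by (simp add: algebra_simps)
    moreover have "(\<tau> * D\<^sup>2 * Osc + Cc * (2 * D\<^sup>2 * Osc)) * Os \<le> (\<tau> * D\<^sup>2 * Osc + Cc * (2 * D\<^sup>2 * Osc)) * (exp (2 * \<tau>) * d)"
      using Os_le t0 Osc0 Cc by (intro mult_left_mono) auto
    ultimately show ?thesis by (simp add: K_def mult.assoc)
  qed

  \<comment> \<open>Here \<epsilon> \<rightarrow> 0 is completed: \<open>d\<close> is arbitrary for
    fixed \<tau>, so the oscillation drops out.\<close>
  have lim: "\<tau> / 2 * J \<tau> \<le> Cc * (2 * D\<^sup>2) * J \<tau> + Cc * (C2\<^sup>2 * (W1 \<tau>)\<^sup>2 * V2)" if tau: "\<tau> \<ge> \<tau>0" for \<tau>
  proof (rule field_le_epsilon)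
    fix e :: real assume e: "0 < e"
    have K0: "K \<tau> \<ge> 0" using tau tau0 Osc0 Cc by (simp add: K_def)
    define d where "d = e / (K \<tau> + 1)"
    have "d > 0" using e K0 by (simp add: d_def)
    from main[OF tau this] have "\<tau> / 2 * J \<tau> \<le> Cc * (2 * D\<^sup>2) * J \<tau> + Cc * (C2\<^sup>2 * (W1 \<tau>)\<^sup>2 * V2) + K \<tau> * d" .
    moreover have "K \<tau> * d \<le> e" using e K0 by (simp add: d_def field_simps)
    ultimately show "\<tau> / 2 * J \<tau> \<le> Cc * (2 * D\<^sup>2) * J \<tau> + Cc * (C2\<^sup>2 * (W1 \<tau>)\<^sup>2 * V2) + e" by linarith
  qed
  \<comment> \<open>From \<open>8 * (Cc * D\<^sup>2)\<close> on, the term to be absorbed is at most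
    half of the left side; afterwards \<open>(W1 \<tau>)\<^sup>2\<close> is cancelled.\<close>
  have J0_le: "\<tau> * J0 \<le> 4 * (Cc * (C2\<^sup>2 * V2))" if tau: "\<tau> \<ge> \<tau>0" "\<tau> \<ge> 8 * (Cc * D\<^sup>2)" for \<tau>
  proof -
    have t0: "\<tau> \<ge> 0" using tau tau0 by simp
    have "0 \<le> J0" unfolding J0_def by (rule integral_nonneg_AE) (simp add: i1_def)
    then have "0 \<le> (W1 \<tau>)\<^sup>2 * J0" by simp
    then have J: "0 \<le> J \<tau>" using J_ge[OF t0] by linarith
    have "8 * (Cc * D\<^sup>2) * J \<tau> \<le> \<tau> * J \<tau>" using tau(2) J by (rule mult_right_mono)
    then have "\<tau> * J \<tau> \<le> 4 * (Cc * (C2\<^sup>2 * (W1 \<tau>)\<^sup>2 * V2))" using lim[OF tau(1)] by simp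
    moreover have "\<tau> * ((W1 \<tau>)\<^sup>2 * J0) \<le> \<tau> * J \<tau>" using J_ge[OF t0] t0 by (rule mult_left_mono)
    ultimately have "(W1 \<tau>)\<^sup>2 * (\<tau> * J0) \<le> (W1 \<tau>)\<^sup>2 * (4 * (Cc * (C2\<^sup>2 * V2)))" by (simp add: mult_ac)
    then show ?thesis using W1[of \<tau>] by simp
  qed
  have "J0 \<le> 0"
  proof (rule ccontr)
    assume "\<not> J0 \<le> 0"
    then have J0: "J0 > 0" by simp
    define \<tau> where "\<tau> = max (max \<tau>0 (8 * (Cc * D\<^sup>2))) (4 * (Cc * (C2\<^sup>2 * V2)) / J0 + 1)"
    have "\<tau> * J0 \<le> 4 * (Cc * (C2\<^sup>2 * V2))" by (rule J0_le) (auto simp: \<tau>_def)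
    moreover have "4 * (Cc * (C2\<^sup>2 * V2)) / J0 < \<tau>" unfolding \<tau>_def by linarith
    ultimately show False using J0 by (simp add: field_simps)
  qed
  moreover have "J0 \<ge> 0" unfolding J0_def by (rule integral_nonneg_AE) (simp add: i1_def)
  ultimately have "J0 = 0" by simp
  then have "AE x in lborel. i1 x * (norm (U x))\<^sup>2 = 0"
    using integral_nonneg_eq_0_iff_AE[OF J0int] by (simp add: J0_def i1_def)
  then show "AE z in lborel. z \<in> cball y R1 \<longrightarrow> u z = 0"
    by eventually_elim (auto simp: i1_def indicator_def U_def zero_prod_def split: if_splits)
  qed
qed

theorem unique_continuation_ball:
  assumes r: "0 < r" and u0: "AE z in lborel. z \<in> ball y r \<longrightarrow> u z = 0"
  shows "AE z in lborel. z \<in> ball y R \<longrightarrow> u z = 0"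
proof -
  \<comment> \<open>Radii increasing to \<open>R\<close>; the summand 2 instead of 1 keeps
    \<open>q 0\<close> positive.\<close>
  define q where "q n = R - R / (real n + 2)" for n
  have q: "0 < q n" "q n < R" for n
  proof -
    have "R / (real n + 2) < R / 1" using R by (intro divide_strict_left_mono) auto
    then show "0 < q n" "q n < R" using R by (auto simp: q_def)
  qed
  have "AE z in lborel. \<forall>n. z \<in> cball y (q n) \<longrightarrow> u z = 0"
    unfolding AE_all_countable using unique_continuation_smaller_ball[OF r q u0] by blast
  then show ?thesis
  proof eventually_elim
    fix z assume z: "\<forall>n. z \<in> cball y (q n) \<longrightarrow> u z = 0"
    show "z \<in> ball y R \<longrightarrow> u z = 0"
    proof
      assume "z \<in> ball y R"
      then have d: "R - dist y z > 0" by simp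
      obtain n where n: "R / (R - dist y z) < real n" using reals_Archimedean2 by blast
      then have "R < real n * (R - dist y z)" using d by (simp add: pos_divide_less_eq)
      also have "\<dots> \<le> (real n + 2) * (R - dist y z)" using d by (intro mult_right_mono) auto
      finally have "R / (real n + 2) < R - dist y z" by (simp add: divide_less_eq mult.commute)
      then have "z \<in> cball y (q n)" by (simp add: q_def)
      then show "u z = 0" using z by blast
    qed
  qed
qed

end

section \<open>The fundamental lemma and uniqueness of weak derivatives\<close>

lemma test_functionI:
  assumes "smooth \<phi>" "\<And>x. x \<notin> cball y r \<Longrightarrow> \<phi> x = 0" "cball y r \<subseteq> \<Omega>"
  shows "test_function \<Omega> \<phi>"
proof -
  have "{x. \<phi> x \<noteq> 0} \<subseteq> cball y r" using assms(2) by blast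
  then have "closure {x. \<phi> x \<noteq> 0} \<subseteq> cball y r" by (intro closure_minimal) auto
  moreover from this have "compact (closure {x. \<phi> x \<noteq> 0})"
    using compact_cball closed_closure by (metis compact_Int_closed inf.absorb_iff2)
  ultimately show ?thesis using assms unfolding test_function_def smooth_def by blast
qed

section \<open>From Lebesgue measurable data to Borel representatives\<close>

lemma borel_version:
  fixes f :: "'a::euclidean_space \<Rightarrow> real"
  assumes f: "f \<in> borel_measurable (lebesgue_on S)" and S: "S \<in> sets lebesgue"
  obtains g where "g \<in> borel_measurable borel" "AE x in lborel. x \<in> S \<longrightarrow> f x = g x"
proof -
  have "(\<lambda>x. if x \<in> S then f x else 0) \<in> borel_measurable lebesgue"
    by (rule borel_measurable_if_I[OF f S])
  from completion_ex_borel_measurable_real[OF this] obtain g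
    where g: "g \<in> borel_measurable lborel" "AE x in lborel. (if x \<in> S then f x else 0) = g x" by blast
  have "AE x in lborel. x \<in> S \<longrightarrow> f x = g x" using g(2) by eventually_elim auto
  then show ?thesis using that[of g] g(1) by simp
qed

text \<open>Only the representative \<open>g\<close> is known to be measurable; completeness of
  Lebesgue measure passes measurability on to the extension of \<open>f\<close> by zero.\<close>

lemma integral_lebesgue_on_eq:
  fixes f g :: "'a::euclidean_space \<Rightarrow> real"
  assumes S: "S \<in> sets lebesgue" and g: "g \<in> borel_measurable borel"
    and eq: "AE x in lborel. (if x \<in> S then f x else 0) = g x"
  shows "(\<integral>x. f x \<partial>lebesgue_on S) = (\<integral>x. g x \<partial>lborel)"
proof -
  have g': "g \<in> borel_measurable lebesgue" using g by (simp add: measurable_completion)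
  have ae: "AE x in lebesgue. g x = (if x \<in> S then f x else 0)"
    using AE_completion[OF eq] by eventually_elim simp
  have m: "(\<lambda>x. if x \<in> S then f x else 0) \<in> borel_measurable lebesgue"
    by (rule borel_measurable_AE[OF g' ae])
  have "(\<integral>x. f x \<partial>lebesgue_on S) = (\<integral>x. indicator S x *\<^sub>R f x \<partial>lebesgue)"
    using S by (intro integral_restrict_space) auto
  also have "\<dots> = (\<integral>x. (if x \<in> S then f x else 0) \<partial>lebesgue)"
    by (intro Bochner_Integration.integral_cong) (auto simp: indicator_def)
  also have "\<dots> = (\<integral>x. g x \<partial>lebesgue)"
    using ae by (intro integral_cong_AE m g') auto
  also have "\<dots> = (\<integral>x. g x \<partial>lborel)" using g by (intro integral_completion) simp
  finally show ?thesis .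
qed

lemma AE_lebesgue_on_iff:
  "S \<in> sets lebesgue \<Longrightarrow> (AE x in lebesgue_on S. P x) \<longleftrightarrow> (AE x in lborel. x \<in> S \<longrightarrow> P x)"
  by (subst AE_restrict_space_iff) (auto simp: AE_completion_iff)

text \<open>Uncountably many exceptional null sets are reduced to countably many by the Lindelof
  property.\<close>

lemma AE_locally:
  fixes \<Omega> :: "'a::euclidean_space set"
  assumes "\<And>x. x \<in> \<Omega> \<Longrightarrow> \<exists>r>0. AE z in lborel. z \<in> ball x r \<longrightarrow> P z"
  shows "AE z in lborel. z \<in> \<Omega> \<longrightarrow> P z"
proof -
  define \<F> where "\<F> = {B. \<exists>x r. B = ball x r \<and> (AE z in lborel. z \<in> ball (x::'a) r \<longrightarrow> P z)}"
  obtain \<G> where G: "\<G> \<subseteq> \<F>" "countable \<G>" "\<Union>\<G> = \<Union>\<F>"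
    using Lindelof[of \<F>] by (auto simp: \<F>_def)
  have "AE z in lborel. \<forall>B\<in>\<G>. z \<in> B \<longrightarrow> P z"
    using G(1) by (intro AE_ball_countable' G(2)) (auto simp: \<F>_def)
  then show ?thesis
  proof eventually_elim
    fix z assume z: "\<forall>B\<in>\<G>. z \<in> B \<longrightarrow> P z"
    show "z \<in> \<Omega> \<longrightarrow> P z"
    proof
      assume "z \<in> \<Omega>"
      from assms[OF this] obtain r where r: "r > 0" "AE x in lborel. x \<in> ball z r \<longrightarrow> P x" by blast
      then have "ball z r \<in> \<F>" unfolding \<F>_def by blast
      moreover have "z \<in> ball z r" using r(1) by simp
      ultimately have "z \<in> \<Union>\<G>" unfolding G(3) by blast
      then show "P z" using z by blast
    qed
  qed
qed

lemma partials_conv: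
  fixes f :: "real ^ 'n \<Rightarrow> real"
  assumes f: "bounded_compact_support f C a r" and k: "mollifying_kernel k"
  shows "partials \<alpha> (conv k f) = conv (partials \<alpha> k) f \<and> mollifying_kernel (partials \<alpha> k)"
proof (induction \<alpha>)
  case (Cons i \<alpha>)
  then have m: "mollifying_kernel (partials \<alpha> k)" by blast
  have "partial i (conv (partials \<alpha> k) f) = conv (partial i (partials \<alpha> k)) f"
    by (rule ext) (simp add: partial_eqI[OF has_derivative_conv[OF f m]] inner_axis)
  then show ?case using Cons mollifying_kernel_partial[OF m] by (simp add: partials_Cons)
qed (use k in simp)

lemma smooth_conv:
  fixes f :: "real ^ 'n \<Rightarrow> real"
  assumes f: "bounded_compact_support f C a r" and k: "mollifying_kernel k"
  shows "smooth (conv k f)"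
  unfolding smooth_def differentiable_def
  using partials_conv[OF f k] has_derivative_conv[OF f] by metis

lemma conv_mollifier_eq_0:
  fixes f :: "real ^ 'n \<Rightarrow> real"
  assumes f: "bounded_compact_support f C a r" and e: "\<epsilon> > 0" and x: "x \<notin> cball a (r + \<epsilon>)"
  shows "conv (mollifier \<epsilon>) f x = 0"
proof -
  have "mollifier \<epsilon> (x - z) *\<^sub>R f z = 0" for z
  proof (cases "z \<in> cball a r")
    case True
    then have "norm (x - z) \<ge> \<epsilon>" using x norm_triangle_ineq[of "a - z" "z - x"] by (simp add: dist_norm norm_minus_commute)
    then show ?thesis using partials_mollifier_eq_0[OF e, of "x - z" "[]"] by simp
  qed (use bounded_compact_support.supp[OF f] in simp)
  then show ?thesis unfolding conv_def by (intro integral_eq_zero_AE AE_I2)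
qed

text \<open>Half of the radius is given up to leave room for the supports of the test functions.
  These converge only in the mean, so a subsequence converging almost everywhere is taken before
  dominated convergence with the bound \<open>B * \<bar>w x\<bar>\<close>; the limit is the integral
  of \<bar>h\<bar> over the smaller ball.\<close>

lemma fundamental_lemma_local:
  fixes h :: "real ^ 'n \<Rightarrow> real"
  assumes h: "integrable (lebesgue_on (cball x0 \<rho>)) h" and rho: "\<rho> > 0" and sub: "cball x0 \<rho> \<subseteq> \<Omega>" and Om: "\<Omega> \<in> sets lebesgue"
    and t: "\<And>\<phi>. test_function \<Omega> \<phi> \<Longrightarrow> (\<integral>x. h x * \<phi> x \<partial>lebesgue_on \<Omega>) = 0"
  shows "AE z in lborel. z \<in> ball x0 (\<rho> / 2) \<longrightarrow> h z = 0"
proof -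
  let ?K = "cball x0 \<rho>"
  obtain g where g [measurable]: "g \<in> borel_measurable borel" and ge: "AE x in lborel. x \<in> ?K \<longrightarrow> h x = g x"
    using borel_version[OF borel_measurable_integrable[OF h]] by auto
  have [measurable]: "?K \<in> sets borel" "cball x0 (\<rho> / 2) \<in> sets borel" by auto
  define w where "w x = indicator ?K x * g x" for x
  have wm [measurable]: "w \<in> borel_measurable borel" unfolding w_def by measurable
  have wint: "integrable lborel w"
  proof -
    have i: "integrable lebesgue (\<lambda>x. indicator ?K x *\<^sub>R h x)"
      using h by (subst (asm) integrable_restrict_space) auto
    have "AE x in lebesgue. indicator ?K x *\<^sub>R h x = w x"
      using AE_completion[OF ge] by eventually_elim (auto simp: w_def indicator_def)
    moreover have "w \<in> borel_measurable lebesgue" using wm by (simp add: measurable_completion)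
    ultimately have "integrable lebesgue w" using integrable_cong_AE_imp[OF i] by (metis (mono_tags, lifting) AE_cong)
    then show ?thesis using wm by (simp add: integrable_completion)
  qed
  \<comment> \<open>Test functions tending to the sign of \<open>h\<close> on a smaller ball: \<open>h\<close> is not known to be bounded, so
    it is the test function and not \<open>h\<close> that is mollified.\<close>
  define s where "s x = indicator (cball x0 (\<rho> / 2)) x * sgn (w x)" for x
  have s: "bounded_compact_support s 1 x0 (\<rho> / 2)"
  proof
    show "s \<in> borel_measurable borel" unfolding s_def by measurable
  qed (auto simp: s_def indicator_def sgn_real_def)
  interpret sb: bounded_compact_support s 1 x0 "\<rho> / 2" by (rule s)
  obtain M0 where M0: "M0 \<ge> 0" "\<And>\<epsilon> x. \<epsilon> > 0 \<Longrightarrow> \<bar>(mollifier \<epsilon> :: real ^ 'n \<Rightarrow> real) x\<bar> \<le> M0 / \<epsilon> ^ CARD('n)"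
    using partials_mollifier_bound[of "[] :: 'n list"] by auto
  \<comment> \<open>At most \<rho> / 4, so that mollifying a function supported in the ball of
    radius \<rho> / 2 stays within radius \<rho>.\<close>
  define \<epsilon> where "\<epsilon> n = \<rho> / 4 * inverse (real (Suc n))" for n
  have e: "\<epsilon> n > 0" "\<epsilon> n \<le> \<rho> / 4" for n
  proof -
    show "\<epsilon> n > 0" using rho by (simp add: \<epsilon>_def)
    have "\<rho> / 4 * inverse (real (Suc n)) \<le> \<rho> / 4 * 1" using rho by (intro mult_left_mono) (auto simp: inverse_eq_divide)
    then show "\<epsilon> n \<le> \<rho> / 4" by (simp add: \<epsilon>_def)
  qed
  define \<phi> where "\<phi> n = conv (mollifier (\<epsilon> n)) s" for n
  have mk: "mollifying_kernel (mollifier (\<epsilon> n) :: real ^ 'n \<Rightarrow> real)" for n by (rule mollifying_kernel_mollifier[OF e(1)])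
  have sm: "smooth (\<phi> n)" for n unfolding \<phi>_def by (rule smooth_conv[OF s mk])
  have phm [measurable]: "\<phi> n \<in> borel_measurable borel" for n
    by (rule borel_measurable_continuous_onI[OF smooth_continuous[OF sm]])
  have out: "\<phi> n x = 0" if "x \<notin> ?K" for n x
    unfolding \<phi>_def by (rule conv_mollifier_eq_0[OF s e(1)]) (use that e(2)[of n] rho in auto)
  have close: "\<bar>\<phi> n x - s x\<bar> \<le> M0 * oscillation (\<epsilon> n) s x" for n x
    unfolding \<phi>_def conv_def real_norm_def[symmetric]
    by (rule sb.kernel_oscillation[OF e(1) kernel_continuous[OF mk] _ _ integral_mollifier[OF e(1)]])
       (use M0(2)[OF e(1)] partials_mollifier_eq_0[OF e(1), of _ _ "[]", OF less_imp_le] in auto)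
  define B where "B = 1 + M0 * (2 * unit_ball_vol (real CARD('n)))"
  have pb: "\<bar>\<phi> n x\<bar> \<le> B" for n x
  proof -
    have "M0 * oscillation (\<epsilon> n) s x \<le> M0 * (2 * unit_ball_vol (real CARD('n)))"
      using sb.oscillation_le[OF e(1)[of n], of x] M0(1) by (intro mult_left_mono) auto
    then show ?thesis using close[of n x] sb.bound[of x] unfolding B_def real_norm_def by linarith
  qed
  have phint: "integrable lborel (\<phi> n)" for n
    by (rule integrable_lborel_bounded_support[OF phm, where C=B and a=x0 and r=\<rho>]) (use pb out in auto)
  have zero: "(\<integral>x. w x * \<phi> n x \<partial>lborel) = 0" for n
  proof -
    have "test_function \<Omega> (\<phi> n)" by (rule test_functionI[OF sm out sub])
    from t[OF this] have "(\<integral>x. h x * \<phi> n x \<partial>lebesgue_on \<Omega>) = 0" .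
    moreover have "(\<integral>x. h x * \<phi> n x \<partial>lebesgue_on \<Omega>) = (\<integral>x. w x * \<phi> n x \<partial>lborel)"
    proof (rule integral_lebesgue_on_eq[OF Om])
      show "(\<lambda>x. w x * \<phi> n x) \<in> borel_measurable borel" by measurable
      show "AE x in lborel. (if x \<in> \<Omega> then h x * \<phi> n x else 0) = w x * \<phi> n x"
        using ge
      proof eventually_elim
        fix x assume x: "x \<in> ?K \<longrightarrow> h x = g x"
        show "(if x \<in> \<Omega> then h x * \<phi> n x else 0) = w x * \<phi> n x"
        proof (cases "x \<in> ?K")
          case True
          then have "x \<in> \<Omega>" using sub by blast
          then show ?thesis using True x by (simp add: w_def)
        qed (use out in simp)
      qed
    qed
    ultimately show ?thesis by simp
  qed
  have "(\<lambda>n. \<integral>x. norm (\<phi> n x - s x) \<partial>lborel) \<longlonglongrightarrow> 0"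
  proof (rule LIMSEQ_I)
    fix d :: real assume d: "0 < d"
    define d' where "d' = d / (M0 + 1) / 2"
    have d': "d' > 0" "M0 * d' < d"
    proof -
      show "d' > 0" using d M0(1) by (simp add: d'_def)
      have "M0 * d' \<le> (M0 + 1) * d'" using \<open>d' > 0\<close> by (simp add: algebra_simps)
      also have "\<dots> = d / 2" using M0(1) unfolding d'_def by (simp add: nonzero_divide_eq_eq field_simps)
      finally show "M0 * d' < d" using d by simp
    qed
    obtain \<delta> where del: "\<delta> > 0" "\<And>\<epsilon>. 0 < \<epsilon> \<Longrightarrow> \<epsilon> \<le> \<delta> \<Longrightarrow>
      integrable lborel (oscillation \<epsilon> s) \<and> (\<integral>x. oscillation \<epsilon> s x \<partial>lborel) \<le> d'"
      using sb.integral_oscillation_small[OF d'(1)] by blast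
    have "\<epsilon> \<longlonglongrightarrow> \<rho> / 4 * 0" unfolding \<epsilon>_def by (intro tendsto_mult tendsto_const LIMSEQ_inverse_real_of_nat)
    then have "\<forall>\<^sub>F n in sequentially. \<epsilon> n < \<delta>" using del(1) by (intro order_tendstoD(2)[where y=0]) auto
    then obtain N where N: "\<And>n. n \<ge> N \<Longrightarrow> \<epsilon> n < \<delta>" by (auto simp: eventually_sequentially)
    show "\<exists>no. \<forall>n\<ge>no. norm ((\<integral>x. norm (\<phi> n x - s x) \<partial>lborel) - 0) < d"
    proof (intro exI[of _ N] allI impI)
      fix n assume "n \<ge> N"
      then have os: "integrable lborel (oscillation (\<epsilon> n) s)" "(\<integral>x. oscillation (\<epsilon> n) s x \<partial>lborel) \<le> d'"
        using del(2)[OF e(1)[of n]] N[of n] by auto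
      have "(\<integral>x. norm (\<phi> n x - s x) \<partial>lborel) \<le> (\<integral>x. M0 * oscillation (\<epsilon> n) s x \<partial>lborel)"
        using close by (intro integral_mono integrable_norm Bochner_Integration.integrable_diff phint sb.integrable integrable_mult_right os) auto
      also have "\<dots> \<le> M0 * d'" using os(2) M0(1) by (simp add: mult_left_mono)
      also have "\<dots> < d" by (rule d')
      finally show "norm ((\<integral>x. norm (\<phi> n x - s x) \<partial>lborel) - 0) < d" by simp
    qed
  qed
  then obtain q where q: "AE x in lborel. (\<lambda>n. \<phi> (q n) x - s x) \<longlonglongrightarrow> 0"
    using tendsto_L1_AE_subseq[of lborel "\<lambda>n x. \<phi> n x - s x"] phint sb.integrable by auto
  have "(\<lambda>n. \<integral>x. w x * \<phi> (q n) x \<partial>lborel) \<longlonglongrightarrow> (\<integral>x. w x * s x \<partial>lborel)"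
  proof (rule integral_dominated_convergence[where w="\<lambda>x. B * \<bar>w x\<bar>"])
    show "integrable lborel (\<lambda>x. B * \<bar>w x\<bar>)" using wint by simp
    show "AE x in lborel. (\<lambda>n. w x * \<phi> (q n) x) \<longlonglongrightarrow> w x * s x"
      using q by eventually_elim (intro tendsto_mult tendsto_const, simp add: LIM_zero_iff)
    show "AE x in lborel. norm (w x * \<phi> (q n) x) \<le> B * \<bar>w x\<bar>" for n
    proof (rule AE_I2)
      fix x
      show "norm (w x * \<phi> (q n) x) \<le> B * \<bar>w x\<bar>"
        using mult_left_mono[OF pb[of "q n" x], of "\<bar>w x\<bar>"] by (simp add: abs_mult mult.commute)
    qed
  qed (use sb.meas in measurable)
  then have "(\<integral>x. w x * s x \<partial>lborel) = 0" unfolding zero by (simp add: LIMSEQ_const_iff)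
  moreover have ws: "w x * s x = indicator (cball x0 (\<rho> / 2)) x * \<bar>w x\<bar>" for x
    by (simp add: s_def abs_sgn)
  have wi: "integrable lborel (\<lambda>x. indicator (cball x0 (\<rho> / 2)) x * \<bar>w x\<bar>)"
    by (rule Bochner_Integration.integrable_bound[OF wint]) (auto simp: indicator_def)
  ultimately have "AE x in lborel. indicator (cball x0 (\<rho> / 2)) x * \<bar>w x\<bar> = 0"
    using integral_nonneg_eq_0_iff_AE[OF wi] unfolding ws by simp
  then show ?thesis using ge
  proof eventually_elim
    fix z assume a: "indicator (cball x0 (\<rho> / 2)) z * \<bar>w z\<bar> = 0" and b: "z \<in> ?K \<longrightarrow> h z = g z"
    show "z \<in> ball x0 (\<rho> / 2) \<longrightarrow> h z = 0"
    proof
      assume z: "z \<in> ball x0 (\<rho> / 2)"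
      then have "z \<in> cball x0 (\<rho> / 2)" "z \<in> ?K" using rho by auto
      then show "h z = 0" using a b by (simp add: w_def)
    qed
  qed
qed

lemma locally_integrable_test_function:
  fixes v :: "real ^ 'n \<Rightarrow> real"
  assumes v: "locally_integrable \<Omega> v" and t: "test_function \<Omega> \<phi>" and Om: "\<Omega> \<in> sets lebesgue"
  shows "integrable (lebesgue_on \<Omega>) (\<lambda>x. v x * \<phi> x)"
proof -
  define K where "K = closure {x. \<phi> x \<noteq> 0}"
  have K: "compact K" "K \<subseteq> \<Omega>" and sm: "smooth \<phi>"
    using t by (auto simp: test_function_def K_def smooth_def)
  have Ks: "K \<in> sets lebesgue" using K(1) by (simp add: borel_compact)
  have out: "\<phi> x = 0" if "x \<notin> K" for x using that closure_subset[of "{x. \<phi> x \<noteq> 0}"] by (auto simp: K_def)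
  have vK: "integrable (lebesgue_on K) v" using v K by (auto simp: locally_integrable_def)
  have "bounded (\<phi> ` K)"
    using smooth_continuous[OF sm] K(1) by (intro compact_imp_bounded compact_continuous_image) (auto intro: continuous_on_subset)
  then obtain B where B: "\<And>x. x \<in> K \<Longrightarrow> \<bar>\<phi> x\<bar> \<le> B" unfolding bounded_iff by force
  have pm: "\<phi> \<in> borel_measurable (lebesgue_on K)"
    using borel_measurable_continuous_onI[OF smooth_continuous[OF sm]]
    by (intro measurable_restrict_space1 measurable_completion) simp
  have "integrable (lebesgue_on K) (\<lambda>x. v x * \<phi> x)"
  proof (rule Bochner_Integration.integrable_bound)
    show "integrable (lebesgue_on K) (\<lambda>x. B * v x)" using vK by simp
    show "(\<lambda>x. v x * \<phi> x) \<in> borel_measurable (lebesgue_on K)"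
      using vK pm by (intro borel_measurable_times) auto
    show "AE x in lebesgue_on K. norm (v x * \<phi> x) \<le> norm (B * v x)"
    proof (rule AE_I2)
      fix x assume "x \<in> space (lebesgue_on K)"
      then have "\<bar>\<phi> x\<bar> \<le> \<bar>B\<bar>" using B[of x] by (simp add: space_restrict_space)
      then show "norm (v x * \<phi> x) \<le> norm (B * v x)"
        using mult_left_mono[of "\<bar>\<phi> x\<bar>" "\<bar>B\<bar>" "\<bar>v x\<bar>"] by (simp add: abs_mult mult.commute)
    qed
  qed
  then have "integrable lebesgue (\<lambda>x. indicator K x *\<^sub>R (v x * \<phi> x))"
    using Ks by (subst (asm) integrable_restrict_space) auto
  moreover have "(\<lambda>x. indicator K x *\<^sub>R (v x * \<phi> x)) = (\<lambda>x. indicator \<Omega> x *\<^sub>R (v x * \<phi> x))"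
    using out K(2) by (auto simp: indicator_def fun_eq_iff)
  ultimately show ?thesis using Om by (subst integrable_restrict_space) auto
qed

text \<open>\<open>weak_gradient\<close> is an arbitrary choice among the weak gradients, and the
  bounds in \<open>mem_W1inf\<close> may concern another one; uniqueness transfers them.\<close>

lemma weak_deriv_unique:
  fixes u v1 v2 :: "real ^ 'n \<Rightarrow> real"
  assumes Om: "open \<Omega>" and v: "has_weak_deriv \<Omega> \<alpha> u v1" "has_weak_deriv \<Omega> \<alpha> u v2"
  shows "AE x in lborel. x \<in> \<Omega> \<longrightarrow> v1 x = v2 x"
proof (rule AE_locally)
  have Oms: "\<Omega> \<in> sets lebesgue" using Om by simp
  fix x assume "x \<in> \<Omega>"
  with Om[unfolded open_contains_cball] obtain \<rho> where rho: "\<rho> > 0" "cball x \<rho> \<subseteq> \<Omega>" by blast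
  have "compact (cball x \<rho>)" by (rule compact_cball)
  with rho(2) v have li: "integrable (lebesgue_on (cball x \<rho>)) v1" "integrable (lebesgue_on (cball x \<rho>)) v2"
    unfolding has_weak_deriv_def locally_integrable_def by blast+
  have "AE z in lborel. z \<in> ball x (\<rho> / 2) \<longrightarrow> v1 z - v2 z = 0"
  proof (rule fundamental_lemma_local[OF _ rho Oms])
    show "integrable (lebesgue_on (cball x \<rho>)) (\<lambda>z. v1 z - v2 z)"
      by (rule Bochner_Integration.integrable_diff[OF li])
    fix \<phi> assume t: "test_function \<Omega> \<phi>"
    have w: "locally_integrable \<Omega> v'"
      "(\<integral>x. u x * partials \<alpha> \<phi> x \<partial>lebesgue_on \<Omega>) = (-1) ^ length \<alpha> * (\<integral>x. v' x * \<phi> x \<partial>lebesgue_on \<Omega>)"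
      if "has_weak_deriv \<Omega> \<alpha> u v'" for v' using that t by (simp_all add: has_weak_deriv_def)
    have "(\<integral>x. v1 x * \<phi> x \<partial>lebesgue_on \<Omega>) = (\<integral>x. v2 x * \<phi> x \<partial>lebesgue_on \<Omega>)"
      using w(2)[OF v(1)] w(2)[OF v(2)] by simp
    moreover note locally_integrable_test_function[OF w(1)[OF v(1)] t Oms]
      locally_integrable_test_function[OF w(1)[OF v(2)] t Oms]
    ultimately show "(\<integral>x. (v1 x - v2 x) * \<phi> x \<partial>lebesgue_on \<Omega>) = 0"
      by (simp add: left_diff_distrib)
  qed
  then show "\<exists>r>0. AE z in lborel. z \<in> ball x r \<longrightarrow> v1 z = v2 z"
    using rho(1) by (intro exI[of _ "\<rho> / 2"]) simp
qed

section \<open>Propagation through the domain\<close>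

lemma partial_eq_0_outside:
  assumes "\<And>x. x \<notin> cball y r \<Longrightarrow> \<phi> x = 0" "x \<notin> cball y r"
  shows "partial i \<phi> x = 0"
proof -
  have "((\<lambda>x. 0) has_derivative (\<lambda>h. 0)) (at x)" by simp
  moreover have "open (- cball y r)" by (simp add: open_Compl)
  moreover have "x \<in> - cball y r" using assms(2) by simp
  ultimately have "(\<phi> has_derivative (\<lambda>h. 0)) (at x)"
    by (rule has_derivative_transform_within_open) (use assms(1) in auto)
  from partial_eqI[OF this] show ?thesis .
qed

text \<open>The bounds come from the continuous extensions of the function and its first derivatives
  to the closure, which is compact because \<Omega> is bounded.\<close>

lemma Ck1_closure_bdiff_on:
  fixes f :: "real ^ 'n \<Rightarrow> real"
  assumes f: "Ck1_closure k \<Omega> f" and k: "k \<ge> 1" and b: "bounded \<Omega>"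
  shows "bdiff_on \<Omega> f (\<lambda>x h. grad f x \<bullet> h)"
proof -
  have bnd: "\<exists>B. \<forall>x\<in>\<Omega>. \<bar>partials \<alpha> f x\<bar> \<le> B" if "length \<alpha> \<le> k" for \<alpha>
  proof -
    have "\<forall>\<alpha>. length \<alpha> \<le> k \<longrightarrow> (\<exists>g. continuous_on (closure \<Omega>) g \<and> (\<forall>x\<in>\<Omega>. g x = partials \<alpha> f x))"
      using f unfolding Ck1_closure_def by (elim conjE)
    with that obtain g where g: "continuous_on (closure \<Omega>) g" "\<And>x. x \<in> \<Omega> \<Longrightarrow> g x = partials \<alpha> f x"
      by meson
    have "bounded (g ` closure \<Omega>)"
      using g(1) b by (intro compact_imp_bounded compact_continuous_image) (auto simp: compact_closure)
    then obtain B where "\<And>x. x \<in> closure \<Omega> \<Longrightarrow> \<bar>g x\<bar> \<le> B" unfolding bounded_iff by force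
    then show ?thesis using g(2) closure_subset by (metis subsetD)
  qed
  obtain B where B: "\<And>x. x \<in> \<Omega> \<Longrightarrow> \<bar>f x\<bar> \<le> B" using bnd[of "[]"] by auto
  have "\<exists>B. \<forall>x\<in>\<Omega>. \<bar>partial i f x\<bar> \<le> B" for i using bnd[of "[i]"] k by (simp add: partials_Cons)
  then obtain D where D: "\<And>i x. x \<in> \<Omega> \<Longrightarrow> \<bar>partial i f x\<bar> \<le> D i" by metis
  show ?thesis
  proof (rule bdiff_onI[where B=B and C="\<Sum>i\<in>UNIV. D i"])
    fix x h assume x: "x \<in> \<Omega>"
    have "f differentiable (at x)" using f k x unfolding Ck1_closure_def by (metis list.size(3) partials_Nil less_le_trans less_one)
    then show "(f has_derivative (\<lambda>h. grad f x \<bullet> h)) (at x)" by (rule has_derivative_partials)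
    show "norm (f x) \<le> B" using B[OF x] by simp
    have "\<bar>grad f x \<bullet> h\<bar> \<le> norm (grad f x) * norm h" by (rule Cauchy_Schwarz_ineq2)
    also have "\<dots> \<le> (\<Sum>i\<in>UNIV. D i) * norm h"
      by (intro mult_right_mono order_trans[OF norm_le_l1_cart] sum_mono) (use D[OF x] in auto)
    finally show "norm (grad f x \<bullet> h) \<le> (\<Sum>i\<in>UNIV. D i) * norm h" by simp
  qed
qed

text \<open>The given functions are determined up to null sets. Borel representatives satisfying all
  bounds at every point put them into the form required by \<open>weak_solution_ball\<close>, and
  the closed ball inside \<Omega> lets its test functions serve on \<Omega>.\<close>

lemma unique_continuation_step:
  fixes A :: "real ^ 'n \<Rightarrow> real ^ 'n ^ 'n" and u F :: "real ^ 'n \<Rightarrow> real" and G :: "real ^ 'n \<Rightarrow> real ^ 'n"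
  assumes Om: "open \<Omega>" and A: "bdiff_on \<Omega> A A'" and kappa: "\<kappa> > 0"
    and sym: "\<And>x g h. x \<in> \<Omega> \<Longrightarrow> (A x *v g) \<bullet> h = g \<bullet> (A x *v h)"
    and ell: "\<And>x g. x \<in> \<Omega> \<Longrightarrow> (norm g)\<^sup>2 \<le> \<kappa> * ((A x *v g) \<bullet> g)"
    and G: "\<And>i. has_weak_deriv \<Omega> [i] u (\<lambda>x. G x $ i)"
    and F: "locally_integrable \<Omega> F"
    and eq: "\<And>\<phi>. test_function \<Omega> \<phi> \<Longrightarrow>
      (\<integral>x. (A x *v G x) \<bullet> grad \<phi> x \<partial>lebesgue_on \<Omega>) = (\<integral>x. F x * \<phi> x \<partial>lebesgue_on \<Omega>)"
    and C: "C \<ge> 0" "L \<ge> 0"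
    and bnd: "AE x in lborel. x \<in> \<Omega> \<longrightarrow> norm (u x, G x) \<le> C \<and> \<bar>F x\<bar> \<le> L * norm (u x, G x)"
    and R: "R > 0" "cball y R \<subseteq> \<Omega>" and r: "r > 0" and u0: "AE z in lborel. z \<in> ball y r \<longrightarrow> u z = 0"
  shows "AE z in lborel. z \<in> ball y R \<longrightarrow> u z = 0"
proof -
  let ?K = "cball y R"
  have Oms: "\<Omega> \<in> sets lebesgue" using Om by simp
  have sub: "ball y R \<subseteq> \<Omega>" using R(2) ball_subset_cball by blast
  have K: "compact ?K" "?K \<in> sets lebesgue" by auto
  have li: "integrable (lebesgue_on ?K) u" "\<And>i. integrable (lebesgue_on ?K) (\<lambda>x. G x $ i)" "integrable (lebesgue_on ?K) F"
    using G F R(2) K(1) unfolding has_weak_deriv_def locally_integrable_def by blast+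
  obtain u1 where u1 [measurable]: "u1 \<in> borel_measurable borel" and u1e: "AE x in lborel. x \<in> ?K \<longrightarrow> u x = u1 x"
    by (rule borel_version[OF borel_measurable_integrable[OF li(1)] K(2)])
  obtain F1 where F1 [measurable]: "F1 \<in> borel_measurable borel" and F1e: "AE x in lborel. x \<in> ?K \<longrightarrow> F x = F1 x"
    by (rule borel_version[OF borel_measurable_integrable[OF li(3)] K(2)])
  have "\<forall>i. \<exists>g. g \<in> borel_measurable borel \<and> (AE x in lborel. x \<in> ?K \<longrightarrow> G x $ i = g x)"
  proof
    fix i
    obtain g where "g \<in> borel_measurable borel" "AE x in lborel. x \<in> ?K \<longrightarrow> G x $ i = g x"
      by (rule borel_version[OF borel_measurable_integrable[OF li(2)[of i]] K(2)])
    then show "\<exists>g. g \<in> borel_measurable borel \<and> (AE x in lborel. x \<in> ?K \<longrightarrow> G x $ i = g x)" by blast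
  qed
  from choice[OF this] obtain g1
    where "\<forall>i. g1 i \<in> borel_measurable borel \<and> (AE x in lborel. x \<in> ?K \<longrightarrow> G x $ i = g1 i x)" ..
  then have g1: "\<And>i. g1 i \<in> borel_measurable borel" and g1e: "\<And>i. AE x in lborel. x \<in> ?K \<longrightarrow> G x $ i = g1 i x"
    by auto
  define G1 where "G1 x = (\<chi> i. g1 i x)" for x
  have G1 [measurable]: "G1 \<in> borel_measurable borel"
    unfolding borel_measurable_euclidean_space[of G1] by (auto simp: Basis_vec_def inner_axis G1_def g1)
  have G1e: "AE x in lborel. x \<in> ?K \<longrightarrow> G x = G1 x"
  proof -
    have "AE x in lborel. \<forall>i. x \<in> ?K \<longrightarrow> G x $ i = g1 i x" unfolding AE_all_countable using g1e by blast
    then show ?thesis by eventually_elim (simp add: vec_eq_iff G1_def)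
  qed
  \<comment> \<open>Restricting to the points where the representatives obey the bounds loses only a
    null set of the ball, makes the bounds hold everywhere and yields the extension by zero.\<close>
  define S where "S = {x. x \<in> ball y R \<and> norm (u1 x, G1 x) \<le> C \<and> \<bar>F1 x\<bar> \<le> L * norm (u1 x, G1 x)}"
  have nm [measurable]: "(\<lambda>x. norm (u1 x, G1 x)) \<in> borel_measurable borel"
    unfolding norm_prod_def by measurable
  have [measurable]: "ball y R \<in> sets borel" by simp
  have S [measurable]: "S \<in> sets borel" unfolding S_def by measurable
  define u2 where "u2 x = indicator S x * u1 x" for x
  define F2 where "F2 x = indicator S x * F1 x" for x
  define G2 where "G2 x = indicator S x *\<^sub>R G1 x" for x
  have m2: "u2 \<in> borel_measurable borel" "F2 \<in> borel_measurable borel" "G2 \<in> borel_measurable borel"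
    unfolding u2_def F2_def G2_def by measurable
  have ae: "AE x in lborel. x \<in> ball y R \<longrightarrow> u x = u2 x \<and> G x = G2 x \<and> F x = F2 x"
    using u1e F1e G1e bnd
  proof eventually_elim
    fix x assume h: "x \<in> ?K \<longrightarrow> u x = u1 x" "x \<in> ?K \<longrightarrow> F x = F1 x" "x \<in> ?K \<longrightarrow> G x = G1 x"
      "x \<in> \<Omega> \<longrightarrow> norm (u x, G x) \<le> C \<and> \<bar>F x\<bar> \<le> L * norm (u x, G x)"
    show "x \<in> ball y R \<longrightarrow> u x = u2 x \<and> G x = G2 x \<and> F x = F2 x"
    proof
      assume x: "x \<in> ball y R"
      then have "x \<in> ?K" "x \<in> \<Omega>" using sub by auto
      then have e: "u x = u1 x" "F x = F1 x" "G x = G1 x" and "x \<in> S" using h x by (auto simp: S_def)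
      then show "u x = u2 x \<and> G x = G2 x \<and> F x = F2 x" by (simp add: u2_def G2_def F2_def)
    qed
  qed
  have out: "u2 x = 0 \<and> G2 x = 0 \<and> F2 x = 0" if "x \<notin> ball y R" for x
    using that by (simp add: u2_def G2_def F2_def S_def)
  have Ab: "bdiff_on (ball y R) A A'" by (rule bdiff_on_subset[OF A sub])
  have AG: "(\<lambda>x. A x *v G2 x) \<in> borel_measurable borel"
  proof (rule borel_measurable_matrix_field[where S="ball y R"])
    show "continuous_on (ball y R) A"
      using bdiff_onD[OF Ab] by (meson continuous_at_imp_continuous_on has_derivative_continuous)
  qed (use m2 out in auto)
  interpret ws: weak_solution_ball A A' y R \<kappa> u2 F2 G2 C L
  proof
    show "0 < R" by (rule R)
    show "0 < \<kappa>" by (rule kappa)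
    show "bdiff_on (ball y R) A A'" by (rule Ab)
    show "(A x *v g) \<bullet> h = g \<bullet> (A x *v h)" if "x \<in> ball y R" for x g h using sym that sub by blast
    show "(norm g)\<^sup>2 \<le> \<kappa> * ((A x *v g) \<bullet> g)" if "x \<in> ball y R" for x g using ell that sub by blast
    show "norm (u2 x, G2 x) \<le> C" for x
      using C by (cases "x \<in> S") (auto simp: u2_def G2_def S_def zero_prod_def[symmetric])
    show "\<bar>F2 x\<bar> \<le> L * norm (u2 x, G2 x)" for x
      using C by (cases "x \<in> S") (auto simp: u2_def G2_def F2_def S_def)
    show "u2 x = 0 \<and> G2 x = 0" if "x \<notin> ball y R" for x using out[OF that] by blast
    fix \<phi> :: "real ^ 'n \<Rightarrow> real" and R' assume sm: "smooth \<phi>" and R': "R' < R" and z: "\<And>x. x \<notin> cball y R' \<Longrightarrow> \<phi> x = 0"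
    have t: "test_function \<Omega> \<phi>"
      by (rule test_functionI[OF sm z]) (use R' R(2) in auto)
    have nin: "x \<notin> cball y R'" if "x \<notin> ball y R" for x using that R' by auto
    have pm [measurable]: "\<phi> \<in> borel_measurable borel" "\<And>i. partial i \<phi> \<in> borel_measurable borel"
      by (intro borel_measurable_continuous_onI smooth_continuous smooth_partial sm)+
    have gm: "(\<lambda>x. grad \<phi> x) \<in> borel_measurable borel"
      unfolding borel_measurable_euclidean_space[of "\<lambda>x. grad \<phi> x"] using pm by (auto simp: Basis_vec_def inner_axis)
    show "(\<integral>x. u2 x * partial i \<phi> x \<partial>lborel) = - (\<integral>x. G2 x $ i * \<phi> x \<partial>lborel)" for i
    proof -
      have "(\<integral>x. u x * partials [i] \<phi> x \<partial>lebesgue_on \<Omega>) = (\<integral>x. u2 x * partial i \<phi> x \<partial>lborel)"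
      proof (rule integral_lebesgue_on_eq[OF Oms])
        show "(\<lambda>x. u2 x * partial i \<phi> x) \<in> borel_measurable borel" using m2 pm by (intro borel_measurable_times)
        show "AE x in lborel. (if x \<in> \<Omega> then u x * partials [i] \<phi> x else 0) = u2 x * partial i \<phi> x"
          using ae
        proof eventually_elim
          fix x assume h: "x \<in> ball y R \<longrightarrow> u x = u2 x \<and> G x = G2 x \<and> F x = F2 x"
          show "(if x \<in> \<Omega> then u x * partials [i] \<phi> x else 0) = u2 x * partial i \<phi> x"
          proof (cases "x \<in> ball y R")
            case True then show ?thesis using h sub by (auto simp: partials_Cons)
          next
            case False
            then have "partial i \<phi> x = 0" by (intro partial_eq_0_outside[OF z nin]) auto
            then show ?thesis by (simp add: partials_Cons)
          qed
        qed
      qed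
      moreover have "(\<integral>x. G x $ i * \<phi> x \<partial>lebesgue_on \<Omega>) = (\<integral>x. G2 x $ i * \<phi> x \<partial>lborel)"
      proof (rule integral_lebesgue_on_eq[OF Oms])
        have "(\<lambda>x. (G2 x \<bullet> axis i 1) * \<phi> x) \<in> borel_measurable borel"
          using m2 pm by (intro borel_measurable_times borel_measurable_inner) auto
        then show "(\<lambda>x. G2 x $ i * \<phi> x) \<in> borel_measurable borel" by (simp add: inner_axis)
        show "AE x in lborel. (if x \<in> \<Omega> then G x $ i * \<phi> x else 0) = G2 x $ i * \<phi> x"
          using ae
        proof eventually_elim
          fix x assume h: "x \<in> ball y R \<longrightarrow> u x = u2 x \<and> G x = G2 x \<and> F x = F2 x"
          show "(if x \<in> \<Omega> then G x $ i * \<phi> x else 0) = G2 x $ i * \<phi> x"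
            using h sub z[OF nin] by (cases "x \<in> ball y R") auto
        qed
      qed
      ultimately show ?thesis using G[of i] t by (simp add: has_weak_deriv_def)
    qed
    show "(\<integral>x. (A x *v G2 x) \<bullet> grad \<phi> x \<partial>lborel) = (\<integral>x. F2 x * \<phi> x \<partial>lborel)"
    proof -
      have "(\<integral>x. (A x *v G x) \<bullet> grad \<phi> x \<partial>lebesgue_on \<Omega>) = (\<integral>x. (A x *v G2 x) \<bullet> grad \<phi> x \<partial>lborel)"
      proof (rule integral_lebesgue_on_eq[OF Oms])
        show "(\<lambda>x. (A x *v G2 x) \<bullet> grad \<phi> x) \<in> borel_measurable borel" by (rule borel_measurable_inner[OF AG gm])
        show "AE x in lborel. (if x \<in> \<Omega> then (A x *v G x) \<bullet> grad \<phi> x else 0) = (A x *v G2 x) \<bullet> grad \<phi> x"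
          using ae
        proof eventually_elim
          fix x assume h: "x \<in> ball y R \<longrightarrow> u x = u2 x \<and> G x = G2 x \<and> F x = F2 x"
          show "(if x \<in> \<Omega> then (A x *v G x) \<bullet> grad \<phi> x else 0) = (A x *v G2 x) \<bullet> grad \<phi> x"
          proof (cases "x \<in> ball y R")
            case True then show ?thesis using h sub by auto
          next
            case False
            then have "grad \<phi> x = 0" unfolding vec_eq_iff using partial_eq_0_outside[OF z nin] by simp
            then show ?thesis by simp
          qed
        qed
      qed
      moreover have "(\<integral>x. F x * \<phi> x \<partial>lebesgue_on \<Omega>) = (\<integral>x. F2 x * \<phi> x \<partial>lborel)"
      proof (rule integral_lebesgue_on_eq[OF Oms])
        show "(\<lambda>x. F2 x * \<phi> x) \<in> borel_measurable borel" using m2 pm by (intro borel_measurable_times)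
        show "AE x in lborel. (if x \<in> \<Omega> then F x * \<phi> x else 0) = F2 x * \<phi> x"
          using ae
        proof eventually_elim
          fix x assume h: "x \<in> ball y R \<longrightarrow> u x = u2 x \<and> G x = G2 x \<and> F x = F2 x"
          show "(if x \<in> \<Omega> then F x * \<phi> x else 0) = F2 x * \<phi> x"
            using h sub z[OF nin] by (cases "x \<in> ball y R") auto
        qed
      qed
      ultimately show ?thesis using eq[OF t] by simp
    qed
  qed (use m2 C in auto)
  have "AE z in lborel. z \<in> ball y r \<longrightarrow> u2 z = 0"
    using ae u0
  proof eventually_elim
    fix z assume "z \<in> ball y R \<longrightarrow> u z = u2 z \<and> G z = G2 z \<and> F z = F2 z" "z \<in> ball y r \<longrightarrow> u z = 0"
    then show "z \<in> ball y r \<longrightarrow> u2 z = 0" using out[of z] by (cases "z \<in> ball y R") auto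
  qed
  from ws.unique_continuation_ball[OF r this] ae
  show ?thesis by eventually_elim auto
qed

text \<open>The zero region is open by its definition. It is closed in \<Omega> because the radius
  gained by \<open>step\<close> depends only on the room inside \<Omega>, not on the size of the
  ball on which \<open>u\<close> was known to vanish.\<close>

lemma unique_continuation_connected:
  fixes u :: "'a::euclidean_space \<Rightarrow> real"
  assumes Om: "open \<Omega>" "connected \<Omega>" and om: "open \<omega>" "\<omega> \<noteq> {}" "\<omega> \<subseteq> \<Omega>"
    and u0: "AE z in lborel. z \<in> \<omega> \<longrightarrow> u z = 0"
    and step: "\<And>y r R. 0 < r \<Longrightarrow> 0 < R \<Longrightarrow> cball y R \<subseteq> \<Omega> \<Longrightarrow>
      AE z in lborel. z \<in> ball y r \<longrightarrow> u z = 0 \<Longrightarrow> AE z in lborel. z \<in> ball y R \<longrightarrow> u z = 0"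
  shows "AE z in lborel. z \<in> \<Omega> \<longrightarrow> u z = 0"
proof -
  define Z where "Z = {x\<in>\<Omega>. \<exists>r>0. AE z in lborel. z \<in> ball x r \<longrightarrow> u z = 0}"
  have "openin (top_of_set \<Omega>) Z"
    unfolding openin_contains_ball
  proof (intro conjI ballI)
    show "Z \<subseteq> \<Omega>" by (auto simp: Z_def)
    fix x assume "x \<in> Z"
    then obtain r where r: "r > 0" "AE z in lborel. z \<in> ball x r \<longrightarrow> u z = 0" by (auto simp: Z_def)
    have "ball x r \<inter> \<Omega> \<subseteq> Z"
    proof
      fix y assume y: "y \<in> ball x r \<inter> \<Omega>"
      have sub: "ball y (r - dist x y) \<subseteq> ball x r" by (rule ball_subset_ball_iff[THEN iffD2]) (simp add: dist_commute)
      have "AE z in lborel. z \<in> ball y (r - dist x y) \<longrightarrow> u z = 0" using r(2) by eventually_elim (use sub in blast)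
      then show "y \<in> Z" using y by (auto simp: Z_def intro!: exI[of _ "r - dist x y"])
    qed
    then show "\<exists>e>0. ball x e \<inter> \<Omega> \<subseteq> Z" using r(1) by blast
  qed
  moreover have "closedin (top_of_set \<Omega>) Z"
    unfolding closedin_closed
  proof (intro exI[of _ "closure Z"] conjI)
    show "Z = \<Omega> \<inter> closure Z"
    proof
      show "Z \<subseteq> \<Omega> \<inter> closure Z" using closure_subset[of Z] unfolding Z_def by blast
      show "\<Omega> \<inter> closure Z \<subseteq> Z"
      proof
        fix x assume x: "x \<in> \<Omega> \<inter> closure Z"
        with Om(1)[unfolded open_contains_cball] obtain \<rho> where rho: "\<rho> > 0" "cball x \<rho> \<subseteq> \<Omega>" by blast
        \<comment> \<open>With \<open>y\<close> this close to \<open>x\<close>, the ball of radius 2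
          \<rho> / 3 around \<open>y\<close> stays within distance \<rho> of \<open>x\<close> and
          still covers the ball of radius \<rho> / 3 around \<open>x\<close>.\<close>
        obtain y where y: "y \<in> Z" "dist y x < \<rho> / 3"
          using x rho(1) closure_approachable[of x Z] by (metis IntD2 divide_pos_pos zero_less_numeral)
        obtain r where r: "r > 0" "AE z in lborel. z \<in> ball y r \<longrightarrow> u z = 0" using y(1) by (auto simp: Z_def)
        have sub1: "cball y (2 * \<rho> / 3) \<subseteq> \<Omega>"
        proof
          fix z assume "z \<in> cball y (2 * \<rho> / 3)"
          then have "dist x z \<le> \<rho>" using y(2) dist_triangle[of x z y] by (simp add: dist_commute)
          then show "z \<in> \<Omega>" using rho(2) by auto
        qed
        have a: "AE z in lborel. z \<in> ball y (2 * \<rho> / 3) \<longrightarrow> u z = 0"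
          by (rule step[OF r(1) _ sub1 r(2)]) (use rho(1) in simp)
        have sub: "ball x (\<rho> / 3) \<subseteq> ball y (2 * \<rho> / 3)"
        proof
          fix z assume "z \<in> ball x (\<rho> / 3)"
          then show "z \<in> ball y (2 * \<rho> / 3)" using y(2) dist_triangle[of y z x] by simp
        qed
        have "AE z in lborel. z \<in> ball x (\<rho> / 3) \<longrightarrow> u z = 0" using a by eventually_elim (use sub in blast)
        then show "x \<in> Z" using x rho(1) by (auto simp: Z_def intro!: exI[of _ "\<rho> / 3"])
      qed
    qed
  qed simp
  moreover have "Z \<noteq> {}"
  proof -
    obtain x where x: "x \<in> \<omega>" using om(2) by blast
    from om(1)[unfolded open_contains_ball] x obtain r where r: "r > 0" "ball x r \<subseteq> \<omega>" by blast
    have "AE z in lborel. z \<in> ball x r \<longrightarrow> u z = 0" using u0 by eventually_elim (use r(2) in blast)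
    then show ?thesis using x om(3) r(1) by (auto simp: Z_def)
  qed
  ultimately have "Z = \<Omega>" using Om(2) connected_clopen by blast
  then have "\<exists>r>0. AE z in lborel. z \<in> ball x r \<longrightarrow> u z = 0" if "x \<in> \<Omega>" for x
    using that by (auto simp: Z_def)
  then show ?thesis by (rule AE_locally)
qed

section \<open>Reduction of the semilinear equation to a differential inequality\<close>

theorem corollary1p4:
  fixes \<Omega> \<omega> :: "(real ^ 'n) set"
    and A :: "real ^ 'n \<Rightarrow> real ^ 'n ^ 'n"
    and f :: "(real ^ 'n) \<times> (real \<times> (real ^ 'n)) \<Rightarrow> real"
    and u :: "real ^ 'n \<Rightarrow> real"
    and \<kappa> \<eta> :: real
  assumes "CARD('n) \<ge> 2"
    and "bounded \<Omega>" and "C11_domain \<Omega>"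
    and "\<And>x. x \<in> closure \<Omega> \<Longrightarrow> transpose (A x) = A x"
    and "\<And>k l. Ck1_closure 2 \<Omega> (\<lambda>x. A x $ k $ l)"
    and "\<kappa> > 1"
    and "\<And>x \<xi>. x \<in> closure \<Omega> \<Longrightarrow> inverse \<kappa> * (norm \<xi>)\<^sup>2 \<le> (A x *v \<xi>) \<bullet> \<xi>"
    and "\<And>k l. Ck1_norm 2 \<Omega> (\<lambda>x. A x $ k $ l) \<le> ennreal \<kappa>"
    and "admissible_nonlinearity \<Omega> f"
    and "open \<omega>" and "\<omega> \<noteq> {}" and "compactly_contained \<omega> \<Omega>"
    and "\<eta> > 0"
    and "mem_H (3 / 2 + \<eta>) \<Omega> u" and "mem_W1inf \<Omega> u"
    and "observation \<omega> \<Omega> A f u = 0"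
  shows "AE x in lebesgue_on \<Omega>. u x = 0"
proof -
  have Om: "open \<Omega>" "connected \<Omega>" using assms(3) by (auto simp: C11_domain_def)
  have Oms: "\<Omega> \<in> sets lebesgue" using Om by simp
  have inc: "x \<in> closure \<Omega>" if "x \<in> \<Omega>" for x using that closure_subset by blast
  have A: "bdiff_on \<Omega> A (\<lambda>x h. \<chi> k l. grad (\<lambda>x. A x $ k $ l) x \<bullet> h)"
  proof (intro bdiff_on_vec)
    fix k l
    show "bdiff_on \<Omega> (\<lambda>x. A x $ k $ l) (\<lambda>x h. (\<chi> k l. grad (\<lambda>x. A x $ k $ l) x \<bullet> h) $ k $ l)"
      using Ck1_closure_bdiff_on[OF assms(5) _ assms(2), of k l] by simp
  qed
  have sym: "(A x *v g) \<bullet> h = g \<bullet> (A x *v h)" if "x \<in> \<Omega>" for x g h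
    using dot_lmul_matrix[of g "A x" h] transpose_matrix_vector[of "A x" g] assms(4)[OF inc[OF that]] by simp
  have ell: "(norm g)\<^sup>2 \<le> \<kappa> * ((A x *v g) \<bullet> g)" if "x \<in> \<Omega>" for x g
    using assms(7)[OF inc[OF that], of g] assms(6) by (simp add: field_simps)
  define G where "G = weak_gradient \<Omega> u"
  have "\<exists>v. has_weak_deriv \<Omega> [i] u v \<and> mem_Linf \<Omega> v" for i using assms(15) by (simp add: mem_W1inf_def)
  then obtain v where v: "\<And>i. has_weak_deriv \<Omega> [i] u (v i)" "\<And>i. mem_Linf \<Omega> (v i)" by metis
  \<comment> \<open>The components are assembled into one vector field as a witness, so that the
    choice made in \<open>weak_gradient\<close> is known to be a weak gradient.\<close>
  have "\<forall>i. has_weak_deriv \<Omega> [i] u (\<lambda>x. (\<chi> i. v i x) $ i)" using v(1) by simp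
  then have "\<forall>i. has_weak_deriv \<Omega> [i] u (\<lambda>x. G x $ i)"
    unfolding G_def weak_gradient_def
    by (rule someI[where P="\<lambda>G. \<forall>i. has_weak_deriv \<Omega> [i] u (\<lambda>x. G x $ i)"])
  then have G: "has_weak_deriv \<Omega> [i] u (\<lambda>x. G x $ i)" for i ..
  have "\<exists>c. AE x in lborel. x \<in> \<Omega> \<longrightarrow> \<bar>v i x\<bar> \<le> c" for i
    using v(2)[of i] AE_lebesgue_on_iff[OF Oms] by (simp add: mem_Linf_def)
  then obtain c where c: "\<And>i. AE x in lborel. x \<in> \<Omega> \<longrightarrow> \<bar>v i x\<bar> \<le> c i" by metis
  obtain cu where cu: "AE x in lborel. x \<in> \<Omega> \<longrightarrow> \<bar>u x\<bar> \<le> cu"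
    using assms(15) AE_lebesgue_on_iff[OF Oms] by (auto simp: mem_W1inf_def mem_Linf_def)
  \<comment> \<open>The summand 1 makes \<open>C\<close> positive, since the growth condition is
    stated for positive radii and is applied with this one.\<close>
  define C where "C = \<bar>cu\<bar> + (\<Sum>i\<in>UNIV. \<bar>c i\<bar>) + 1"
  have C: "C > 0" unfolding C_def by (simp add: add_nonneg_pos sum_nonneg)
  have "AE x in lborel. x \<in> \<Omega> \<longrightarrow> \<bar>G x $ i\<bar> \<le> c i" for i
    using weak_deriv_unique[OF Om(1) G[of i] v(1)[of i]] c[of i] by eventually_elim auto
  then have "AE x in lborel. \<forall>i. x \<in> \<Omega> \<longrightarrow> \<bar>G x $ i\<bar> \<le> c i" unfolding AE_all_countable by blast
  then have UC: "AE x in lborel. x \<in> \<Omega> \<longrightarrow> norm (u x, G x) \<le> C"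
    using cu
  proof eventually_elim
    fix x assume h: "\<forall>i. x \<in> \<Omega> \<longrightarrow> \<bar>G x $ i\<bar> \<le> c i" "x \<in> \<Omega> \<longrightarrow> \<bar>u x\<bar> \<le> cu"
    show "x \<in> \<Omega> \<longrightarrow> norm (u x, G x) \<le> C"
    proof
      assume x: "x \<in> \<Omega>"
      have "norm (G x) \<le> (\<Sum>i\<in>UNIV. \<bar>G x $ i\<bar>)" by (rule norm_le_l1_cart)
      also have "\<dots> \<le> (\<Sum>i\<in>UNIV. \<bar>c i\<bar>)" by (rule sum_mono) (use h(1) x in \<open>auto intro: order_trans[OF _ abs_ge_self]\<close>)
      finally have "norm (G x) \<le> (\<Sum>i\<in>UNIV. \<bar>c i\<bar>)" .
      then show "norm (u x, G x) \<le> C" using norm_Pair_le[of "u x" "G x"] h(2) x by (simp add: C_def)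
    qed
  qed
  define F where "F = nonlinear_term \<Omega> f u"
  \<comment> \<open>The exceptional null set does not depend on \<open>z\<close>, so the pair of
    \<open>u x\<close> and \<open>G x\<close> may be inserted for \<open>z\<close> point by
    point.\<close>
  obtain g where g: "mem_Linf \<Omega> g" "AE x in lebesgue_on \<Omega>. 0 \<le> g x \<and> (\<forall>z. norm z \<le> C \<longrightarrow> \<bar>f (x, z)\<bar> \<le> g x * norm z)"
    using assms(9) C unfolding admissible_nonlinearity_def by blast
  obtain L where L: "AE x in lebesgue_on \<Omega>. \<bar>g x\<bar> \<le> L" using g(1) by (auto simp: mem_Linf_def)
  have bnd: "AE x in lborel. x \<in> \<Omega> \<longrightarrow> norm (u x, G x) \<le> C \<and> \<bar>F x\<bar> \<le> \<bar>L\<bar> * norm (u x, G x)"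
    using UC g(2)[unfolded AE_lebesgue_on_iff[OF Oms]] L[unfolded AE_lebesgue_on_iff[OF Oms]]
  proof eventually_elim
    fix x assume h: "x \<in> \<Omega> \<longrightarrow> norm (u x, G x) \<le> C"
      "x \<in> \<Omega> \<longrightarrow> 0 \<le> g x \<and> (\<forall>z. norm z \<le> C \<longrightarrow> \<bar>f (x, z)\<bar> \<le> g x * norm z)" "x \<in> \<Omega> \<longrightarrow> \<bar>g x\<bar> \<le> L"
    show "x \<in> \<Omega> \<longrightarrow> norm (u x, G x) \<le> C \<and> \<bar>F x\<bar> \<le> \<bar>L\<bar> * norm (u x, G x)"
    proof
      assume x: "x \<in> \<Omega>"
      then have "\<bar>F x\<bar> \<le> g x * norm (u x, G x)" using h by (simp add: F_def nonlinear_term_def G_def)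
      also have "\<dots> \<le> \<bar>L\<bar> * norm (u x, G x)" using h(3) x by (intro mult_right_mono) auto
      finally show "norm (u x, G x) \<le> C \<and> \<bar>F x\<bar> \<le> \<bar>L\<bar> * norm (u x, G x)" using h(1) x by blast
    qed
  qed
  have F: "locally_integrable \<Omega> F" unfolding F_def by (rule observation_eq_0D(2)[OF assms(16)])
  have eq: "(\<integral>x. (A x *v G x) \<bullet> grad \<phi> x \<partial>lebesgue_on \<Omega>) = (\<integral>x. F x * \<phi> x \<partial>lebesgue_on \<Omega>)"
    if "test_function \<Omega> \<phi>" for \<phi>
    using observation_eq_0D(3)[OF assms(16) that] by (simp add: semilinear_op_def F_def G_def)
  have om: "\<omega> \<subseteq> \<Omega>" using assms(12) closure_subset unfolding compactly_contained_def by blast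
  have u0: "AE z in lborel. z \<in> \<omega> \<longrightarrow> u z = 0"
    using observation_eq_0D(1)[OF assms(16)] AE_lebesgue_on_iff[of \<omega>] assms(10) by simp
  have "AE z in lborel. z \<in> \<Omega> \<longrightarrow> u z = 0"
  proof (rule unique_continuation_connected[OF Om assms(10,11) om u0])
    fix y r R
    assume h: "0 < r" "0 < R" "cball y R \<subseteq> \<Omega>" "AE z in lborel. z \<in> ball y r \<longrightarrow> u z = 0"
    have k: "0 < \<kappa>" "0 \<le> C" "0 \<le> \<bar>L\<bar>" using assms(6) C by auto
    show "AE z in lborel. z \<in> ball y R \<longrightarrow> u z = 0"
      by (rule unique_continuation_step[OF Om(1) A k(1) sym ell G F eq k(2,3) bnd h(2,3,1,4)])
  qed
  then show ?thesis using AE_lebesgue_on_iff[OF Oms] by blast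
qed

end
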